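(* Let $G$ be a plane network with root vertex $\rho$, and let $\mathcal S_\rho$ be the rectangle tiling of $G$ in the cylinder $\mathbb R/\eta\mathbb Z\times[0,1]$. Let $\langle X_n\rangle_{n\geq 0}$ be the random walk on $G$ started at $\rho$. Suppose that, almost surely, $\theta(X_n)$ converges to a point of $\mathbb R/\eta\mathbb Z$ and $\mathrm{length}(I(X_n))\to 0$ as $n\to\infty$. Then for every bounded harmonic function $h$ on $G$ there exists a bounded Borel function $f:\mathbb R/\eta\mathbb Z\to\mathbb R$ such that \[ h(v)=E_v\Big[f\Big(\lim_{n\to\infty}\theta(X_n)\Big)\Big] \quad\text{for every } v\in V,\] where $E_v$ is the expectation for the random walk started at $v$.
   Context: A network $(G,c)$ is a connected, locally finite graph $G=(V,E)$ (self-loops and multiple edges allowed) with conductances $c:E\to(0,\infty)$; $c(v)$ is the sum of conductances of edges at $v$, $c(u,v)$ the sum of conductances of edges joining $u$ and $v$, and the random walk has transition probabilities $p(u,v)=c(u,v)/c(u)$. $P_v,E_v$ denote law and expectation of the walk started at $v$. A function $h:V\to\mathbb R$ is harmonic if $h(u)=\sum_v p(u,v)h(v)$ for all $u$. Let $\mathbb G$ be the metric graph obtained from $V$ and one copy $[0,1]$ per edge glued at the endpoints. An embedding of $G$ into a surface $S$ is a continuous injective map $\mathbb G\to S$; a plane network is a network together with an embedding into $\mathbb R^2$. Rectangle tiling: fix a root $\rho\in V$; let $y(v)=P_v(\text{the walk never visits }\rho)$ and $\eta=\sum_{u\sim\rho}c(\rho,u)y(u)$. The rectangle tiling (constructed by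 Benjamini and Schramm for transient, uniquely absorbing plane networks) is a collection $\mathcal S_\rho=\{S(e):e\in E\}$ such that: (1) for each oriented edge $e$ from $e^-$ to $e^+$ with $y(e^+)\geq y(e^-)$, $S(e)=I(e)\times[y(e^-),y(e^+)]\subseteq\mathbb R/\eta\mathbb Z\times[0,1)$ where $I(e)\subseteq\mathbb R/\eta\mathbb Z$ is an interval of length $c(e)(y(e^+)-y(e^-))$, and $I(e)=I(-e)$, $S(e)=S(-e)$ otherwise; (2) the interiors of the $S(e)$ are disjoint and their union is $\mathbb R/\eta\mathbb Z\times[0,1)$; (3) for each vertex $v$, $I(v):=\bigcup_{e^-=v}I(e)$ is an interval and equals $\bigcup_{e^+=v}I(e)$; (4) for a.e. $\theta$ and every $t\in[0,1)$, the segment $\{\theta\}\times[0,t]$ meets only finitely many rectangles; (5) the interiors of vertical sides of $S(e_1),S(e_2)$ intersect only if $e_1,e_2$ lie on the boundary of a common face. For each $v$, $\theta(v)$ is a point chosen arbitrarily in $I(v)$. *)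

theory Defs
  imports "HOL-Probability.Probability"
begin

section \<open>Networks\<close>

text \<open>A network: vertex set = the type 'v, edge set = the type 'e, each edge e has
  (ordered, but only used up to order) endpoints ends e; self-loops and multiple edges allowed.
  c are the conductances.\<close>

definition incident :: "('e \<Rightarrow> 'v \<times> 'v) \<Rightarrow> 'v \<Rightarrow> 'e set" where
  "incident ends v = {e. fst (ends e) = v \<or> snd (ends e) = v}"

definition adj :: "('e \<Rightarrow> 'v \<times> 'v) \<Rightarrow> 'v \<Rightarrow> 'v \<Rightarrow> bool" where
  "adj ends u w \<longleftrightarrow> (\<exists>e. ends e = (u, w) \<or> ends e = (w, u))"

definition nbrs :: "('e \<Rightarrow> 'v \<times> 'v) \<Rightarrow> 'v \<Rightarrow> 'v set" where
  "nbrs ends u = {w. adj ends u w}"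

definition network :: "('e \<Rightarrow> 'v \<times> 'v) \<Rightarrow> ('e \<Rightarrow> real) \<Rightarrow> bool" where
  "network ends c \<longleftrightarrow> (\<forall>e. 0 < c e) \<and> (\<forall>v. finite (incident ends v))
     \<and> (\<forall>u w. (u, w) \<in> {(x, y). adj ends x y}\<^sup>*)"

text \<open>c(u,w): sum of conductances of edges joining u and w; c(u): sum over edges at u
  (a self-loop counted once, so that c(u) = sum over w of c(u,w)).\<close>

definition cond_pair :: "('e \<Rightarrow> 'v \<times> 'v) \<Rightarrow> ('e \<Rightarrow> real) \<Rightarrow> 'v \<Rightarrow> 'v \<Rightarrow> real" where
  "cond_pair ends c u w = (\<Sum>e\<in>{e. ends e = (u, w) \<or> ends e = (w, u)}. c e)"

definition cond_vert :: "('e \<Rightarrow> 'v \<times> 'v) \<Rightarrow> ('e \<Rightarrow> real) \<Rightarrow> 'v \<Rightarrow> real" where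
  "cond_vert ends c u = (\<Sum>e\<in>incident ends u. c e)"

definition trans_prob :: "('e \<Rightarrow> 'v \<times> 'v) \<Rightarrow> ('e \<Rightarrow> real) \<Rightarrow> 'v \<Rightarrow> 'v \<Rightarrow> real" where
  "trans_prob ends c u w = cond_pair ends c u w / cond_vert ends c u"

definition harmonic :: "('e \<Rightarrow> 'v \<times> 'v) \<Rightarrow> ('e \<Rightarrow> real) \<Rightarrow> ('v \<Rightarrow> real) \<Rightarrow> bool" where
  "harmonic ends c h \<longleftrightarrow> (\<forall>u. h u = (\<Sum>w\<in>nbrs ends u. trans_prob ends c u w * h w))"

section \<open>The random walk\<close>

definition walk_space :: "(nat \<Rightarrow> 'v) measure" where
  "walk_space = PiM UNIV (\<lambda>_. count_space UNIV)"

text \<open>M is the law P_v of the random walk started at v (on the product sigma-algebra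
  of trajectories): characterised by its finite-dimensional distributions.\<close>

definition rw_law :: "('e \<Rightarrow> 'v \<times> 'v) \<Rightarrow> ('e \<Rightarrow> real) \<Rightarrow> 'v \<Rightarrow> (nat \<Rightarrow> 'v) measure \<Rightarrow> bool" where
  "rw_law ends c v M \<longleftrightarrow> prob_space M \<and> sets M = sets walk_space \<and>
     (\<forall>n (x :: nat \<Rightarrow> 'v). emeasure M {\<omega> \<in> space M. \<forall>i\<le>n. \<omega> i = x i} =
        ennreal (if x 0 = v then (\<Prod>i<n. trans_prob ends c (x i) (x (Suc i))) else 0))"

definition transient_at :: "('v \<Rightarrow> (nat \<Rightarrow> 'v) measure) \<Rightarrow> 'v \<Rightarrow> bool" where
  "transient_at P \<rho> \<longleftrightarrow> measure (P \<rho>) {\<omega>. \<exists>n\<ge>1. \<omega> n = \<rho>} < 1"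

text \<open>y(v) = P_v(the walk never visits rho), and eta.\<close>

definition esc :: "('v \<Rightarrow> (nat \<Rightarrow> 'v) measure) \<Rightarrow> 'v \<Rightarrow> 'v \<Rightarrow> real" where
  "esc P \<rho> v = measure (P v) {\<omega>. \<forall>n. \<omega> n \<noteq> \<rho>}"

definition eta :: "('e \<Rightarrow> 'v \<times> 'v) \<Rightarrow> ('e \<Rightarrow> real) \<Rightarrow> ('v \<Rightarrow> (nat \<Rightarrow> 'v) measure) \<Rightarrow> 'v \<Rightarrow> real" where
  "eta ends c P \<rho> = (\<Sum>u\<in>nbrs ends \<rho>. cond_pair ends c \<rho> u * esc P \<rho> u)"

section \<open>Plane embeddings\<close>

text \<open>An embedding of the metric graph into the plane (= complex numbers): vertex positions
  pos, and for each edge e a map gamma e on [0,1] (the copy of [0,1] for e).  A map from the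
  metric graph (a locally finite CW complex) is continuous iff it is continuous on each
  closed edge; injectivity on the metric graph is spelled out.\<close>

definition plane_embedding ::
  "('e \<Rightarrow> 'v \<times> 'v) \<Rightarrow> ('v \<Rightarrow> complex) \<Rightarrow> ('e \<Rightarrow> real \<Rightarrow> complex) \<Rightarrow> bool" where
  "plane_embedding ends pos \<gamma> \<longleftrightarrow> inj pos \<and>
     (\<forall>e. continuous_on {0..1} (\<gamma> e) \<and> \<gamma> e 0 = pos (fst (ends e)) \<and> \<gamma> e 1 = pos (snd (ends e))) \<and>
     (\<forall>e t. t \<in> {0<..<1} \<longrightarrow> \<gamma> e t \<notin> range pos) \<and>
     (\<forall>e e' t t'. t \<in> {0<..<1} \<longrightarrow> t' \<in> {0<..<1} \<longrightarrow> \<gamma> e t = \<gamma> e' t' \<longrightarrow> e = e' \<and> t = t')"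

definition graph_image :: "('v \<Rightarrow> complex) \<Rightarrow> ('e \<Rightarrow> real \<Rightarrow> complex) \<Rightarrow> complex set" where
  "graph_image pos \<gamma> = range pos \<union> (\<Union>e. \<gamma> e ` {0..1})"

definition is_face :: "('v \<Rightarrow> complex) \<Rightarrow> ('e \<Rightarrow> real \<Rightarrow> complex) \<Rightarrow> complex set \<Rightarrow> bool" where
  "is_face pos \<gamma> F \<longleftrightarrow>
     (\<exists>z. z \<notin> graph_image pos \<gamma> \<and> F = connected_component_set (- graph_image pos \<gamma>) z)"

definition common_face :: "('v \<Rightarrow> complex) \<Rightarrow> ('e \<Rightarrow> real \<Rightarrow> complex) \<Rightarrow> 'e \<Rightarrow> 'e \<Rightarrow> bool" where
  "common_face pos \<gamma> e1 e2 \<longleftrightarrow>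
     (\<exists>F. is_face pos \<gamma> F \<and> \<gamma> e1 ` {0..1} \<subseteq> frontier F \<and> \<gamma> e2 ` {0..1} \<subseteq> frontier F)"

section \<open>The cylinder R/eta Z x [0,1)\<close>

text \<open>Subsets of R/eta Z are represented by their eta-periodic lifts to R; the closed
  interval of R/eta Z starting at a of length l lifts to arc eta a l.  Points of R/eta Z are
  represented by points of the unit circle in C via circ_pt.\<close>

definition arc :: "real \<Rightarrow> real \<Rightarrow> real \<Rightarrow> real set" where
  "arc \<eta> a l = {x. \<exists>k::int. a + of_int k * \<eta> \<le> x \<and> x \<le> a + of_int k * \<eta> + l}"

definition is_arc :: "real \<Rightarrow> real set \<Rightarrow> bool" where
  "is_arc \<eta> S \<longleftrightarrow> (\<exists>a l. 0 \<le> l \<and> l \<le> \<eta> \<and> S = arc \<eta> a l)"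

definition arc_length :: "real \<Rightarrow> real set \<Rightarrow> real" where
  "arc_length \<eta> S = measure lborel (S \<inter> {0..<\<eta>})"

definition circ_pt :: "real \<Rightarrow> real \<Rightarrow> complex" where
  "circ_pt \<eta> x = cis (2 * pi * x / \<eta>)"

section \<open>Rectangle tiling\<close>

text \<open>The tiling is encoded by a e, the starting point of I(e); its length is forced by (1).\<close>

definition y_lo :: "('e \<Rightarrow> 'v \<times> 'v) \<Rightarrow> ('v \<Rightarrow> (nat \<Rightarrow> 'v) measure) \<Rightarrow> 'v \<Rightarrow> 'e \<Rightarrow> real" where
  "y_lo ends P \<rho> e = min (esc P \<rho> (fst (ends e))) (esc P \<rho> (snd (ends e)))"

definition y_hi :: "('e \<Rightarrow> 'v \<times> 'v) \<Rightarrow> ('v \<Rightarrow> (nat \<Rightarrow> 'v) measure) \<Rightarrow> 'v \<Rightarrow> 'e \<Rightarrow> real" where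
  "y_hi ends P \<rho> e = max (esc P \<rho> (fst (ends e))) (esc P \<rho> (snd (ends e)))"

definition tile_len :: "('e \<Rightarrow> 'v \<times> 'v) \<Rightarrow> ('e \<Rightarrow> real) \<Rightarrow> ('v \<Rightarrow> (nat \<Rightarrow> 'v) measure) \<Rightarrow> 'v \<Rightarrow> 'e \<Rightarrow> real" where
  "tile_len ends c P \<rho> e = c e * (y_hi ends P \<rho> e - y_lo ends P \<rho> e)"

definition tile_int :: "('e \<Rightarrow> 'v \<times> 'v) \<Rightarrow> ('e \<Rightarrow> real) \<Rightarrow> ('v \<Rightarrow> (nat \<Rightarrow> 'v) measure) \<Rightarrow> 'v
    \<Rightarrow> ('e \<Rightarrow> real) \<Rightarrow> 'e \<Rightarrow> real set" where
  "tile_int ends c P \<rho> a e = arc (eta ends c P \<rho>) (a e) (tile_len ends c P \<rho> e)"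

definition tile_rect :: "('e \<Rightarrow> 'v \<times> 'v) \<Rightarrow> ('e \<Rightarrow> real) \<Rightarrow> ('v \<Rightarrow> (nat \<Rightarrow> 'v) measure) \<Rightarrow> 'v
    \<Rightarrow> ('e \<Rightarrow> real) \<Rightarrow> 'e \<Rightarrow> (real \<times> real) set" where
  "tile_rect ends c P \<rho> a e = tile_int ends c P \<rho> a e \<times> {y_lo ends P \<rho> e .. y_hi ends P \<rho> e}"

text \<open>Open vertical sides of S(e) (lifted).\<close>
definition tile_vsides :: "('e \<Rightarrow> 'v \<times> 'v) \<Rightarrow> ('e \<Rightarrow> real) \<Rightarrow> ('v \<Rightarrow> (nat \<Rightarrow> 'v) measure) \<Rightarrow> 'v
    \<Rightarrow> ('e \<Rightarrow> real) \<Rightarrow> 'e \<Rightarrow> (real \<times> real) set" where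
  "tile_vsides ends c P \<rho> a e =
     {x. \<exists>k::int. x = a e + of_int k * eta ends c P \<rho>
                 \<or> x = a e + tile_len ends c P \<rho> e + of_int k * eta ends c P \<rho>}
     \<times> {y_lo ends P \<rho> e <..< y_hi ends P \<rho> e}"

text \<open>Oriented edge (e,u,w) from u to w with y(w) >= y(u).\<close>
definition up_edge :: "('e \<Rightarrow> 'v \<times> 'v) \<Rightarrow> ('v \<Rightarrow> (nat \<Rightarrow> 'v) measure) \<Rightarrow> 'v \<Rightarrow> 'e \<Rightarrow> 'v \<Rightarrow> 'v \<Rightarrow> bool" where
  "up_edge ends P \<rho> e u w \<longleftrightarrow> (ends e = (u, w) \<or> ends e = (w, u)) \<and> esc P \<rho> u \<le> esc P \<rho> w"

definition vert_int :: "('e \<Rightarrow> 'v \<times> 'v) \<Rightarrow> ('e \<Rightarrow> real) \<Rightarrow> ('v \<Rightarrow> (nat \<Rightarrow> 'v) measure) \<Rightarrow> 'v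
    \<Rightarrow> ('e \<Rightarrow> real) \<Rightarrow> 'v \<Rightarrow> real set" where
  "vert_int ends c P \<rho> a v = \<Union>{tile_int ends c P \<rho> a e | e w. up_edge ends P \<rho> e v w}"

definition vert_int_in :: "('e \<Rightarrow> 'v \<times> 'v) \<Rightarrow> ('e \<Rightarrow> real) \<Rightarrow> ('v \<Rightarrow> (nat \<Rightarrow> 'v) measure) \<Rightarrow> 'v
    \<Rightarrow> ('e \<Rightarrow> real) \<Rightarrow> 'v \<Rightarrow> real set" where
  "vert_int_in ends c P \<rho> a v = \<Union>{tile_int ends c P \<rho> a e | e u. up_edge ends P \<rho> e u v}"

definition rectangle_tiling ::
  "('e \<Rightarrow> 'v \<times> 'v) \<Rightarrow> ('e \<Rightarrow> real) \<Rightarrow> ('v \<Rightarrow> (nat \<Rightarrow> 'v) measure) \<Rightarrow> 'v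
    \<Rightarrow> ('v \<Rightarrow> complex) \<Rightarrow> ('e \<Rightarrow> real \<Rightarrow> complex) \<Rightarrow> ('e \<Rightarrow> real) \<Rightarrow> bool" where
  "rectangle_tiling ends c P \<rho> pos \<gamma> a \<longleftrightarrow>
     \<comment> \<open>(1) I(e) is an interval of R/eta Z of length c(e)(y(e+)-y(e-))\<close>
     (\<forall>e. tile_len ends c P \<rho> e \<le> eta ends c P \<rho>) \<and>
     \<comment> \<open>(2)\<close>
     (\<forall>e1 e2. e1 \<noteq> e2 \<longrightarrow>
        interior (tile_rect ends c P \<rho> a e1) \<inter> interior (tile_rect ends c P \<rho> a e2) = {}) \<and>
     (\<Union>e. tile_rect ends c P \<rho> a e) = UNIV \<times> {0..<1} \<and>
     \<comment> \<open>(3)\<close>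
     (\<forall>v. is_arc (eta ends c P \<rho>) (vert_int ends c P \<rho> a v)) \<and>
     (\<forall>v. v \<noteq> \<rho> \<longrightarrow> vert_int ends c P \<rho> a v = vert_int_in ends c P \<rho> a v) \<and>
     \<comment> \<open>(4)\<close>
     (AE x in lborel. \<forall>t\<in>{0..<1}.
        finite {e. tile_rect ends c P \<rho> a e \<inter> ({x} \<times> {0..t}) \<noteq> {}}) \<and>
     \<comment> \<open>(5)\<close>
     (\<forall>e1 e2. e1 \<noteq> e2 \<longrightarrow>
        tile_vsides ends c P \<rho> a e1 \<inter> tile_vsides ends c P \<rho> a e2 \<noteq> {} \<longrightarrow>
        common_face pos \<gamma> e1 e2)"

end

(* Write y(v) for the escape probability and H for the limit of h(X_n), which exists by martingale
   convergence. It suffices to show that H is a function of the landing point lim theta(X_n).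

   The landing point has no atoms: cutting the submartingale y(X_n) off below a level t close to 1
   gives a compensator that lives on vertices with an edge crossing level t. By reversibility its
   expected mass at such a vertex is at most a constant times the total width of the tiles of
   these edges, so the part picked up near a point xi of the circle is small; but if the walk
   lands at xi with high probability, almost all of it is picked up there.

   Let X be a typical walk with landing point xi, and let v = Y_n be a late position of a walk Y.
   Since no landing law has atoms, xi typically lies in the middle of the landing law from v when
   xi is the landing point of Y: walks Z, Z' from v land on either side of xi with probability at
   least delta each, while they stay high up, close to v, and keep h nearly constant with
   probability more than 1 - delta. By planarity (Fashoda's theorem on crossing paths, applied to
   curves running through the interiors of the tiles) such a Z or Z' visits a vertex of the tail of
   X, so H(X) is close to h(v). Reading off h(v) at a vertex v having xi in its middle thus
   approximates H by a Borel function of the landing point. *)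

theory Submission
  imports Defs
begin

subsection \<open>The walk\<close>

text \<open>Two normalisations make the compensator bound work. The expected number of visits to
  \<open>u\<close> from a fixed vertex is, by reversibility, at most a constant times
  \<open>cond_vert ends c u * hit u\<close> with \<open>hit = 1 - y\<close>; and the factor
  \<open>hit u\<close> cancels the slope \<open>1 / (1 - t)\<close> of the truncated height, which
  leaves at most the flow through the edges crossing level \<open>t\<close>, that is, widths of
  tiles. Tiles of length 0 are an obstacle to the planar argument, since disjointness of interiors
  says nothing about them. So the curves are drawn only through vertices with non-degenerate arcs. X
  has to come from below the walks it is compared with. This fixes the order of choices: a time m
  after which X is tame, a height s above that of X at time m, then a vertex v from which walks stay
  above s. Such a v need not lie on a particular walk, so it can be selected from a fixed
  enumeration by looking at the landing point alone; hence the approximating function is Borel. All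
  curves stay in a window of one period, where the cylinder is a plane strip.\<close>

locale network_walk =
  fixes ends :: "'e \<Rightarrow> 'v \<times> 'v" and c :: "'e \<Rightarrow> real"
    and P :: "'v \<Rightarrow> (nat \<Rightarrow> 'v) measure"
  assumes net: "network ends c" and law: "\<And>v. rw_law ends c v (P v)"
begin

abbreviation "nb \<equiv> nbrs ends"
abbreviation "tp \<equiv> trans_prob ends c"

section \<open>Conductances and transition probabilities\<close>

lemma c_pos: "0 < c e"
  and finite_incident: "finite (incident ends v)"
  and connected: "(u, w) \<in> {(x, y). adj ends x y}\<^sup>*"
  using net by (auto simp: network_def)

lemma finite_nb [simp, intro]: "finite (nb u)"
proof -
  have "nb u \<subseteq> (fst \<circ> ends) ` incident ends u \<union> (snd \<circ> ends) ` incident ends u"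
  proof
    fix w assume "w \<in> nb u"
    then obtain e where "ends e = (u, w) \<or> ends e = (w, u)" by (auto simp: nbrs_def adj_def)
    then show "w \<in> (fst \<circ> ends) ` incident ends u \<union> (snd \<circ> ends) ` incident ends u"
      by (auto simp: incident_def intro!: image_eqI[of _ _ e])
  qed
  then show ?thesis
    using finite_incident by (meson finite_UnI finite_imageI finite_subset)
qed

lemma adj_sym: "adj ends u w \<longleftrightarrow> adj ends w u"
  by (auto simp: adj_def)

lemma nb_sym: "w \<in> nb u \<longleftrightarrow> u \<in> nb w"
  by (auto simp: nbrs_def adj_sym)

lemma cond_pair_sym: "cond_pair ends c u w = cond_pair ends c w u"
  unfolding cond_pair_def by (rule sum.cong) auto

lemma cond_pair_nonneg: "0 \<le> cond_pair ends c u w"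
  unfolding cond_pair_def using c_pos by (intro sum_nonneg) (auto simp: less_imp_le)

lemma cond_vert_nonneg: "0 \<le> cond_vert ends c u"
  unfolding cond_vert_def using c_pos by (intro sum_nonneg) (auto simp: less_imp_le)

lemma p_nonneg [simp]: "0 \<le> tp u w"
  unfolding trans_prob_def using cond_pair_nonneg cond_vert_nonneg by simp

lemma p_eq_0: "w \<notin> nb u \<Longrightarrow> tp u w = 0"
  unfolding trans_prob_def cond_pair_def nbrs_def adj_def by simp

lemma finite_joining: "finite {e. ends e = (u, w) \<or> ends e = (w, u)}"
  by (rule finite_subset[OF _ finite_incident[of u]]) (auto simp: incident_def)

lemma p_pos:
  assumes "w \<in> nb u" shows "0 < tp u w"
proof -
  obtain e where e: "ends e = (u, w) \<or> ends e = (w, u)"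
    using assms by (auto simp: nbrs_def adj_def)
  have "0 < cond_pair ends c u w"
    unfolding cond_pair_def using e c_pos finite_joining
    by (intro sum_pos) auto
  moreover have "e \<in> incident ends u"
    using e by (auto simp: incident_def)
  then have "0 < cond_vert ends c u"
    unfolding cond_vert_def using c_pos finite_incident by (intro sum_pos) auto
  ultimately show ?thesis by (simp add: trans_prob_def)
qed

text \<open>Balls around one vertex are finite by local finiteness and exhaust the graph by
  connectedness. Countability lets null sets and measurable sets be united over all vertices or over
  all finite paths.\<close>

lemma countable_V: "countable (UNIV :: 'v set)"
proof -
  define B :: "nat \<Rightarrow> 'v set" where "B n = ((\<lambda>S. \<Union>u\<in>S. nb u) ^^ n) {undefined}" for n
  have fin: "finite (B n)" for n
    by (induction n) (auto simp: B_def)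
  have "\<exists>n. w \<in> B n" if "(undefined, w) \<in> {(x, y). adj ends x y}\<^sup>*" for w
    using that
  proof induction
    case base
    have "undefined \<in> B 0" by (simp add: B_def)
    then show ?case by blast
  next
    case (step u w)
    then obtain n where "u \<in> B n" by blast
    then have "w \<in> B (Suc n)" using step(2) by (auto simp: B_def nbrs_def)
    then show ?case by blast
  qed
  then have "(UNIV :: 'v set) = (\<Union>n. B n)"
    using connected by blast
  then show ?thesis
    using fin by (metis countable_UN countable_finite countableI_type)
qed

section \<open>Trajectories, shifts and cylinders\<close>

lemma space_walk [simp]: "space (walk_space :: (nat \<Rightarrow> 'v) measure) = UNIV"
  by (auto simp: walk_space_def space_PiM)

lemma sets_P [simp, measurable_cong]: "sets (P v) = sets walk_space"
  using law by (auto simp: rw_law_def)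

lemma space_P [simp]: "space (P v) = UNIV"
  using sets_eq_imp_space_eq[OF sets_P] by simp

lemma prob_P: "prob_space (P v)"
  using law by (auto simp: rw_law_def)

sublocale PS: prob_space "P v" for v
  by (rule prob_P)

lemma prob_UNIV [simp]: "measure (P v) UNIV = 1"
  using PS.prob_space[of v] by simp

lemma measurable_P_eq: "measurable (P v) N = measurable walk_space N"
  by (rule measurable_cong_sets) auto

lemma coord_measurable [measurable]: "(\<lambda>\<omega>. \<omega> n) \<in> walk_space \<rightarrow>\<^sub>M count_space (UNIV :: 'v set)"
  unfolding walk_space_def by (rule measurable_component_singleton) simp

lemma measurable_fun_coord [measurable]:
  "(\<lambda>\<omega>. g (\<omega> n)) \<in> borel_measurable (walk_space :: (nat \<Rightarrow> 'v) measure)"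
  for g :: "'v \<Rightarrow> 'b :: topological_space"
  by (rule measurable_compose[OF coord_measurable]) simp

lemma pred_coord [measurable]: "Measurable.pred (walk_space :: (nat \<Rightarrow> 'v) measure) (\<lambda>\<omega>. Q (\<omega> n))"
  by (rule measurable_compose[OF coord_measurable]) simp

lemma case_nat_measurable [measurable]:
  "case_nat v \<in> (walk_space :: (nat \<Rightarrow> 'v) measure) \<rightarrow>\<^sub>M walk_space"
  unfolding walk_space_def
proof (rule measurable_PiM_single')
  fix i :: nat
  show "(\<lambda>\<omega>. case_nat v \<omega> i) \<in> PiM UNIV (\<lambda>_. count_space UNIV) \<rightarrow>\<^sub>M count_space (UNIV :: 'v set)"
    by (cases i) (auto intro: measurable_component_singleton)
qed auto

definition shift :: "nat \<Rightarrow> (nat \<Rightarrow> 'v) \<Rightarrow> nat \<Rightarrow> 'v" where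
  "shift n \<omega> = (\<lambda>i. \<omega> (n + i))"

lemma shift_measurable [measurable]: "shift n \<in> walk_space \<rightarrow>\<^sub>M walk_space"
  unfolding walk_space_def shift_def
  by (rule measurable_PiM_single') (auto intro: measurable_component_singleton)

lemma shift_simps [simp]: "shift n \<omega> i = \<omega> (n + i)" "shift 0 \<omega> = \<omega>"
  "shift (Suc n) (case_nat v \<omega>) = shift n \<omega>" "shift m (shift n \<omega>) = shift (n + m) \<omega>"
  by (auto simp: shift_def add.assoc)

definition cyl :: "nat \<Rightarrow> (nat \<Rightarrow> 'v) \<Rightarrow> (nat \<Rightarrow> 'v) set" where
  "cyl n x = {\<omega>. \<forall>i\<le>n. \<omega> i = x i}"

lemma cyl_measurable [measurable]: "cyl n x \<in> sets walk_space"
proof -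
  have "{\<omega> \<in> space (walk_space :: (nat \<Rightarrow> 'v) measure). \<forall>i\<in>{..n}. \<omega> i = x i} \<in> sets walk_space"
    by measurable
  moreover have "{\<omega> \<in> space (walk_space :: (nat \<Rightarrow> 'v) measure). \<forall>i\<in>{..n}. \<omega> i = x i} = cyl n x"
    by (auto simp: cyl_def)
  ultimately show ?thesis by simp
qed

text \<open>Countability of the vertex set enters here: an event about one coordinate is a countable
  union of cylinders prescribing the whole initial path. So an identity between laws need only be
  checked on cylinders, whose probabilities are given.\<close>

lemma cyl_generates: "sets walk_space = sigma_sets UNIV (insert {} {cyl n x |n x. True})"
proof
  let ?S = "sigma_sets UNIV (insert {} {cyl n x |n x. True})"
  show "?S \<subseteq> sets walk_space"
  proof -
    have "insert {} {cyl n x |n x. True} \<subseteq> sets (walk_space :: (nat \<Rightarrow> 'v) measure)"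
      using cyl_measurable by blast
    from sets.sigma_sets_subset[OF this] show ?thesis by simp
  qed
  have "{\<omega>. \<omega> i \<in> A} \<in> ?S" for i :: nat and A :: "'v set"
  proof -
    have "{\<omega>. \<omega> i \<in> A} = (\<Union>xs\<in>{xs. length xs = Suc i \<and> xs ! i \<in> A}. cyl i ((!) xs))"
    proof (intro equalityI subsetI)
      fix \<omega> assume "\<omega> \<in> {\<omega>. \<omega> i \<in> A}"
      then have "\<omega> \<in> cyl i ((!) (map \<omega> [0..<Suc i]))" "map \<omega> [0..<Suc i] ! i \<in> A"
        by (auto simp: cyl_def simp del: upt_Suc)
      then show "\<omega> \<in> (\<Union>xs\<in>{xs. length xs = Suc i \<and> xs ! i \<in> A}. cyl i ((!) xs))"
        by (intro UN_I[of "map \<omega> [0..<Suc i]"]) (auto simp del: upt_Suc)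
    qed (auto simp: cyl_def)
    moreover have "countable {xs :: 'v list. length xs = Suc i \<and> xs ! i \<in> A}"
      using countable_lists[OF countable_V] by (metis countable_subset lists_UNIV subset_UNIV)
    ultimately show ?thesis
      by (simp only:) (rule sigma_sets_UNION, auto intro!: sigma_sets.Basic)
  qed
  then have *: "X \<in> ?S" if "X \<in> {{f \<in> UNIV. f i \<in> A} |i A. i \<in> (UNIV :: nat set) \<and> A \<in> sets (count_space (UNIV :: 'v set))}" for X
    using that by fastforce
  have "sigma_sets UNIV {{f \<in> UNIV. f i \<in> A} |i A. i \<in> (UNIV :: nat set) \<and> A \<in> sets (count_space (UNIV :: 'v set))} \<subseteq> ?S"
    by (rule sigma_sets_mono, rule subsetI, rule *)
  then show "sets walk_space \<subseteq> ?S"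
    unfolding walk_space_def sets_PiM_single by (simp add: PiE_UNIV_domain)
qed

lemma cyl_prob: "measure (P v) (cyl n x) = (if x 0 = v then \<Prod>i<n. tp (x i) (x (Suc i)) else 0)"
proof -
  have "emeasure (P v) {\<omega> \<in> space (P v). \<forall>i\<le>n. \<omega> i = x i} =
      ennreal (if x 0 = v then (\<Prod>i<n. tp (x i) (x (Suc i))) else 0)"
    using law[of v] unfolding rw_law_def by blast
  then have "emeasure (P v) (cyl n x) = ennreal (if x 0 = v then (\<Prod>i<n. tp (x i) (x (Suc i))) else 0)"
    by (simp add: cyl_def)
  then show ?thesis
    by (simp add: measure_def prod_nonneg)
qed

section \<open>First-step decomposition\<close>

lemma starts_at: "measure (P v) {\<omega>. \<omega> 0 = v} = 1"
  using cyl_prob[of v 0 "\<lambda>_. v"] by (simp add: cyl_def)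

lemma AE_starts: "AE \<omega> in P v. \<omega> 0 = v"
  by (rule PS.AE_prob_1[OF starts_at, unfolded mem_Collect_eq])

text \<open>The row sum is read off the law: \<open>P v\<close> has total mass 1, and steps to
  non-neighbours are null. In particular every vertex has a neighbour, so no division by zero hides
  in \<open>tp\<close>.\<close>

lemma sum_p [simp]: "(\<Sum>w\<in>nb v. tp v w) = 1"
proof -
  define C where "C w = {\<omega> :: nat \<Rightarrow> 'v. \<omega> 0 = v \<and> \<omega> 1 = w}" for w
  have C: "C w = cyl 1 (case_nat v (\<lambda>_. w))" for w
    by (auto simp: C_def cyl_def le_Suc_eq split: nat.splits)
  have meas: "C w \<in> sets walk_space" for w
    unfolding C by measurable
  have prob: "measure (P v) (C w) = tp v w" for w
    unfolding C cyl_prob by simp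
  have fin: "(\<Sum>w\<in>nb v. tp v w) = measure (P v) (\<Union>w\<in>nb v. C w)"
  proof (subst PS.finite_measure_finite_Union)
    show "disjoint_family_on C (nb v)" by (auto simp: disjoint_family_on_def C_def)
  qed (use meas prob in auto)
  have "AE \<omega> in P v. \<omega> \<notin> C w \<or> w \<in> nb v" for w
  proof (cases "w \<in> nb v")
    case False
    then have "emeasure (P v) (C w) = 0"
      using prob[of w] p_eq_0 by (simp add: PS.emeasure_eq_measure)
    then have "C w \<in> null_sets (P v)" using meas by auto
    then show ?thesis by (rule AE_I') (use False in auto)
  qed simp
  then have "AE \<omega> in P v. \<forall>w. \<omega> \<notin> C w \<or> w \<in> nb v"
    using AE_ball_countable[OF countable_V, where M = "P v" and P = "\<lambda>\<omega> w. \<omega> \<notin> C w \<or> w \<in> nb v"] by simp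
  with AE_starts[of v] have "AE \<omega> in P v. \<omega> \<in> (\<Union>w\<in>nb v. C w)"
    by eventually_elim (auto simp: C_def)
  then have "measure (P v) (\<Union>w\<in>nb v. C w) = 1"
    using meas by (intro PS.prob_eq_1[THEN iffD2]) auto
  with fin show ?thesis by simp
qed

text \<open>The Markov property at time 1, by the pi-lambda theorem: two cylinders are disjoint or
  meet in a cylinder of the larger length, so they form an intersection-stable generator.\<close>

lemma first_step_measure:
  assumes "B \<in> sets walk_space"
  shows "measure (P v) B = (\<Sum>w\<in>nb v. tp v w * measure (P w) (case_nat v -` B))"
proof -
  let ?G = "insert {} {cyl n x |n x. True} :: (nat \<Rightarrow> 'v) set set"
  have pre: "case_nat u -` B \<in> sets walk_space" if "B \<in> sets walk_space" for B and u :: 'v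
    using measurable_sets[OF case_nat_measurable that, of u] by simp
  have "Int_stable ?G"
  proof (rule Int_stableI)
    fix a b :: "(nat \<Rightarrow> 'v) set" assume "a \<in> ?G" "b \<in> ?G"
    then consider "a = {} \<or> b = {}" | n x m x' where "a = cyl n x" "b = cyl m x'"
      by blast
    then show "a \<inter> b \<in> ?G"
    proof cases
      case 2
      show ?thesis
      proof (cases "a \<inter> b = {}")
        case False
        then obtain z where z: "z \<in> cyl n x" "z \<in> cyl m x'" using 2 by blast
        have "a \<inter> b = cyl (max n m) z"
          using z unfolding 2 cyl_def by (auto simp: le_max_iff_disj)
        then show ?thesis by blast
      qed simp
    qed auto
  qed
  moreover have "?G \<subseteq> Pow UNIV" by simp
  moreover have "B \<in> sigma_sets UNIV ?G" using assms cyl_generates by simp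
  ultimately show ?thesis
  proof (induction rule: sigma_sets_induct_disjoint)
    case (basic A)
    show ?case
    proof (cases "A = {}")
      case False
      then obtain n x where A: "A = cyl n x" using basic by blast
      show ?thesis
      proof (cases "x 0 = v")
        case False
        then have "case_nat v -` A = {}" by (auto simp: A cyl_def)
        then show ?thesis using False by (simp add: A cyl_prob)
      next
        case True
        show ?thesis
        proof (cases n)
          case 0
          have "case_nat v -` A = UNIV" using True by (auto simp: A 0 cyl_def)
          then show ?thesis using True PS.prob_space by (simp add: A 0 cyl_prob)
        next
          case (Suc m)
          have *: "case_nat v -` A = cyl m (\<lambda>i. x (Suc i))"
          proof (intro equalityI subsetI)
            fix \<omega> assume "\<omega> \<in> case_nat v -` A"
            then have "\<forall>i\<le>n. case_nat v \<omega> i = x i" by (simp add: A cyl_def)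
            then show "\<omega> \<in> cyl m (\<lambda>i. x (Suc i))"
              unfolding cyl_def mem_Collect_eq Suc
              by (intro allI impI, drule_tac x = "Suc i" in spec) simp
          next
            fix \<omega> assume "\<omega> \<in> cyl m (\<lambda>i. x (Suc i))"
            then show "\<omega> \<in> case_nat v -` A"
              using True by (auto simp: A cyl_def Suc split: nat.splits)
          qed
          have "(\<Sum>w\<in>nb v. tp v w * measure (P w) (case_nat v -` A)) =
              (\<Sum>w\<in>nb v. if w = x 1 then tp v w * (\<Prod>i<m. tp (x (Suc i)) (x (Suc (Suc i)))) else 0)"
            unfolding * cyl_prob by (intro sum.cong) auto
          also have "\<dots> = tp v (x 1) * (\<Prod>i<m. tp (x (Suc i)) (x (Suc (Suc i))))"
            using p_eq_0[of "x 1" v] by (simp add: sum.delta)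
          also have "\<dots> = measure (P v) A"
            using True by (simp add: A cyl_prob Suc prod.lessThan_Suc_shift del: prod.lessThan_Suc)
          finally show ?thesis ..
        qed
      qed
    qed simp
  next
    case empty
    show ?case by simp
  next
    case (compl A)
    have A: "A \<in> sets walk_space" using compl cyl_generates by simp
    have "measure (P w) (case_nat v -` (UNIV - A)) = 1 - measure (P w) (case_nat v -` A)" for w
      using PS.prob_compl[of "case_nat v -` A" w] pre[OF A] by (simp add: vimage_Diff)
    then have "(\<Sum>w\<in>nb v. tp v w * measure (P w) (case_nat v -` (UNIV - A))) =
        (\<Sum>w\<in>nb v. tp v w) - (\<Sum>w\<in>nb v. tp v w * measure (P w) (case_nat v -` A))"
      by (simp add: right_diff_distrib sum_subtractf del: sum_p)
    moreover have "measure (P v) (UNIV - A) = 1 - measure (P v) A"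
      using PS.prob_compl[of A v] A by simp
    ultimately show ?case using compl by simp
  next
    case (union A)
    have A: "A i \<in> sets walk_space" for i using union cyl_generates by auto
    have 1: "(\<lambda>i. measure (P v) (A i)) sums measure (P v) (\<Union>i. A i)"
      using A union(1) by (intro PS.finite_measure_UNION) auto
    have 2: "(\<lambda>i. measure (P w) (case_nat v -` A i)) sums measure (P w) (\<Union>i. case_nat v -` A i)" for w
    proof (intro PS.finite_measure_UNION)
      show "disjoint_family (\<lambda>i. case_nat v -` A i)"
        using union(1) unfolding disjoint_family_on_def by blast
    qed (use pre[OF A] in auto)
    have "(\<lambda>i. \<Sum>w\<in>nb v. tp v w * measure (P w) (case_nat v -` A i)) sums
        (\<Sum>w\<in>nb v. tp v w * measure (P w) (\<Union>i. case_nat v -` A i))"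
      by (intro sums_sum sums_mult 2)
    then have "(\<lambda>i. measure (P v) (A i)) sums (\<Sum>w\<in>nb v. tp v w * measure (P w) (case_nat v -` (\<Union>i. A i)))"
      using union by (simp add: vimage_Union vimage_UN)
    from sums_unique2[OF 1 this] show ?case .
  qed
qed

lemma first_step_nn:
  assumes "F \<in> borel_measurable walk_space"
  shows "(\<integral>\<^sup>+\<omega>. F \<omega> \<partial>P v) = (\<Sum>w\<in>nb v. ennreal (tp v w) * (\<integral>\<^sup>+\<omega>. F (case_nat v \<omega>) \<partial>P w))"
  using assms
proof (induction rule: borel_measurable_induct)
  case (cong f g)
  then have "f = g" by auto
  then show ?case using cong by simp
next
  case (set A)
  have pre: "case_nat v -` A \<in> sets walk_space"
    using measurable_sets[OF case_nat_measurable set, of v] by simp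
  have "(\<integral>\<^sup>+\<omega>. indicator A (case_nat v \<omega>) \<partial>P w) = measure (P w) (case_nat v -` A)" for w
  proof -
    have "(\<integral>\<^sup>+\<omega>. indicator A (case_nat v \<omega>) \<partial>P w) = (\<integral>\<^sup>+\<omega>. indicator (case_nat v -` A) \<omega> \<partial>P w)"
      by (intro nn_integral_cong) (auto simp: indicator_def)
    then show ?thesis using pre by (simp add: PS.emeasure_eq_measure)
  qed
  then show ?case
    using set by (simp add: PS.emeasure_eq_measure first_step_measure[of A v] ennreal_mult'[symmetric] sum_ennreal)
next
  case (mult u a)
  then show ?case
    by (simp add: nn_integral_cmult measurable_P_eq sum_distrib_left mult.left_commute
        measurable_compose[OF case_nat_measurable])
next
  case (add u w)
  then show ?case
    by (simp add: nn_integral_add measurable_P_eq sum.distrib distrib_left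
        measurable_compose[OF case_nat_measurable])
next
  case (seq U)
  have m: "incseq (\<lambda>i \<omega>. U i (case_nat v \<omega>))"
    using seq(3) by (auto simp: incseq_def le_fun_def)
  have U': "(\<lambda>\<omega>. U i (case_nat v \<omega>)) \<in> borel_measurable walk_space" for i
    using seq(1) by (rule measurable_compose[OF case_nat_measurable])
  have "(\<integral>\<^sup>+\<omega>. (SUP i. U i) \<omega> \<partial>P v) = (SUP i. \<integral>\<^sup>+\<omega>. U i \<omega> \<partial>P v)"
    unfolding SUP_apply using seq by (intro nn_integral_monotone_convergence_SUP) (auto simp: measurable_P_eq)
  also have "\<dots> = (SUP i. \<Sum>w\<in>nb v. ennreal (tp v w) * (\<integral>\<^sup>+\<omega>. U i (case_nat v \<omega>) \<partial>P w))"
    using seq by simp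
  also have "\<dots> = (\<Sum>w\<in>nb v. SUP i. ennreal (tp v w) * (\<integral>\<^sup>+\<omega>. U i (case_nat v \<omega>) \<partial>P w))"
  proof (rule ennreal_SUP_sum)
    fix w
    show "incseq (\<lambda>i. ennreal (tp v w) * (\<integral>\<^sup>+\<omega>. U i (case_nat v \<omega>) \<partial>P w))"
      using m by (intro monoI mult_left_mono nn_integral_mono) (auto simp: incseq_def le_fun_def)
  qed
  also have "\<dots> = (\<Sum>w\<in>nb v. ennreal (tp v w) * (SUP i. \<integral>\<^sup>+\<omega>. U i (case_nat v \<omega>) \<partial>P w))"
    by (simp add: SUP_mult_left_ennreal)
  also have "\<dots> = (\<Sum>w\<in>nb v. ennreal (tp v w) * (\<integral>\<^sup>+\<omega>. (SUP i. U i) (case_nat v \<omega>) \<partial>P w))"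
    unfolding SUP_apply using m U'
    by (subst nn_integral_monotone_convergence_SUP) (auto simp: measurable_P_eq)
  finally show ?case .
qed

section \<open>The transition operator and its powers\<close>

definition avg :: "('v \<Rightarrow> real) \<Rightarrow> 'v \<Rightarrow> real" where
  "avg f u = (\<Sum>w\<in>nb u. tp u w * f w)"

lemma integrable_bdd:
  fixes F :: "(nat \<Rightarrow> 'v) \<Rightarrow> real"
  assumes "F \<in> borel_measurable walk_space" "\<And>\<omega>. \<bar>F \<omega>\<bar> \<le> C"
  shows "integrable (P v) F"
  using assms by (intro PS.integrable_const_bound[where B = C]) (auto simp: measurable_P_eq)

text \<open>Adding the bound \<open>C\<close> reduces the signed case to the non-negative one; the
  constant survives averaging because the transition probabilities sum to 1.\<close>

lemma first_step:
  fixes F :: "(nat \<Rightarrow> 'v) \<Rightarrow> real"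
  assumes F [measurable]: "F \<in> borel_measurable walk_space" and bdd: "\<And>\<omega>. \<bar>F \<omega>\<bar> \<le> C"
  shows "(\<integral>\<omega>. F \<omega> \<partial>P v) = avg (\<lambda>w. \<integral>\<omega>. F (case_nat v \<omega>) \<partial>P w) v"
proof -
  have nonneg: "(\<integral>\<omega>. G \<omega> \<partial>P v) = avg (\<lambda>w. \<integral>\<omega>. G (case_nat v \<omega>) \<partial>P w) v"
    if G [measurable]: "G \<in> borel_measurable walk_space" and G0: "\<And>\<omega>. 0 \<le> G \<omega>" and GC: "\<And>\<omega>. G \<omega> \<le> K"
    for G :: "(nat \<Rightarrow> 'v) \<Rightarrow> real" and K
  proof -
    have G' [measurable]: "(\<lambda>\<omega>. G (case_nat v \<omega>)) \<in> borel_measurable walk_space" by measurable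
    have i: "integrable (P u) G" "integrable (P u) (\<lambda>\<omega>. G (case_nat v \<omega>))" for u
      using G0 GC by (auto intro!: integrable_bdd[where C = K])
    have "ennreal (\<integral>\<omega>. G \<omega> \<partial>P v) = (\<integral>\<^sup>+\<omega>. G \<omega> \<partial>P v)"
      using i G0 by (subst nn_integral_eq_integral) auto
    also have "\<dots> = (\<Sum>w\<in>nb v. ennreal (tp v w) * (\<integral>\<^sup>+\<omega>. G (case_nat v \<omega>) \<partial>P w))"
      by (rule first_step_nn) measurable
    also have "\<dots> = (\<Sum>w\<in>nb v. ennreal (tp v w) * ennreal (\<integral>\<omega>. G (case_nat v \<omega>) \<partial>P w))"
      using i G0 by (subst nn_integral_eq_integral) auto
    also have "\<dots> = ennreal (avg (\<lambda>w. \<integral>\<omega>. G (case_nat v \<omega>) \<partial>P w) v)"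
      using G0 by (simp add: avg_def ennreal_mult'[symmetric] sum_ennreal integral_nonneg)
    finally show ?thesis
      using G0 by (subst (asm) ennreal_inj) (auto simp: avg_def intro!: sum_nonneg integral_nonneg)
  qed
  have F' [measurable]: "(\<lambda>\<omega>. F (case_nat v \<omega>)) \<in> borel_measurable walk_space" by measurable
  have i: "integrable (P u) F" "integrable (P u) (\<lambda>\<omega>. F (case_nat v \<omega>))" for u
    using bdd by (auto intro!: integrable_bdd[where C = C])
  have "(\<integral>\<omega>. F \<omega> + C \<partial>P v) = avg (\<lambda>w. \<integral>\<omega>. F (case_nat v \<omega>) + C \<partial>P w) v"
  proof (rule nonneg)
    show "0 \<le> F \<omega> + C" "F \<omega> + C \<le> 2 * C" for \<omega> using bdd[of \<omega>] by auto
  qed measurable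
  then show ?thesis
    using i by (simp add: PS.prob_space avg_def distrib_left sum.distrib sum_distrib_right[symmetric])
qed

lemma avg_mono: "(\<And>w. w \<in> nb v \<Longrightarrow> f w \<le> g w) \<Longrightarrow> avg f v \<le> avg g v"
  unfolding avg_def by (intro sum_mono mult_left_mono) auto

lemma avg_const [simp]: "avg (\<lambda>_. a) = (\<lambda>_. a)"
  by (rule ext) (simp add: avg_def sum_distrib_right[symmetric])

lemma avg_add: "avg (\<lambda>w. f w + g w) v = avg f v + avg g v"
  by (simp add: avg_def distrib_left sum.distrib)

lemma avg_diff: "avg (\<lambda>w. f w - g w) v = avg f v - avg g v"
  by (simp add: avg_def right_diff_distrib sum_subtractf)

lemma avg_cmult: "avg (\<lambda>w. a * f w) v = a * avg f v"
  by (simp add: avg_def sum_distrib_left mult.left_commute)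

lemma avg_nonneg: "(\<And>w. 0 \<le> f w) \<Longrightarrow> 0 \<le> avg f v"
  unfolding avg_def by (intro sum_nonneg) auto

lemma avg_tendsto: "(\<And>w. ((\<lambda>i. f i w) \<longlongrightarrow> g w) F) \<Longrightarrow> ((\<lambda>i. avg (f i) v) \<longlongrightarrow> avg g v) F"
  unfolding avg_def by (intro tendsto_sum tendsto_mult_left)

text \<open>The \<open>n\<close>-step transition operator: for bounded \<open>f\<close>,
  \<open>avgn n f v\<close> is the mean of \<open>f\<close> at the position at time \<open>n\<close>
  (\<open>expectation_coord\<close>). It takes the place of conditional expectations
  throughout.\<close>

definition avgn :: "nat \<Rightarrow> ('v \<Rightarrow> real) \<Rightarrow> 'v \<Rightarrow> real" where
  "avgn n = avg ^^ n"

lemma avgn_0 [simp]: "avgn 0 f = f" and avgn_Suc: "avgn (Suc n) f = avg (avgn n f)"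
  by (auto simp: avgn_def)

lemma avgn_Suc': "avgn (Suc n) f = avgn n (avg f)"
  unfolding avgn_def by (simp add: funpow_swap1)

lemma avgn_mono: "(\<And>w. f w \<le> g w) \<Longrightarrow> avgn n f v \<le> avgn n g v"
  by (induction n arbitrary: v) (auto simp: avgn_Suc intro: avg_mono)

lemma avgn_nonneg: "(\<And>w. 0 \<le> f w) \<Longrightarrow> 0 \<le> avgn n f v"
  by (induction n arbitrary: v) (auto simp: avgn_Suc intro: avg_nonneg)

lemma avgn_const [simp]: "avgn n (\<lambda>_. a) = (\<lambda>_. a)"
  by (induction n) (auto simp: avgn_Suc)

lemma avgn_add: "avgn n (\<lambda>w. f w + g w) v = avgn n f v + avgn n g v"
proof (induction n arbitrary: v)
  case (Suc n)
  then have "avgn n (\<lambda>w. f w + g w) = (\<lambda>w. avgn n f w + avgn n g w)" by blast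
  then show ?case by (simp add: avgn_Suc avg_add)
qed simp

lemma avgn_diff: "avgn n (\<lambda>w. f w - g w) v = avgn n f v - avgn n g v"
proof (induction n arbitrary: v)
  case (Suc n)
  then have "avgn n (\<lambda>w. f w - g w) = (\<lambda>w. avgn n f w - avgn n g w)" by blast
  then show ?case by (simp add: avgn_Suc avg_diff)
qed simp

lemma avgn_cmult: "avgn n (\<lambda>w. a * f w) v = a * avgn n f v"
proof (induction n arbitrary: v)
  case (Suc n)
  then have "avgn n (\<lambda>w. a * f w) = (\<lambda>w. a * avgn n f w)" by blast
  then show ?case by (simp add: avgn_Suc avg_cmult)
qed simp

lemma avgn_tendsto:
  "(\<And>w. ((\<lambda>i. f i w) \<longlongrightarrow> g w) F) \<Longrightarrow> ((\<lambda>i. avgn n (f i) v) \<longlongrightarrow> avgn n g v) F"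
  by (induction n arbitrary: v) (auto simp: avgn_Suc intro: avg_tendsto)

lemma avgn_bdd: "(\<And>w. \<bar>f w\<bar> \<le> K) \<Longrightarrow> \<bar>avgn n f v\<bar> \<le> K"
  using avgn_mono[of f "\<lambda>_. K" n v] avgn_mono[of "\<lambda>_. - K" f n v]
  by (auto simp: abs_le_iff minus_le_iff)

lemma expectation_shift:
  fixes F :: "(nat \<Rightarrow> 'v) \<Rightarrow> real"
  assumes F [measurable]: "F \<in> borel_measurable walk_space" and bdd: "\<And>\<omega>. \<bar>F \<omega>\<bar> \<le> C"
  shows "(\<integral>\<omega>. F (shift n \<omega>) \<partial>P v) = avgn n (\<lambda>w. \<integral>\<omega>. F \<omega> \<partial>P w) v"
proof (induction n arbitrary: v)
  case (Suc n)
  have "(\<integral>\<omega>. F (shift (Suc n) \<omega>) \<partial>P v) = avg (\<lambda>w. \<integral>\<omega>. F (shift n \<omega>) \<partial>P w) v"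
    using bdd by (subst first_step[where C = C]) auto
  then show ?case by (simp only: Suc avgn_Suc)
qed simp

lemma expectation_start:
  fixes f :: "'v \<Rightarrow> real"
  shows "(\<integral>\<omega>. f (\<omega> 0) \<partial>P v) = f v"
proof -
  have "(\<integral>\<omega>. f (\<omega> 0) \<partial>P v) = (\<integral>\<omega>. f v \<partial>P v)"
    using AE_starts[of v] by (intro integral_cong_AE) (auto simp: measurable_P_eq)
  then show ?thesis by (simp add: PS.prob_space)
qed

lemma expectation_coord:
  fixes f :: "'v \<Rightarrow> real"
  assumes "\<And>w. \<bar>f w\<bar> \<le> C"
  shows "(\<integral>\<omega>. f (\<omega> n) \<partial>P v) = avgn n f v"
  using expectation_shift[where F = "\<lambda>\<omega>. f (\<omega> 0)" and C = C and n = n and v = v] assms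
  by (simp add: expectation_start)

lemma measure_shift:
  assumes [measurable]: "B \<in> sets walk_space"
  shows "measure (P v) {\<omega>. shift n \<omega> \<in> B} = avgn n (\<lambda>w. measure (P w) B) v"
proof -
  have "{\<omega>. shift n \<omega> \<in> B} = shift n -` B \<inter> space walk_space" by auto
  then have m: "{\<omega>. shift n \<omega> \<in> B} \<in> sets walk_space"
    using measurable_sets[OF shift_measurable assms] by simp
  have "measure (P v) {\<omega>. shift n \<omega> \<in> B} = (\<integral>\<omega>. indicator {\<omega>. shift n \<omega> \<in> B} \<omega> \<partial>P v)"
    using m by simp
  also have "\<dots> = (\<integral>\<omega>. indicator B (shift n \<omega>) \<partial>P v)"
    by (intro Bochner_Integration.integral_cong) (auto simp: indicator_def)
  also have "\<dots> = avgn n (\<lambda>w. \<integral>\<omega>. indicator B \<omega> \<partial>P w) v"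
    by (rule expectation_shift[where C = 1]) (auto simp: indicator_def)
  finally show ?thesis by simp
qed

text \<open>The probability of missing \<open>B\<close> is a non-negative harmonic function of the
  starting point. If it vanishes at \<open>u\<close>, it vanishes at the neighbours by the minimum
  principle, hence everywhere by connectedness. This carries almost sure statements from the root to
  every start.\<close>

lemma invariant_AE:
  assumes B [measurable]: "B \<in> sets walk_space" and inv: "\<And>\<omega>. shift 1 \<omega> \<in> B \<longleftrightarrow> \<omega> \<in> B"
    and AE: "AE \<omega> in P u. \<omega> \<in> B"
  shows "AE \<omega> in P w. \<omega> \<in> B"
proof -
  define f where "f v = 1 - measure (P v) B" for v
  have f0: "0 \<le> f v" for v by (simp add: f_def)
  have step: "avg (\<lambda>w. measure (P w) B) v = measure (P v) B" for v
    using measure_shift[OF B, of v 1] unfolding inv by (simp add: avgn_Suc)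
  have har: "f v = avg f v" for v
    unfolding f_def[abs_def] avg_diff step by simp
  have "f u = 0" using AE B by (simp add: f_def PS.prob_eq_1)
  have "(u, w) \<in> {(x, y). adj ends x y}\<^sup>*" by (rule connected)
  then have "f w = 0"
  proof induction
    case base
    then show ?case by fact
  next
    case (step x z)
    have "tp x z * f z \<le> avg f x"
      unfolding avg_def using step(2) f0
      by (intro member_le_sum[of z "nb x" "\<lambda>w. tp x w * f w"] finite_nb) (auto simp: nbrs_def)
    then have "tp x z * f z \<le> 0" using step(3) har[of x] by linarith
    moreover have "0 < tp x z" using step(2) by (intro p_pos) (auto simp: nbrs_def)
    ultimately show ?case using f0[of z] by (simp add: mult_le_0_iff)
  qed
  then show ?thesis using B by (simp add: f_def PS.prob_eq_1)
qed

text \<open>Doob's maximal inequality, with \<open>b n = avgn n r\<close> for a subharmonic \<open>r\<close> and with constant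
  \<open>b\<close> for a superharmonic one.\<close>

lemma maximal_finite:
  fixes r :: "'v \<Rightarrow> real" and b :: "nat \<Rightarrow> 'v \<Rightarrow> real"
  assumes b0: "\<And>n w. 0 \<le> b n w" and rb: "\<And>n w. r w \<le> b n w"
    and step: "\<And>n w. avg (b n) w \<le> b (Suc n) w" and l: "0 < l"
  shows "l * measure (P v) {\<omega>. \<exists>k\<le>N. l \<le> r (\<omega> k)} \<le> b N v"
proof (induction N arbitrary: v)
  case 0
  have m: "{\<omega>. l \<le> r (\<omega> 0)} \<in> sets walk_space"
    using pred_coord[of "\<lambda>w. l \<le> r w" 0] by (simp add: pred_def)
  have "measure (P v) {\<omega>. l \<le> r (\<omega> 0)} = (if l \<le> r v then 1 else 0)"
  proof (cases "l \<le> r v")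
    case True
    have "AE \<omega> in P v. \<omega> \<in> {\<omega>. l \<le> r (\<omega> 0)}" using AE_starts[of v] by eventually_elim (use True in auto)
    then show ?thesis using m True PS.prob_eq_1[of "{\<omega>. l \<le> r (\<omega> 0)}" v] by simp
  next
    case False
    have "AE \<omega> in P v. \<omega> \<notin> {\<omega>. l \<le> r (\<omega> 0)}" using AE_starts[of v] by eventually_elim (use False in auto)
    then show ?thesis using m False PS.prob_eq_0[of "{\<omega>. l \<le> r (\<omega> 0)}" v] by simp
  qed
  then show ?case using b0[of 0 v] rb[of v 0] by auto
next
  case (Suc N)
  define A where "A N = {\<omega> :: nat \<Rightarrow> 'v. \<exists>k\<le>N. l \<le> r (\<omega> k)}" for N
  have m: "A N \<in> sets walk_space" for N
  proof -
    have "{\<omega> \<in> space (walk_space :: (nat \<Rightarrow> 'v) measure). \<exists>k\<in>{..N}. l \<le> r (\<omega> k)} \<in> sets walk_space"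
      by measurable
    moreover have "{\<omega> \<in> space (walk_space :: (nat \<Rightarrow> 'v) measure). \<exists>k\<in>{..N}. l \<le> r (\<omega> k)} = A N"
      by (auto simp: A_def)
    ultimately show ?thesis by simp
  qed
  show ?case
  proof (cases "l \<le> r v")
    case True
    have "l * measure (P v) (A (Suc N)) \<le> l * 1"
      using l by (intro mult_left_mono) auto
    also have "\<dots> \<le> b (Suc N) v" using True rb[of v "Suc N"] by simp
    finally show ?thesis by (simp add: A_def)
  next
    case False
    have "case_nat v -` A (Suc N) = A N"
    proof (intro equalityI subsetI)
      fix \<omega> assume "\<omega> \<in> case_nat v -` A (Suc N)"
      then obtain k where "k \<le> Suc N" "l \<le> r (case_nat v \<omega> k)" by (auto simp: A_def)
      then show "\<omega> \<in> A N" using False by (cases k) (auto simp: A_def)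
    next
      fix \<omega> assume "\<omega> \<in> A N"
      then obtain k where "k \<le> N" "l \<le> r (\<omega> k)" by (auto simp: A_def)
      then show "\<omega> \<in> case_nat v -` A (Suc N)" by (auto simp: A_def intro!: exI[of _ "Suc k"])
    qed
    then have "l * measure (P v) (A (Suc N)) = avg (\<lambda>w. l * measure (P w) (A N)) v"
      using m by (simp add: first_step_measure avg_def sum_distrib_left mult.left_commute)
    also have "\<dots> \<le> avg (b N) v"
      using Suc by (intro avg_mono) (simp add: A_def)
    also have "\<dots> \<le> b (Suc N) v" by (rule step)
    finally show ?thesis by (simp add: A_def)
  qed
qed

lemma ex_coord_measurable [measurable]:
  "{\<omega>. \<exists>k. Q k (\<omega> k)} \<in> sets (walk_space :: (nat \<Rightarrow> 'v) measure)"
proof -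
  have "{\<omega> \<in> space (walk_space :: (nat \<Rightarrow> 'v) measure). \<exists>k. Q k (\<omega> k)} \<in> sets walk_space"
    by measurable
  then show ?thesis by simp
qed

lemma maximal:
  fixes r :: "'v \<Rightarrow> real" and b :: "nat \<Rightarrow> 'v \<Rightarrow> real"
  assumes b0: "\<And>n w. 0 \<le> b n w" and rb: "\<And>n w. r w \<le> b n w"
    and step: "\<And>n w. avg (b n) w \<le> b (Suc n) w" and l: "0 < l"
    and bd: "\<And>n. b n v \<le> K"
  shows "l * measure (P v) {\<omega>. \<exists>k. l \<le> r (\<omega> k)} \<le> K"
proof -
  define A where "A N = {\<omega> :: nat \<Rightarrow> 'v. \<exists>k\<le>N. l \<le> r (\<omega> k)}" for N
  have "A N = {\<omega>. \<exists>k. k \<le> N \<and> l \<le> r (\<omega> k)}" for N by (auto simp: A_def)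
  then have m: "A N \<in> sets (P v)" for N
    using ex_coord_measurable[of "\<lambda>k w. k \<le> N \<and> l \<le> r w"] by simp
  have "(\<lambda>N. measure (P v) (A N)) \<longlonglongrightarrow> measure (P v) (\<Union>N. A N)"
    using m by (intro PS.finite_Lim_measure_incseq) (auto simp: A_def incseq_def intro: order_trans)
  moreover have "(\<Union>N. A N) = {\<omega>. \<exists>k. l \<le> r (\<omega> k)}" by (auto simp: A_def)
  ultimately have "(\<lambda>N. l * measure (P v) (A N)) \<longlonglongrightarrow> l * measure (P v) {\<omega>. \<exists>k. l \<le> r (\<omega> k)}"
    by (auto intro: tendsto_mult_left)
  moreover have "l * measure (P v) (A N) \<le> K" for N
    using maximal_finite[of b r l v N, OF b0 rb step l] bd[of N] by (simp add: A_def)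
  ultimately show ?thesis by (blast intro: LIMSEQ_le_const2)
qed

end

section \<open>Almost sure convergence of bounded harmonic functions\<close>

lemma LIMSEQ_squeeze_0:
  fixes a b :: "nat \<Rightarrow> real"
  assumes "b \<longlonglongrightarrow> 0" "\<And>n. 0 \<le> a n" "\<And>n. a n \<le> b n"
  shows "a \<longlonglongrightarrow> 0"
  by (rule tendsto_sandwich[OF _ _ tendsto_const assms(1)]) (use assms in auto)

context network_walk
begin

text \<open>In the uses, \<open>B\<close> says that some later position deviates, so a single shift
  outside \<open>B\<close> controls the whole remaining path.\<close>

lemma AE_tail_of_measure:
  assumes B: "B \<in> sets walk_space"
    and lim: "(\<lambda>n. avgn n (\<lambda>w. measure (P w) B) v) \<longlonglongrightarrow> 0"
  shows "AE \<omega> in P v. \<exists>n. shift n \<omega> \<notin> B"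
proof -
  define S where "S n = {\<omega>. shift n \<omega> \<in> B}" for n
  have S: "S n \<in> sets (P v)" for n
    using measurable_sets[OF shift_measurable B, of n] by (simp add: S_def vimage_def)
  have "measure (P v) (\<Inter>n. S n) \<le> avgn n (\<lambda>w. measure (P w) B) v" for n
    using S by (subst measure_shift[OF B, symmetric]) (auto intro!: PS.finite_measure_mono simp: S_def)
  then have "measure (P v) (\<Inter>n. S n) \<le> 0"
    by (intro LIMSEQ_le_const[OF lim]) auto
  then have "measure (P v) (\<Inter>n. S n) = 0" by (simp add: measure_le_0_iff)
  moreover have "(\<Inter>n. S n) \<in> sets (P v)" using S by auto
  ultimately have "AE \<omega> in P v. \<omega> \<notin> (\<Inter>n. S n)"
    by (simp add: PS.prob_eq_0)
  then show ?thesis by eventually_elim (auto simp: S_def)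
qed

lemma measure_start_cong:
  assumes "A \<in> sets walk_space" "B \<in> sets walk_space"
    and "\<And>\<omega>. \<omega> 0 = v \<Longrightarrow> \<omega> \<in> A \<longleftrightarrow> \<omega> \<in> B"
  shows "measure (P v) A = measure (P v) B"
proof -
  have "AE \<omega> in P v. \<omega> \<in> A \<longleftrightarrow> \<omega> \<in> B"
    using AE_starts[of v] by eventually_elim (use assms(3) in auto)
  then show ?thesis
    using assms(1,2) by (intro measure_eq_AE) auto
qed

text \<open>The variance of \<open>h\<close> over one step is non-negative.\<close>

lemma avg_sq_dev:
  assumes "h v = avg h v"
  shows "(h v)\<^sup>2 \<le> avg (\<lambda>w. (h w)\<^sup>2) v"
proof -
  have "0 \<le> avg (\<lambda>w. (h w - h v)\<^sup>2) v" by (rule avg_nonneg) simp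
  also have "(\<lambda>w. (h w - h v)\<^sup>2) = (\<lambda>w. ((h w)\<^sup>2 - (2 * h v) * h w) + (h v)\<^sup>2)"
    by (auto simp: power2_eq_square algebra_simps)
  also have "avg \<dots> v = avg (\<lambda>w. (h w)\<^sup>2) v - (2 * h v) * avg h v + (h v)\<^sup>2"
    by (simp only: avg_add avg_diff avg_cmult avg_const)
  finally show ?thesis by (simp add: power2_eq_square assms[symmetric])
qed

text \<open>Orthogonality of martingale increments bounds the oscillation after time \<open>n\<close> by
  the increase of \<open>E h(X\<^sub>k)\<^sup>2\<close> after time \<open>n\<close>.\<close>

lemma harmonic_converges:
  assumes har: "\<And>w. h w = avg h w" and bdd: "\<And>w. \<bar>h w\<bar> \<le> K"
  shows "AE \<omega> in P v. convergent (\<lambda>n. h (\<omega> n))"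
proof -
  define s where "s w = (h w)\<^sup>2" for w
  have s_sub: "s w \<le> avg s w" for w
    using avg_sq_dev[OF har] by (simp add: s_def[abs_def])
  have s_bdd: "\<bar>s w\<bar> \<le> K\<^sup>2" for w
    using power_mono[OF bdd[of w], of 2] by (simp add: s_def)
  have inc: "incseq (\<lambda>n. avgn n s w)" for w
    by (rule incseq_SucI) (simp add: avgn_Suc' avgn_mono s_sub)
  have "\<exists>l. (\<lambda>n. avgn n s w) \<longlonglongrightarrow> l" for w
    using incseq_convergent[OF inc, of w "K\<^sup>2"] avgn_bdd[of s "K\<^sup>2", OF s_bdd]
    by (metis abs_le_D1)
  \<comment> \<open>\<open>q w\<close> is the limit of the second moments of \<open>h\<close> along
    the walk from \<open>w\<close>. As a limit of iterated averages it is itself harmonic.\<close>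
  then obtain q where q: "\<And>w. (\<lambda>n. avgn n s w) \<longlonglongrightarrow> q w" by metis
  have sq: "avgn n s w \<le> q w" for n w
    using incseq_le[OF inc q] .
  have "avg q w = q w" for w
  proof -
    have "(\<lambda>n. avgn (Suc n) s w) \<longlonglongrightarrow> avg q w"
      unfolding avgn_Suc by (rule avg_tendsto) (rule q)
    moreover have "(\<lambda>n. avgn (Suc n) s w) \<longlonglongrightarrow> q w" using q by (rule LIMSEQ_Suc)
    ultimately show ?thesis by (rule LIMSEQ_unique)
  qed
  then have "avg q = q" by blast
  then have q_inv: "avgn n q w = q w" for n w
    by (induction n arbitrary: w) (auto simp: avgn_Suc')
  have "avg h = h" by (rule ext) (rule har[symmetric])
  then have h_inv: "avgn n h = h" for n
    by (induction n) (auto simp: avgn_Suc)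
  define B where "B \<epsilon> = {\<omega> :: nat \<Rightarrow> 'v. \<exists>k. \<epsilon> \<le> \<bar>h (\<omega> k) - h (\<omega> 0)\<bar>}" for \<epsilon>
  have B: "B \<epsilon> \<in> sets walk_space" for \<epsilon>
  proof -
    have "{\<omega> \<in> space (walk_space :: (nat \<Rightarrow> 'v) measure). \<exists>k. \<epsilon> \<le> \<bar>h (\<omega> k) - h (\<omega> 0)\<bar>} \<in> sets walk_space"
      by measurable
    then show ?thesis by (simp add: B_def)
  qed
  have osc: "measure (P w) (B \<epsilon>) \<le> (q w - s w) / \<epsilon>\<^sup>2" if \<epsilon>: "0 < \<epsilon>" for w \<epsilon>
  proof -
    \<comment> \<open>The squared deviation from the start is subharmonic. Harmonicity of
      \<open>h\<close> turns its \<open>n\<close>-step mean at \<open>w\<close> into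
      \<open>avgn n s w - s w\<close>.\<close>
    define r where "r z = (h z - h w)\<^sup>2" for z
    have r_eq: "r = (\<lambda>z. (s z - (2 * h w) * h z) + (h w)\<^sup>2)"
      by (auto simp: r_def s_def power2_eq_square algebra_simps)
    have avgn_r: "avgn n r z = avgn n s z - (2 * h w) * h z + (h w)\<^sup>2" for n z
      unfolding r_eq by (simp only: avgn_add avgn_diff avgn_cmult avgn_const h_inv)
    have "(\<epsilon>\<^sup>2) * measure (P w) {\<omega>. \<exists>k. \<epsilon>\<^sup>2 \<le> r (\<omega> k)} \<le> q w - s w"
    proof (rule maximal[where b = "\<lambda>n. avgn n r"])
      show "0 \<le> avgn n r z" for n z by (rule avgn_nonneg) (simp add: r_def)
      have "s z \<le> avgn n s z" for n z
        using incseqD[OF inc, of 0 n z] by simp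
      then show "r z \<le> avgn n r z" for n z
        unfolding avgn_r by (simp add: r_eq)
      show "avgn n r w \<le> q w - s w" for n
        unfolding avgn_r using sq[of n w] by (simp add: s_def power2_eq_square)
    qed (use \<epsilon> in \<open>auto simp: avgn_Suc\<close>)
    moreover have "measure (P w) (B \<epsilon>) = measure (P w) {\<omega>. \<exists>k. \<epsilon>\<^sup>2 \<le> r (\<omega> k)}"
    proof (rule measure_start_cong[OF B ex_coord_measurable])
      fix \<omega> :: "nat \<Rightarrow> 'v" assume "\<omega> 0 = w"
      then show "\<omega> \<in> B \<epsilon> \<longleftrightarrow> \<omega> \<in> {\<omega>. \<exists>k. \<epsilon>\<^sup>2 \<le> r (\<omega> k)}"
        using \<epsilon> by (simp add: B_def r_def abs_le_square_iff[symmetric])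
    qed
    ultimately show ?thesis using \<epsilon> by (simp add: field_simps)
  qed
  have "AE \<omega> in P v. \<exists>n. shift n \<omega> \<notin> B \<epsilon>" if \<epsilon>: "0 < \<epsilon>" for \<epsilon>
  proof (rule AE_tail_of_measure[OF B])
    have "avgn n (\<lambda>w. measure (P w) (B \<epsilon>)) v \<le> (1 / \<epsilon>\<^sup>2) * (q v - avgn n s v)" for n
    proof -
      have "avgn n (\<lambda>w. measure (P w) (B \<epsilon>)) v \<le> avgn n (\<lambda>w. (1 / \<epsilon>\<^sup>2) * (q w - s w)) v"
        using osc[OF \<epsilon>] by (intro avgn_mono) simp
      also have "\<dots> = (1 / \<epsilon>\<^sup>2) * (q v - avgn n s v)"
        by (simp only: avgn_cmult avgn_diff q_inv)
      finally show ?thesis .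
    qed
    moreover have "(\<lambda>n. (1 / \<epsilon>\<^sup>2) * (q v - avgn n s v)) \<longlonglongrightarrow> (1 / \<epsilon>\<^sup>2) * (q v - q v)"
      by (intro tendsto_intros q)
    ultimately show "(\<lambda>n. avgn n (\<lambda>w. measure (P w) (B \<epsilon>)) v) \<longlonglongrightarrow> 0"
      by (intro LIMSEQ_squeeze_0[OF _ avgn_nonneg]) auto
  qed
  then have "AE \<omega> in P v. \<forall>j. \<exists>n. shift n \<omega> \<notin> B (1 / real (Suc j))"
    by (subst AE_all_countable) auto
  then show ?thesis
  proof eventually_elim
    case (elim \<omega>)
    have "Cauchy (\<lambda>n. h (\<omega> n))"
    proof (rule metric_CauchyI)
      fix e :: real assume "0 < e"
      then obtain j where j: "1 / real (Suc j) < e / 2" by (metis half_gt_zero nat_approx_posE)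
      obtain n where n: "shift n \<omega> \<notin> B (1 / real (Suc j))" using elim by blast
      have *: "\<bar>h (\<omega> m) - h (\<omega> n)\<bar> < 1 / real (Suc j)" if "m \<ge> n" for m
      proof -
        have "\<not> 1 / real (Suc j) \<le> \<bar>h (shift n \<omega> (m - n)) - h (shift n \<omega> 0)\<bar>"
          using n by (auto simp only: B_def mem_Collect_eq)
        then show ?thesis using that by simp
      qed
      have "dist (h (\<omega> m)) (h (\<omega> m')) < e" if "m \<ge> n" "m' \<ge> n" for m m'
        using *[OF that(1)] *[OF that(2)] j unfolding dist_real_def by linarith
      then show "\<exists>M. \<forall>m\<ge>M. \<forall>n\<ge>M. dist (h (\<omega> m)) (h (\<omega> n)) < e" by blast
    qed
    then show ?case by (rule Cauchy_convergent)
  qed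
qed

section \<open>Reversibility\<close>

lemma cond_vert_pos: "0 < cond_vert ends c u"
proof -
  have "\<exists>w\<in>nb u. tp u w \<noteq> 0"
    using sum_p[of u] by (metis sum.neutral zero_neq_one)
  then have "cond_vert ends c u \<noteq> 0" by (auto simp: trans_prob_def)
  then show ?thesis using cond_vert_nonneg[of u] by simp
qed

lemma cond_vert_p: "cond_vert ends c u * tp u w = cond_pair ends c u w"
  using cond_vert_pos[of u] by (simp add: trans_prob_def)

abbreviation ind :: "'v \<Rightarrow> 'v \<Rightarrow> real" where "ind v w \<equiv> (if w = v then 1 else 0)"

lemma avgn_sum: "avgn n (\<lambda>x. \<Sum>i\<in>I. f i x) v = (\<Sum>i\<in>I. avgn n (f i) v)"
proof (induction I rule: infinite_finite_induct)
  case (insert i I)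
  then show ?case by (simp add: avgn_add)
qed (auto simp: avgn_const[of _ 0, THEN fun_cong])

text \<open>The column of the transition matrix at \<open>v\<close>, written as a combination of
  indicators. It allows the last step of a path to be peeled off.\<close>

lemma avg_ind: "avg (ind v) x = (\<Sum>w\<in>nb v. tp w v * ind w x)"
proof -
  have "avg (ind v) x = (if v \<in> nb x then tp x v else 0)"
    by (simp add: avg_def if_distrib[of "\<lambda>t. _ * t"] sum.delta cong: if_cong)
  also have "\<dots> = (\<Sum>w\<in>nb v. tp w v * ind w x)"
    using nb_sym[of v x] by (simp add: if_distrib[of "\<lambda>t. _ * t"] sum.delta' cong: if_cong)
  finally show ?thesis .
qed

text \<open>Detailed balance, iterated: the induction peels off the last step on the left-hand side
  and adds a first step on the right-hand side.\<close>

lemma reversible: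
  "cond_vert ends c u * avgn n (ind v) u = cond_vert ends c v * avgn n (ind u) v"
proof (induction n arbitrary: u v)
  case (Suc n)
  have "cond_vert ends c u * avgn (Suc n) (ind v) u =
      cond_vert ends c u * (\<Sum>w\<in>nb v. tp w v * avgn n (ind w) u)"
    by (simp only: avgn_Suc' avg_ind[abs_def] avgn_sum avgn_cmult)
  also have "\<dots> = (\<Sum>w\<in>nb v. tp w v * (cond_vert ends c u * avgn n (ind w) u))"
    by (simp add: sum_distrib_left mult.left_commute)
  also have "\<dots> = (\<Sum>w\<in>nb v. tp w v * (cond_vert ends c w * avgn n (ind u) w))"
    by (intro sum.cong refl arg_cong[where f = "\<lambda>t. _ * t"] Suc)
  also have "\<dots> = (\<Sum>w\<in>nb v. cond_vert ends c v * (tp v w * avgn n (ind u) w))"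
  proof (intro sum.cong refl)
    fix w
    have "cond_vert ends c w * tp w v = cond_vert ends c v * tp v w"
      unfolding cond_vert_p by (rule cond_pair_sym)
    then show "tp w v * (cond_vert ends c w * avgn n (ind u) w) =
        cond_vert ends c v * (tp v w * avgn n (ind u) w)"
      by (simp only: mult.assoc[symmetric] mult.commute[of "tp w v"])
  qed
  also have "\<dots> = cond_vert ends c v * avgn (Suc n) (ind u) v"
    by (simp add: avgn_Suc avg_def sum_distrib_left)
  finally show ?case .
qed simp

end

section \<open>Transience: visits to the root and heights tending to 1\<close>

locale transient_walk = network_walk ends c P
  for ends :: "'e \<Rightarrow> 'v \<times> 'v" and c :: "'e \<Rightarrow> real" and P :: "'v \<Rightarrow> (nat \<Rightarrow> 'v) measure" +
  fixes \<rho> :: 'v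
  assumes transient: "transient_at P \<rho>"
begin

abbreviation "y \<equiv> esc P \<rho>"

definition hit :: "'v \<Rightarrow> real" where "hit v = 1 - y v"

lemma y_nonneg: "0 \<le> y v" and y_le_1: "y v \<le> 1"
  by (auto simp: esc_def)

lemma avoid_measurable [measurable]: "{\<omega>. \<forall>n. \<omega> n \<noteq> \<rho>} \<in> sets (walk_space :: (nat \<Rightarrow> 'v) measure)"
proof -
  have "{\<omega> \<in> space (walk_space :: (nat \<Rightarrow> 'v) measure). \<forall>n. \<omega> n \<noteq> \<rho>} \<in> sets walk_space"
    by measurable
  then show ?thesis by simp
qed

lemma avg_y: "avg y v = measure (P v) {\<omega>. \<forall>n. shift 1 \<omega> n \<noteq> \<rho>}"
  using measure_shift[OF avoid_measurable, of v 1] by (simp add: avgn_Suc esc_def[abs_def])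

lemma y_root: "y \<rho> = 0"
proof -
  have "measure (P \<rho>) {\<omega>. \<forall>n. \<omega> n \<noteq> \<rho>} = measure (P \<rho>) {}"
    by (rule measure_start_cong) auto
  then show ?thesis by (simp add: esc_def)
qed

lemma y_harmonic: "v \<noteq> \<rho> \<Longrightarrow> avg y v = y v"
  unfolding avg_y esc_def
proof (rule measure_start_cong)
  show "{\<omega>. \<forall>n. shift 1 \<omega> n \<noteq> \<rho>} \<in> sets (walk_space :: (nat \<Rightarrow> 'v) measure)"
    using measurable_sets[OF shift_measurable avoid_measurable, of 1] by (simp add: vimage_def)
  fix \<omega> :: "nat \<Rightarrow> 'v" assume "v \<noteq> \<rho>" "\<omega> 0 = v"
  then show "\<omega> \<in> {\<omega>. \<forall>n. shift 1 \<omega> n \<noteq> \<rho>} \<longleftrightarrow> \<omega> \<in> {\<omega>. \<forall>n. \<omega> n \<noteq> \<rho>}"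
    by (auto, metis not0_implies_Suc)
qed auto

lemma avg_y_root_pos: "0 < avg y \<rho>"
proof -
  have m: "{\<omega>. \<exists>n\<ge>1. \<omega> n = \<rho>} \<in> sets (P \<rho>)"
    using ex_coord_measurable[of "\<lambda>n w. n \<ge> 1 \<and> w = \<rho>"] by simp
  have "{\<omega>. \<forall>n. shift 1 \<omega> n \<noteq> \<rho>} = UNIV - {\<omega> :: nat \<Rightarrow> 'v. \<exists>n\<ge>1. \<omega> n = \<rho>}"
    by (auto dest: Suc_le_D)
  then have "avg y \<rho> = 1 - measure (P \<rho>) {\<omega>. \<exists>n\<ge>1. \<omega> n = \<rho>}"
    unfolding avg_y using PS.prob_compl[OF m] by simp
  then show ?thesis using transient by (simp add: transient_at_def)
qed

lemma y_sub: "y v \<le> avg y v"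
  using y_harmonic[of v] avg_y_root_pos y_root by (cases "v = \<rho>") auto

lemma hit_nonneg: "0 \<le> hit v" and hit_root: "hit \<rho> = 1"
  using y_nonneg[of v] y_le_1[of v] y_root by (auto simp: hit_def)

lemma avg_hit: "avg hit v = 1 - avg y v"
  unfolding hit_def[abs_def] by (simp add: avg_diff)

lemma hit_super: "avg hit v \<le> hit v"
  using y_sub[of v] by (simp add: avg_hit hit_def)

text \<open>Expected number of visits to \<open>\<rho>\<close> before time \<open>N\<close>. The
  truncation avoids infinite sums; the bounds obtained are uniform in \<open>N\<close>.\<close>

definition green :: "nat \<Rightarrow> 'v \<Rightarrow> real" where
  "green N v = (\<Sum>n<N. avgn n (ind \<rho>) v)"

lemma green_Suc: "green (Suc N) v = ind \<rho> v + avg (green N) v"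
proof -
  have "green (Suc N) v = ind \<rho> v + (\<Sum>n<N. avg (avgn n (ind \<rho>)) v)"
    unfolding green_def by (subst sum.lessThan_Suc_shift) (simp add: avgn_Suc)
  also have "(\<Sum>n<N. avg (avgn n (ind \<rho>)) v) = avg (green N) v"
    unfolding green_def[abs_def] avg_def sum_distrib_left by (rule sum.swap)
  finally show ?thesis .
qed

lemma green_mono: "green N v \<le> green (Suc N) v"
  unfolding green_def by (simp add: avgn_nonneg)

text \<open>Induction on \<open>N\<close> replaces the strong Markov property at the first visit:
  away from the root \<open>hit\<close> is harmonic, so the bound survives a step; at the root it is
  an equality.\<close>

lemma green_le_root: "green N v \<le> hit v * green N \<rho>"
proof (induction N arbitrary: v)
  case (Suc N)
  show ?case
  proof (cases "v = \<rho>")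
    case False
    have "green (Suc N) v = avg (green N) v" using False by (simp add: green_Suc)
    also have "\<dots> \<le> avg (\<lambda>w. green N \<rho> * hit w) v"
      using Suc by (intro avg_mono) (simp add: mult.commute)
    also have "\<dots> = hit v * green N \<rho>"
      using False y_harmonic[of v] unfolding avg_cmult avg_hit by (simp add: hit_def)
    also have "\<dots> \<le> hit v * green (Suc N) \<rho>"
      using green_mono hit_nonneg by (intro mult_left_mono)
    finally show ?thesis .
  qed (simp add: hit_root)
qed (simp add: green_def)

text \<open>By \<open>green_le_root\<close> the value \<open>G\<close> at the root satisfies
  \<open>G \<le> 1 + G * (1 - q)\<close>, where \<open>q = avg y \<rho>\<close> is the probability
  of not returning; transience makes \<open>q\<close> positive.\<close>

lemma green_root_le: "green N \<rho> \<le> 1 / avg y \<rho>"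
proof -
  have "green N \<rho> \<le> green (Suc N) \<rho>" by (rule green_mono)
  also have "\<dots> \<le> 1 + avg (\<lambda>w. green N \<rho> * hit w) \<rho>"
    unfolding green_Suc using green_le_root by (auto intro!: avg_mono simp: mult.commute)
  also have "\<dots> = 1 + green N \<rho> * (1 - avg y \<rho>)"
    by (simp add: avg_cmult avg_hit)
  finally have "green N \<rho> * avg y \<rho> \<le> 1" by (simp add: algebra_simps)
  then show ?thesis using avg_y_root_pos by (simp add: field_simps)
qed

lemma green_le: "green N v \<le> hit v / avg y \<rho>"
  using order_trans[OF green_le_root mult_left_mono[OF green_root_le hit_nonneg]] by simp

text \<open>Borel-Cantelli: the expected number of visits is finite.\<close>

lemma hits_finitely: "AE \<omega> in P v. eventually (\<lambda>n. \<omega> n \<noteq> \<rho>) sequentially"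
proof -
  define A where "A n = {\<omega> :: nat \<Rightarrow> 'v. \<omega> n = \<rho>}" for n
  have A: "A n \<in> sets walk_space" for n
    using pred_coord[of "\<lambda>w. w = \<rho>" n] by (simp add: pred_def A_def)
  have pA: "measure (P v) (A n) = avgn n (ind \<rho>) v" for n
  proof -
    have "measure (P v) (A n) = (\<integral>\<omega>. indicator (A n) \<omega> \<partial>P v)" using A by simp
    also have "\<dots> = (\<integral>\<omega>. ind \<rho> (\<omega> n) \<partial>P v)"
      by (intro Bochner_Integration.integral_cong) (auto simp: A_def indicator_def)
    also have "\<dots> = avgn n (ind \<rho>) v" by (rule expectation_coord[where C = 1]) simp
    finally show ?thesis .
  qed
  have "summable (\<lambda>n. avgn n (ind \<rho>) v)"
  proof (rule summableI_nonneg_bounded)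
    show "0 \<le> avgn n (ind \<rho>) v" for n by (rule avgn_nonneg) auto
    show "(\<Sum>i<n. avgn i (ind \<rho>) v) \<le> hit v / avg y \<rho>" for n
      using green_le[of n v] by (simp add: green_def)
  qed
  then have "AE \<omega> in P v. eventually (\<lambda>n. \<omega> \<in> space (P v) - A n) sequentially"
    using A by (intro borel_cantelli_AE1) (auto simp: pA PS.emeasure_eq_measure)
  then show ?thesis by eventually_elim (auto simp: A_def elim: eventually_mono)
qed

text \<open>\<open>avgn n hit v\<close> is the probability of a visit to the root at or after time
  \<open>n\<close>.\<close>

lemma avgn_hit_tendsto: "(\<lambda>n. avgn n hit v) \<longlonglongrightarrow> 0"
proof -
  define H where "H n = {\<omega> :: nat \<Rightarrow> 'v. \<exists>j. shift n \<omega> j = \<rho>}" for n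
  have H0: "{\<omega> :: nat \<Rightarrow> 'v. \<exists>j. \<omega> j = \<rho>} \<in> sets walk_space"
    by (rule ex_coord_measurable)
  have "measure (P w) {\<omega>. \<exists>j. \<omega> j = \<rho>} = hit w" for w
  proof -
    have "{\<omega> :: nat \<Rightarrow> 'v. \<exists>j. \<omega> j = \<rho>} = UNIV - {\<omega>. \<forall>n. \<omega> n \<noteq> \<rho>}" by auto
    then show ?thesis
      using PS.prob_compl[of "{\<omega>. \<forall>n. \<omega> n \<noteq> \<rho>}" w] by (simp only: hit_def esc_def) simp
  qed
  then have "measure (P v) (H n) = avgn n hit v" for n
    using measure_shift[OF H0, of v n] by (simp add: H_def)
  moreover have "(\<lambda>n. measure (P v) (H n)) \<longlonglongrightarrow> measure (P v) (\<Inter>n. H n)"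
  proof (rule PS.finite_Lim_measure_decseq)
    show "range H \<subseteq> sets (P v)"
      using measurable_sets[OF shift_measurable H0] by (auto simp: H_def vimage_def)
    show "decseq H"
      by (rule decseq_SucI) (auto simp: H_def, metis add_Suc_right)
  qed
  moreover have "measure (P v) (\<Inter>n. H n) = 0"
  proof (rule PS.prob_eq_0[THEN iffD2])
    have "H n \<in> sets (P v)" for n
      using measurable_sets[OF shift_measurable H0, of n] by (simp add: H_def vimage_def)
    then show "(\<Inter>n. H n) \<in> PS.events v" by auto
    show "AE \<omega> in P v. \<omega> \<notin> (\<Inter>n. H n)"
      using hits_finitely[of v]
      by eventually_elim (auto simp: H_def eventually_sequentially, metis le_add1)
  qed
  ultimately show ?thesis by simp
qed

text \<open>Along the walk \<open>hit\<close> is a non-negative supermartingale whose means tend to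
  0; the maximal inequality upgrades this to almost sure convergence.\<close>

lemma y_tendsto_1: "AE \<omega> in P v. (\<lambda>n. y (\<omega> n)) \<longlonglongrightarrow> 1"
proof -
  define B where "B \<epsilon> = {\<omega> :: nat \<Rightarrow> 'v. \<exists>k. \<epsilon> \<le> hit (\<omega> k)}" for \<epsilon>
  have B: "B \<epsilon> \<in> sets walk_space" for \<epsilon>
    unfolding B_def by (rule ex_coord_measurable)
  have "AE \<omega> in P v. \<exists>n. shift n \<omega> \<notin> B \<epsilon>" if \<epsilon>: "0 < \<epsilon>" for \<epsilon>
  proof (rule AE_tail_of_measure[OF B])
    have "\<epsilon> * measure (P w) (B \<epsilon>) \<le> hit w" for w
      unfolding B_def using \<epsilon>
      by (intro maximal[where b = "\<lambda>_. hit"]) (auto simp: hit_nonneg hit_super)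
    then have "measure (P w) (B \<epsilon>) \<le> (1 / \<epsilon>) * hit w" for w
      using \<epsilon> by (simp add: field_simps)
    then have "avgn n (\<lambda>w. measure (P w) (B \<epsilon>)) v \<le> (1 / \<epsilon>) * avgn n hit v" for n
      by (subst avgn_cmult[symmetric]) (rule avgn_mono)
    moreover have "(\<lambda>n. (1 / \<epsilon>) * avgn n hit v) \<longlonglongrightarrow> (1 / \<epsilon>) * 0"
      by (intro tendsto_intros avgn_hit_tendsto)
    ultimately show "(\<lambda>n. avgn n (\<lambda>w. measure (P w) (B \<epsilon>)) v) \<longlonglongrightarrow> 0"
      by (intro LIMSEQ_squeeze_0[OF _ avgn_nonneg]) auto
  qed
  then have "AE \<omega> in P v. \<forall>j. \<exists>n. shift n \<omega> \<notin> B (1 / real (Suc j))"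
    by (subst AE_all_countable) auto
  then show ?thesis
  proof eventually_elim
    case (elim \<omega>)
    show ?case
    proof (rule metric_LIMSEQ_I)
      fix e :: real assume "0 < e"
      then obtain j where j: "1 / real (Suc j) < e" by (metis nat_approx_posE)
      obtain n where n: "shift n \<omega> \<notin> B (1 / real (Suc j))" using elim by blast
      have "dist (y (\<omega> m)) 1 < e" if "m \<ge> n" for m
      proof -
        have "\<not> 1 / real (Suc j) \<le> hit (shift n \<omega> (m - n))"
          using n by (auto simp only: B_def mem_Collect_eq)
        then show ?thesis
          using that j y_le_1[of "\<omega> m"] unfolding dist_real_def hit_def by simp
      qed
      then show "\<exists>no. \<forall>n\<ge>no. dist (y (\<omega> n)) 1 < e" by blast
    qed
  qed
qed

end

subsection \<open>The rectangle tiling\<close>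

lemma arc_shift: "x \<in> arc \<eta> b l \<Longrightarrow> x + of_int k * \<eta> \<in> arc \<eta> b l"
proof -
  assume "x \<in> arc \<eta> b l"
  then obtain j :: int where "b + of_int j * \<eta> \<le> x" "x \<le> b + of_int j * \<eta> + l"
    by (auto simp: arc_def)
  then show ?thesis
    unfolding arc_def by (auto intro!: exI[of _ "j + k"] simp: algebra_simps)
qed

lemma arc_segment:
  assumes "x \<in> arc \<eta> b l"
  obtains p where "p \<le> x" "x \<le> p + l" "{p..p + l} \<subseteq> arc \<eta> b l"
proof -
  obtain j :: int where "b + of_int j * \<eta> \<le> x" "x \<le> b + of_int j * \<eta> + l"
    using assms by (auto simp: arc_def)
  then show ?thesis
    by (intro that[of "b + of_int j * \<eta>"]) (auto simp: arc_def)
qed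

lemma countable_arc_0: "countable (arc \<eta> b 0)"
proof -
  have "arc \<eta> b 0 \<subseteq> range (\<lambda>k::int. b + of_int k * \<eta>)" by (auto simp: arc_def)
  then show ?thesis by (rule countable_subset) simp
qed

lemma arc_piece: "{b + of_int k * \<eta>..b + of_int k * \<eta> + l} \<subseteq> arc \<eta> b l"
  by (auto simp: arc_def)

lemma arc_start: "0 \<le> l \<Longrightarrow> b + of_int k * \<eta> \<in> arc \<eta> b l"
  by (auto simp: arc_def)

lemma shift_into_window:
  fixes \<eta> :: real
  assumes "0 < \<eta>"
  obtains k :: int where "z - \<eta> / 2 \<le> b + of_int k * \<eta>" "b + of_int k * \<eta> < z + \<eta> / 2"
proof -
  define t where "t = (b - (z - \<eta> / 2)) / \<eta>"
  have b: "b = z - \<eta> / 2 + t * \<eta>" using assms by (simp add: t_def)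
  have 1: "of_int \<lfloor>t\<rfloor> \<le> t" "t < of_int \<lfloor>t\<rfloor> + 1" by linarith+
  have "of_int \<lfloor>t\<rfloor> * \<eta> \<le> t * \<eta>" "t * \<eta> < (of_int \<lfloor>t\<rfloor> + 1) * \<eta>"
    using 1 assms by auto
  then show ?thesis
    by (intro that[of "- \<lfloor>t\<rfloor>"]) (auto simp: b algebra_simps)
qed

lemma arc_length_ge:
  assumes "0 < \<eta>" "0 \<le> l" "l \<le> \<eta>"
  shows "l \<le> arc_length \<eta> (arc \<eta> b l)"
proof -
  obtain k :: int where k: "0 \<le> b + of_int k * \<eta>" "b + of_int k * \<eta> < \<eta>"
    using shift_into_window[of \<eta> "\<eta> / 2" b] assms by auto
  define p where "p = b + of_int k * \<eta>"
  have sub: "{p..p + l} \<subseteq> arc \<eta> b l" "{p - \<eta>..p - \<eta> + l} \<subseteq> arc \<eta> b l"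
  proof -
    show "{p..p + l} \<subseteq> arc \<eta> b l" unfolding p_def by (rule arc_piece)
    have "p - \<eta> = b + of_int (k - 1) * \<eta>" by (simp add: p_def algebra_simps)
    then show "{p - \<eta>..p - \<eta> + l} \<subseteq> arc \<eta> b l" using arc_piece[of b "k - 1" \<eta> l] by simp
  qed
  have "arc \<eta> b l = (\<Union>k::int. {b + of_int k * \<eta>..b + of_int k * \<eta> + l})"
    by (auto simp: arc_def)
  then have m: "arc \<eta> b l \<inter> {0..<\<eta>} \<in> sets lborel" by auto
  \<comment> \<open>The arc starts at \<open>p\<close> in \<open>[0, \<eta>)\<close>; what reaches
    beyond \<open>\<eta>\<close> re-enters at 0.\<close>
  define S where "S = {p..<min (p + l) \<eta>} \<union> {0..<p + l - \<eta>}"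
  have "emeasure lborel S = emeasure lborel {p..<min (p + l) \<eta>} + emeasure lborel {0..<p + l - \<eta>}"
    unfolding S_def using assms by (intro plus_emeasure[symmetric]) auto
  also have "\<dots> = ennreal l"
  proof (cases "p + l \<le> \<eta>")
    case True
    then show ?thesis using assms by simp
  next
    case False
    then show ?thesis using assms k by (simp add: p_def[symmetric] ennreal_plus[symmetric] del: ennreal_plus)
  qed
  finally have "emeasure lborel S = ennreal l" .
  then have "l = measure lborel S" using assms by (simp add: measure_def)
  also have "\<dots> \<le> measure lborel (arc \<eta> b l \<inter> {0..<\<eta>})"
  proof (rule measure_mono_fmeasurable)
    show "S \<subseteq> arc \<eta> b l \<inter> {0..<\<eta>}"
    proof
      fix x assume x: "x \<in> S"
      then have "x \<in> {p..p + l} \<or> x \<in> {p - \<eta>..p - \<eta> + l}"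
        using k by (auto simp: S_def p_def[symmetric])
      then have "x \<in> arc \<eta> b l" using sub by auto
      moreover have "x \<in> {0..<\<eta>}"
        using x k assms by (auto simp: S_def p_def[symmetric])
      ultimately show "x \<in> arc \<eta> b l \<inter> {0..<\<eta>}" by simp
    qed
    have "emeasure lborel (arc \<eta> b l \<inter> {0..<\<eta>}) \<le> emeasure lborel {0..<\<eta>}"
      by (rule emeasure_mono) auto
    also have "\<dots> < \<infinity>" using assms by simp
    finally show "arc \<eta> b l \<inter> {0..<\<eta>} \<in> fmeasurable lborel"
      using m by (auto simp: fmeasurable_def)
  qed (simp add: S_def)
  finally show ?thesis by (simp add: arc_length_def)
qed

lemma segment_meets_interval:
  fixes c d p q x :: real
  assumes "c < d" "c \<le> x" "x \<le> d" "p < x" "x < q"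
  obtains p' q' where "p' < q'" "p \<le> p'" "q' \<le> q" "{p'<..<q'} \<subseteq> {c..d}"
  by (rule that[of "max c p" "min d q"]) (use assms in auto)

section \<open>How tiles and vertex arcs can meet\<close>

locale tiled_walk = transient_walk ends c P \<rho>
  for ends :: "'e \<Rightarrow> 'v \<times> 'v" and c :: "'e \<Rightarrow> real" and P :: "'v \<Rightarrow> (nat \<Rightarrow> 'v) measure" and \<rho> :: 'v +
  fixes pos :: "'v \<Rightarrow> complex" and \<gamma> :: "'e \<Rightarrow> real \<Rightarrow> complex" and a :: "'e \<Rightarrow> real"
  assumes tiling: "rectangle_tiling ends c P \<rho> pos \<gamma> a"
begin

abbreviation "\<eta> \<equiv> eta ends c P \<rho>"
abbreviation "lo \<equiv> y_lo ends P \<rho>"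
abbreviation "hi \<equiv> y_hi ends P \<rho>"
abbreviation "len \<equiv> tile_len ends c P \<rho>"
abbreviation "T \<equiv> tile_int ends c P \<rho> a"
abbreviation "V \<equiv> vert_int ends c P \<rho> a"
abbreviation "up \<equiv> up_edge ends P \<rho>"

text \<open>\<open>\<eta>\<close> is \<open>cond_vert\<close> at the root times the probability of
  not returning there: the total flow out of the root.\<close>

lemma eta_pos: "0 < \<eta>"
proof -
  have "\<eta> = cond_vert ends c \<rho> * avg y \<rho>"
    unfolding eta_def avg_def sum_distrib_left by (simp add: cond_vert_p mult.assoc[symmetric])
  then show ?thesis using cond_vert_pos avg_y_root_pos by simp
qed

lemma lo_le_hi: "lo e \<le> hi e"
  by (simp add: y_lo_def y_hi_def)

lemma len_nonneg: "0 \<le> len e"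
  unfolding tile_len_def using c_pos[of e] lo_le_hi[of e] by simp

lemma len_pos: "0 < len e \<longleftrightarrow> lo e < hi e"
  unfolding tile_len_def using c_pos[of e] by (simp add: zero_less_mult_iff)

lemma rects_disjoint: "e1 \<noteq> e2 \<Longrightarrow>
    interior (tile_rect ends c P \<rho> a e1) \<inter> interior (tile_rect ends c P \<rho> a e2) = {}"
  and rects_cover: "(\<Union>e. tile_rect ends c P \<rho> a e) = UNIV \<times> {0..<1}"
  and V_arc: "is_arc \<eta> (V v)"
  and V_in: "v \<noteq> \<rho> \<Longrightarrow> V v = vert_int_in ends c P \<rho> a v"
  using tiling by (auto simp: rectangle_tiling_def)

lemma T_nonempty: "a e + of_int k * \<eta> \<in> T e"
  unfolding tile_int_def by (rule arc_start) (rule len_nonneg)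

text \<open>Tiles are closed and, even those of length 0, non-empty, while the cylinder they cover
  is open at the top.\<close>

lemma hi_less_1: "hi e < 1"
proof -
  have "(a e + of_int 0 * \<eta>, hi e) \<in> tile_rect ends c P \<rho> a e"
    using T_nonempty[of e 0] lo_le_hi by (simp add: tile_rect_def)
  then have "(a e + of_int 0 * \<eta>, hi e) \<in> UNIV \<times> {0..<1}"
    using rects_cover by blast
  then show ?thesis by simp
qed

lemma adjE:
  assumes "adj ends u w" obtains e where "ends e = (u, w) \<or> ends e = (w, u)"
  using assms by (auto simp: adj_def)

lemma y_less_1: "y v < 1"
proof -
  have "nb v \<noteq> {}" by (metis sum_p sum.empty zero_neq_one)
  then obtain w e where "ends e = (v, w) \<or> ends e = (w, v)" by (auto simp: nbrs_def adj_def)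
  then have "y v \<le> hi e" by (auto simp: y_hi_def)
  then show ?thesis using hi_less_1[of e] by simp
qed

lemma upD:
  assumes "up e u w"
  shows "lo e = y u" "hi e = y w"
  using assms by (auto simp: up_edge_def y_lo_def y_hi_def min_def max_def)

text \<open>If \<open>v\<close> is a lower end of \<open>e\<close>, the tile is one of those
  defining the arc. If \<open>v\<close> is strictly the upper end, it is not the root, and by
  \<open>V_in\<close> the tiles from below fill the same arc.\<close>

lemma T_sub_V:
  assumes e: "ends e = (v, w) \<or> ends e = (w, v)"
  shows "T e \<subseteq> V v"
proof (cases "y v \<le> y w")
  case True
  then have "up e v w" using e by (auto simp: up_edge_def)
  then show ?thesis unfolding vert_int_def by blast
next
  case False
  then have "up e w v" using e by (auto simp: up_edge_def)
  then have "T e \<subseteq> vert_int_in ends c P \<rho> a v" unfolding vert_int_in_def by blast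
  moreover have "v \<noteq> \<rho>" using False y_root y_nonneg[of w] by auto
  ultimately show ?thesis using V_in by simp
qed

lemma tiles_no_overlap:
  assumes "e \<noteq> e'" "p < q" "{p<..<q} \<subseteq> T e" "{p<..<q} \<subseteq> T e'"
    and "lo e < s" "s < hi e" "lo e' < s" "s < hi e'"
  shows False
proof -
  have "((p + q) / 2, s) \<in> interior (tile_rect ends c P \<rho> a e)"
    if "{p<..<q} \<subseteq> T e" "lo e < s" "s < hi e" for e
  proof (rule interiorI)
    show "open ({p<..<q} \<times> {lo e<..<hi e})" by (intro open_Times) auto
    show "((p + q) / 2, s) \<in> {p<..<q} \<times> {lo e<..<hi e}" using that assms(2) by auto
    show "{p<..<q} \<times> {lo e<..<hi e} \<subseteq> tile_rect ends c P \<rho> a e"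
      using that by (auto simp: tile_rect_def)
  qed
  then show False using rects_disjoint[OF assms(1)] assms by blast
qed

text \<open>The arc is the union of the tiles rising from \<open>v\<close>. Those of length 0 cover
  only countably many points, so some point of the interval lies in a tile of positive length and
  height.\<close>

lemma tile_above:
  assumes "p < q" "{p<..<q} \<subseteq> V v"
  obtains e w p' q' where "up e v w" "y v < y w" "p \<le> p'" "p' < q'" "q' \<le> q" "{p'<..<q'} \<subseteq> T e"
proof -
  define D where "D = (\<Union>e\<in>{e \<in> incident ends v. len e = 0}. T e)"
  have "countable D"
    unfolding D_def using finite_incident[of v] countable_arc_0
    by (intro countable_UN) (auto simp: tile_int_def intro: countable_finite)
  moreover have "uncountable {p<..<q}" using assms by (simp add: uncountable_open_interval)
  ultimately obtain x where x: "x \<in> {p<..<q}" "x \<notin> D"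
    by (metis countable_subset subsetI)
  then obtain e w where e: "up e v w" "x \<in> T e"
    using assms(2) unfolding vert_int_def by blast
  have "e \<in> incident ends v" using e by (auto simp: up_edge_def incident_def)
  then have "len e \<noteq> 0" using x e by (auto simp: D_def)
  then have "0 < len e" using len_nonneg[of e] by simp
  moreover obtain b where "b \<le> x" "x \<le> b + len e" "{b..b + len e} \<subseteq> T e"
    using arc_segment e(2) unfolding tile_int_def by metis
  ultimately have b: "b < b + len e" "b \<le> x" "x \<le> b + len e" "{b..b + len e} \<subseteq> T e" by auto
  moreover have "p < x" "x < q" using x by auto
  ultimately obtain p' q' where "p' < q'" "p \<le> p'" "q' \<le> q" "{p'<..<q'} \<subseteq> {b..b + len e}"
    using segment_meets_interval by metis
  with b have "p' < q'" "p \<le> p'" "q' \<le> q" "{p'<..<q'} \<subseteq> T e" by auto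
  moreover have "0 < len e" using b by simp
  then have "y v < y w" using upD[OF e(1)] by (simp add: len_pos)
  ultimately show ?thesis using e(1) that by blast
qed

text \<open>Just above the common height, tiles rising from \<open>u\<close> and from
  \<open>w\<close> would overlap.\<close>

lemma verts_no_overlap:
  assumes "u \<noteq> w" "y u = y w" "p < q" "{p<..<q} \<subseteq> V u" "{p<..<q} \<subseteq> V w"
  shows False
proof -
  obtain e x p1 q1 where e: "up e u x" "y u < y x" "p \<le> p1" "p1 < q1" "q1 \<le> q" "{p1<..<q1} \<subseteq> T e"
    using tile_above[OF assms(3,4)] .
  have "{p1<..<q1} \<subseteq> V w" using e assms(5) by (meson greaterThanLessThan_subseteq_greaterThanLessThan order_trans)
  then obtain e' x' p2 q2 where e': "up e' w x'" "y w < y x'" "p1 \<le> p2" "p2 < q2" "q2 \<le> q1" "{p2<..<q2} \<subseteq> T e'"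
    using tile_above[OF e(4)] by metis
  have "e \<noteq> e'" using e(1,2) e'(1,2) assms(1,2) by (auto simp: up_edge_def)
  moreover have "{p2<..<q2} \<subseteq> T e"
    using e e' by (meson greaterThanLessThan_subseteq_greaterThanLessThan order_trans)
  moreover obtain s where "y u < s" "s < y x" "s < y x'"
    using dense[of "y u" "min (y x) (y x')"] e(2) e'(2) assms(2) by auto
  ultimately show False
    using tiles_no_overlap[OF _ e'(4), of e e' s] e'(6) upD[OF e(1)] upD[OF e'(1)] assms(2) by simp
qed

text \<open>A tile rising from \<open>v\<close> would overlap that of \<open>e\<close> just above
  the height \<open>y v\<close>.\<close>

lemma tile_vert_no_overlap:
  assumes "p < q" "{p<..<q} \<subseteq> T e" "{p<..<q} \<subseteq> V v" "lo e < y v" "y v < hi e"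
  shows False
proof -
  obtain e' x p1 q1 where e': "up e' v x" "y v < y x" "p \<le> p1" "p1 < q1" "q1 \<le> q" "{p1<..<q1} \<subseteq> T e'"
    using tile_above[OF assms(1,3)] .
  have "e \<noteq> e'" using upD[OF e'(1)] assms by auto
  moreover have "{p1<..<q1} \<subseteq> T e"
    using assms(2) e' by (meson greaterThanLessThan_subseteq_greaterThanLessThan order_trans)
  moreover obtain s where "y v < s" "s < y x" "s < hi e"
    using dense[of "y v" "min (y x) (hi e)"] e'(2) assms(5) by auto
  ultimately show False
    using tiles_no_overlap[OF _ e'(4), of e e' s] e'(6) upD[OF e'(1)] assms(4) by simp
qed

text \<open>Where \<open>y\<close> is constant around \<open>v\<close>, all tiles at
  \<open>v\<close> have length 0 and the arc is a single point of the circle. Disjointness of tile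
  interiors says nothing about such vertices, so they are set apart.\<close>

definition fat :: "'v \<Rightarrow> bool" where
  "fat v \<longleftrightarrow> (\<exists>p q. p < q \<and> {p<..<q} \<subseteq> V v)"

lemma fat_segment:
  assumes "fat v" "x \<in> V v"
  obtains p q where "p < q" "p \<le> x" "x \<le> q" "{p..q} \<subseteq> V v"
proof -
  obtain b l where l: "0 \<le> l" "V v = arc \<eta> b l" using V_arc[of v] unfolding is_arc_def by blast
  have "0 < l"
  proof (rule ccontr)
    assume "\<not> 0 < l"
    then have "countable (V v)" using l countable_arc_0 by simp
    then show False
      using assms(1) unfolding fat_def by (metis countable_subset uncountable_open_interval)
  qed
  then show ?thesis using arc_segment assms(2) l that by (metis less_add_same_cancel1)
qed

text \<open>The point \<open>x\<close> may be an end of the arc of \<open>w\<close>, but a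
  non-degenerate arc through \<open>x\<close> overlaps every open interval around
  \<open>x\<close>.\<close>

lemma vert_interior_avoids_vert:
  assumes "u \<noteq> w" "y u = y w" "{p<..<q} \<subseteq> V u" "p < x" "x < q" "fat w" "x \<in> V w"
  shows False
proof -
  obtain p1 q1 where "p1 < q1" "p1 \<le> x" "x \<le> q1" "{p1..q1} \<subseteq> V w"
    using fat_segment[OF assms(6,7)] .
  moreover obtain p' q' where "p' < q'" "p \<le> p'" "q' \<le> q" "{p'<..<q'} \<subseteq> {p1..q1}"
    using segment_meets_interval[of p1 q1 x p q] calculation assms by metis
  ultimately show False
    using verts_no_overlap[OF assms(1,2), of p' q'] assms(3)
    by (meson greaterThanLessThan_subseteq_greaterThanLessThan order_trans)
qed

lemma tile_interior_avoids_vert: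
  assumes "lo e < y v" "y v < hi e" "{p<..<q} \<subseteq> T e" "p < x" "x < q" "fat v" "x \<in> V v"
  shows False
proof -
  obtain p1 q1 where "p1 < q1" "p1 \<le> x" "x \<le> q1" "{p1..q1} \<subseteq> V v"
    using fat_segment[OF assms(6,7)] .
  moreover obtain p' q' where "p' < q'" "p \<le> p'" "q' \<le> q" "{p'<..<q'} \<subseteq> {p1..q1}"
    using segment_meets_interval[of p1 q1 x p q] calculation assms by metis
  ultimately show False
    using tile_vert_no_overlap[of p' q' e v] assms(1-3)
    by (meson greaterThanLessThan_subseteq_greaterThanLessThan order_trans)
qed

lemma tile_interiors_disjoint:
  assumes "e \<noteq> e'" "lo e < s" "s < hi e" "lo e' < s" "s < hi e'"
    and "{p<..<q} \<subseteq> T e" "p < x" "x < q" "{p'<..<q'} \<subseteq> T e'" "p' < x" "x < q'"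
  shows False
  by (rule tiles_no_overlap[OF assms(1), of "max p p'" "min q q'" s]) (use assms in auto)

text \<open>Each arc through \<open>x\<close> contains an interval just to the left or just to the
  right of \<open>x\<close>; of three arcs, two share a side.\<close>

lemma no_three_at_point:
  assumes "u \<noteq> v" "v \<noteq> w" "u \<noteq> w" "y u = y v" "y v = y w"
    and "fat u" "fat v" "fat w" "x \<in> V u" "x \<in> V v" "x \<in> V w"
  shows False
proof -
  have side: "(\<exists>r>0. {x<..<x + r} \<subseteq> V z) \<or> (\<exists>r>0. {x - r<..<x} \<subseteq> V z)"
    if z: "fat z" "x \<in> V z" for z
  proof -
    obtain p q where pq: "p < q" "p \<le> x" "x \<le> q" "{p..q} \<subseteq> V z"
      using fat_segment[OF z] .
    show ?thesis
    proof (cases "x < q")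
      case True
      then have "q - x > 0 \<and> {x<..<x + (q - x)} \<subseteq> V z" using pq by auto
      then show ?thesis by blast
    next
      case False
      then have "x - p > 0 \<and> {x - (x - p)<..<x} \<subseteq> V z" using pq by auto
      then show ?thesis by blast
    qed
  qed
  have R: False if "z \<noteq> z'" "y z = y z'" "r > 0" "r' > 0" "{x<..<x + r} \<subseteq> V z" "{x<..<x + r'} \<subseteq> V z'" for z z' r r'
  proof (rule verts_no_overlap[OF that(1,2), of x "x + min r r'"])
    have "{x<..<x + min r r'} \<subseteq> {x<..<x + r}" "{x<..<x + min r r'} \<subseteq> {x<..<x + r'}" by auto
    then show "{x<..<x + min r r'} \<subseteq> V z" "{x<..<x + min r r'} \<subseteq> V z'" using that by blast+
  qed (use that in auto)
  have L: False if "z \<noteq> z'" "y z = y z'" "r > 0" "r' > 0" "{x - r<..<x} \<subseteq> V z" "{x - r'<..<x} \<subseteq> V z'" for z z' r r'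
  proof (rule verts_no_overlap[OF that(1,2), of "x - min r r'" x])
    have "{x - min r r'<..<x} \<subseteq> {x - r<..<x}" "{x - min r r'<..<x} \<subseteq> {x - r'<..<x}" by auto
    then show "{x - min r r'<..<x} \<subseteq> V z" "{x - min r r'<..<x} \<subseteq> V z'" using that by blast+
  qed (use that in auto)
  show False
    using side[OF assms(6,9)] side[OF assms(7,10)] side[OF assms(8,11)] R L assms(1-5)
    by metis
qed

section \<open>Arcs close to a point\<close>

definition near :: "real \<Rightarrow> real \<Rightarrow> 'v \<Rightarrow> bool" where
  "near z r v \<longleftrightarrow> (\<exists>x\<in>V v. \<bar>x - z\<bar> \<le> r) \<and> arc_length \<eta> (V v) \<le> r"

text \<open>The arc has length at most \<open>r\<close>, an eighth of a period or less, so of its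
  periodic copies only the one at \<open>x\<close> meets the window of one period around
  \<open>z\<close>.\<close>

lemma near_window:
  assumes r: "0 < r" "8 * r \<le> \<eta>" and v: "near z r v"
  obtains l h where "z - 2 * r \<le> l" "l \<le> h" "h \<le> z + 2 * r" "h \<le> l + arc_length \<eta> (V v)"
    "V v \<inter> {z - \<eta> / 2..z + \<eta> / 2} = {l..h}"
proof -
  obtain x where x: "x \<in> V v" "\<bar>x - z\<bar> \<le> r" using v by (auto simp: near_def)
  obtain b L where L: "0 \<le> L" "L \<le> \<eta>" "V v = arc \<eta> b L" using V_arc[of v] unfolding is_arc_def by blast
  have La: "L \<le> arc_length \<eta> (V v)" using arc_length_ge[OF eta_pos L(1,2), of b] L by simp
  then have "L \<le> r" using v by (simp add: near_def)
  obtain k :: int where k: "b + of_int k * \<eta> \<le> x" "x \<le> b + of_int k * \<eta> + L"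
    using x L by (auto simp: arc_def)
  define l where "l = b + of_int k * \<eta>"
  have "V v \<inter> {z - \<eta> / 2..z + \<eta> / 2} = {l..l + L}"
  proof (intro equalityI subsetI)
    fix t assume t: "t \<in> V v \<inter> {z - \<eta> / 2..z + \<eta> / 2}"
    then obtain j :: int where j: "b + of_int j * \<eta> \<le> t" "t \<le> b + of_int j * \<eta> + L"
      using L by (auto simp: arc_def)
    have "j = k"
    proof (rule ccontr)
      assume "j \<noteq> k"
      have e: "b + of_int j * \<eta> = l + of_int (j - k) * \<eta>" by (simp add: l_def algebra_simps)
      consider "of_int (j - k) \<ge> (1 :: real)" | "of_int (j - k) \<le> (-1 :: real)"
        using \<open>j \<noteq> k\<close> by linarith
      then show False
      proof cases
        case 1
        then have "of_int (j - k) * \<eta> \<ge> 1 * \<eta>" using eta_pos by (intro mult_right_mono) auto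
        moreover have "l + of_int (j - k) * \<eta> \<le> t" "t \<le> z + \<eta> / 2" "x \<le> l + L" "z - x \<le> r"
          using j e t k x unfolding l_def[symmetric] by auto
        ultimately show False using r \<open>L \<le> r\<close> by linarith
      next
        case 2
        then have "of_int (j - k) * \<eta> \<le> (-1) * \<eta>" using eta_pos by (intro mult_right_mono) auto
        moreover have "t \<le> l + of_int (j - k) * \<eta> + L" "z - \<eta> / 2 \<le> t" "l \<le> x" "x - z \<le> r"
          using j e t k x unfolding l_def[symmetric] by auto
        ultimately show False using r \<open>L \<le> r\<close> by linarith
      qed
    qed
    then show "t \<in> {l..l + L}" using j by (simp add: l_def)
  next
    fix t assume t: "t \<in> {l..l + L}"
    then have "t \<in> V v" using L by (auto simp: arc_def l_def)
    then show "t \<in> V v \<inter> {z - \<eta> / 2..z + \<eta> / 2}"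
      using t k x r \<open>L \<le> r\<close> unfolding l_def[symmetric] by auto
  qed
  then show ?thesis
    using k x \<open>L \<le> r\<close> La L(1) unfolding l_def[symmetric] by (intro that[of l "l + L"]) auto
qed

text \<open>The copy of the tile that starts in the window starts in the only copy of the arc there.
  If it ran past \<open>h\<close>, it would contain a point of the arc in the window beyond
  \<open>h\<close>.\<close>

lemma tile_in_window:
  assumes r: "0 < r" "8 * r \<le> \<eta>" and e: "ends e = (v, w) \<or> ends e = (w, v)"
    and lh: "h \<le> z + 2 * r" "V v \<inter> {z - \<eta> / 2..z + \<eta> / 2} = {l..h}"
  obtains p where "{p..p + len e} \<subseteq> T e" "{p..p + len e} \<subseteq> {l..h}"
proof -
  obtain k :: int where k: "z - \<eta> / 2 \<le> a e + of_int k * \<eta>" "a e + of_int k * \<eta> < z + \<eta> / 2"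
    using shift_into_window[OF eta_pos] by metis
  define p where "p = a e + of_int k * \<eta>"
  have sub: "{p..p + len e} \<subseteq> T e"
    unfolding tile_int_def arc_def p_def by auto
  have "p \<in> T e" using T_nonempty by (simp add: p_def)
  then have "p \<in> V v" using T_sub_V[OF e] by blast
  then have p: "p \<in> {l..h}" using lh k by (auto simp: p_def[symmetric])
  have "p + len e \<le> h"
  proof (rule ccontr)
    assume "\<not> p + len e \<le> h"
    define t where "t = min (p + len e) (z + \<eta> / 2)"
    have "h < t" using \<open>\<not> p + len e \<le> h\<close> lh(1) r by (simp add: t_def)
    moreover have "t \<in> {p..p + len e}"
      using k len_nonneg[of e] by (auto simp: t_def p_def[symmetric])
    then have "t \<in> V v" using sub T_sub_V[OF e] by blast
    moreover have "z - \<eta> / 2 \<le> t" "t \<le> z + \<eta> / 2" using k len_nonneg[of e] eta_pos by (auto simp: t_def p_def[symmetric])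
    ultimately have "t \<in> V v \<inter> {z - \<eta> / 2..z + \<eta> / 2}" by simp
    then have "t \<in> {l..h}" using lh(2) by blast
    then show False using \<open>h < t\<close> by simp
  qed
  then show ?thesis using sub p that[of p] by auto
qed

text \<open>All these tiles cross the common level \<open>s\<close>, so their intervals have
  disjoint interiors; and they fit into \<open>[z - 2 * r, z + 2 * r]\<close>.\<close>

lemma widths_near:
  assumes r: "0 < r" "8 * r \<le> \<eta>" and F: "finite F"
    and near: "\<And>e. e \<in> F \<Longrightarrow> \<exists>v. e \<in> incident ends v \<and> near z r v"
    and s: "\<And>e. e \<in> F \<Longrightarrow> lo e < s \<and> s < hi e"
  shows "(\<Sum>e\<in>F. len e) \<le> 4 * r"
proof -
  have "\<exists>p. {p..p + len e} \<subseteq> T e \<and> {p..p + len e} \<subseteq> {z - 2 * r..z + 2 * r}" if eF: "e \<in> F" for e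
  proof -
    obtain v where v: "e \<in> incident ends v" "near z r v" using near eF by blast
    then obtain w where w: "ends e = (v, w) \<or> ends e = (w, v)"
      by (cases "ends e") (auto simp: incident_def)
    obtain l h where lh: "z - 2 * r \<le> l" "l \<le> h" "h \<le> z + 2 * r" "h \<le> l + arc_length \<eta> (V v)"
      "V v \<inter> {z - \<eta> / 2..z + \<eta> / 2} = {l..h}"
      using near_window[OF r v(2)] .
    obtain p where "{p..p + len e} \<subseteq> T e" "{p..p + len e} \<subseteq> {l..h}"
      using tile_in_window[OF r w lh(3,5)] .
    then show ?thesis using lh by (intro exI[of _ p]) fastforce
  qed
  then obtain p where p: "\<And>e. e \<in> F \<Longrightarrow> {p e..p e + len e} \<subseteq> T e"
    "\<And>e. e \<in> F \<Longrightarrow> {p e..p e + len e} \<subseteq> {z - 2 * r..z + 2 * r}" by metis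
  define S where "S e = {p e<..<p e + len e}" for e
  have disj: "disjoint_family_on S F"
    unfolding disjoint_family_on_def
  proof (intro ballI impI)
    fix e e' assume e: "e \<in> F" "e' \<in> F" "e \<noteq> e'"
    have sub: "{p e<..<p e + len e} \<subseteq> T e" "{p e'<..<p e' + len e'} \<subseteq> T e'"
      using p(1) e by (meson greaterThanLessThan_subseteq_atLeastAtMost_iff order.refl order_trans)+
    have False if "x \<in> S e" "x \<in> S e'" for x
      using tile_interiors_disjoint[OF e(3), of s "p e" "p e + len e" x "p e'" "p e' + len e'"]
        s[OF e(1)] s[OF e(2)] sub that by (auto simp: S_def)
    then show "S e \<inter> S e' = {}" by blast
  qed
  have "(\<Sum>e\<in>F. len e) = (\<Sum>e\<in>F. measure lborel (S e))"
    using len_nonneg by (simp add: S_def)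
  also have "\<dots> = measure lborel (\<Union>e\<in>F. S e)"
  proof (rule measure_finite_Union[symmetric, OF F _ disj])
    show "emeasure lborel (S e) \<noteq> \<infinity>" for e using len_nonneg[of e] by (simp add: S_def)
  qed (auto simp: S_def)
  also have "\<dots> \<le> measure lborel {z - 2 * r..z + 2 * r}"
  proof (rule measure_mono_fmeasurable)
    show "(\<Union>e\<in>F. S e) \<subseteq> {z - 2 * r..z + 2 * r}"
      using p(2) unfolding S_def by fastforce
    show "{z - 2 * r..z + 2 * r} \<in> fmeasurable lborel"
      by (auto simp: fmeasurable_def emeasure_lborel_Icc_eq)
  qed (use F in \<open>auto simp: S_def\<close>)
  also have "\<dots> = 4 * r" using r by simp
  finally show ?thesis .
qed

end

subsection \<open>The limit angle has no atoms\<close>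

context network_walk
begin

section \<open>Finite Green function expansions and additive functionals\<close>

lemma avgn_pos: "\<exists>j. 0 < avgn j (ind w) v"
proof -
  have "(v, w) \<in> {(x, y). adj ends x y}\<^sup>*" by (rule connected)
  then show ?thesis
  proof (induction rule: converse_rtrancl_induct)
    case base
    have "0 < avgn 0 (ind w) w" by simp
    then show ?case by blast
  next
    case (step v u)
    then obtain j where j: "0 < avgn j (ind w) u" by blast
    have u: "u \<in> nb v" using step by (simp add: nbrs_def)
    have "0 < tp v u * avgn j (ind w) u" using p_pos[OF u] j by simp
    also have "\<dots> \<le> avgn (Suc j) (ind w) v"
      unfolding avgn_Suc avg_def using u
      by (intro member_le_sum[of u "nb v" "\<lambda>x. tp v x * avgn j (ind w) x"] finite_nb mult_nonneg_nonneg avgn_nonneg) auto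
    finally show ?case by blast
  qed
qed

text \<open>Only finitely many vertices can be reached in fewer than \<open>M\<close> steps; this
  keeps the expansions below finite sums.\<close>

lemma avgn_local: "\<exists>R. finite R \<and> (\<forall>n<M. \<forall>f g. (\<forall>u\<in>R. f u = g u) \<longrightarrow> avgn n f v = avgn n g v)"
proof -
  have one: "\<exists>R. finite R \<and> (\<forall>f g. (\<forall>u\<in>R. f u = g u) \<longrightarrow> avgn n f v = avgn n g v)" for n v
  proof (induction n arbitrary: v)
    case 0
    show ?case by (intro exI[of _ "{v}"]) auto
  next
    case (Suc n)
    then obtain R where R': "\<And>v. finite (R v) \<and> (\<forall>f g. (\<forall>u\<in>R v. f u = g u) \<longrightarrow> avgn n f v = avgn n g v)"
      by moura
    then have R: "\<And>v. finite (R v)"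
      "\<And>v f g. (\<And>u. u \<in> R v \<Longrightarrow> f u = g u) \<Longrightarrow> avgn n f v = avgn n g v"
      by blast+
    show ?case
    proof (intro exI[of _ "\<Union>w\<in>nb v. R w"] conjI allI impI)
      fix f g :: "'v \<Rightarrow> real" assume fg: "\<forall>u\<in>\<Union>w\<in>nb v. R w. f u = g u"
      show "avgn (Suc n) f v = avgn (Suc n) g v"
        unfolding avgn_Suc avg_def
      proof (rule sum.cong[OF refl])
        fix w assume "w \<in> nb v"
        then have "\<And>u. u \<in> R w \<Longrightarrow> f u = g u" using fg by blast
        then have "avgn n f w = avgn n g w" by (rule R(2))
        then show "tp v w * avgn n f w = tp v w * avgn n g w" by simp
      qed
    qed (use R(1) in auto)
  qed
  then have "\<exists>R. finite R \<and> (\<forall>f g. (\<forall>u\<in>R. f u = g u) \<longrightarrow> avgn n f v = avgn n g v)" for n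
    by blast
  then obtain R where R': "\<And>n. finite (R n) \<and> (\<forall>f g. (\<forall>u\<in>R n. f u = g u) \<longrightarrow> avgn n f v = avgn n g v)"
    by moura
  then have R: "\<And>n. finite (R n)"
    "\<And>n f g. (\<And>u. u \<in> R n \<Longrightarrow> f u = g u) \<Longrightarrow> avgn n f v = avgn n g v"
    by blast+
  show ?thesis
  proof (intro exI[of _ "\<Union>n<M. R n"] conjI allI impI)
    fix n and f g :: "'v \<Rightarrow> real" assume "n < M" "\<forall>u\<in>\<Union>n<M. R n. f u = g u"
    then have "\<And>u. u \<in> R n \<Longrightarrow> f u = g u" by blast
    then show "avgn n f v = avgn n g v" by (rule R(2))
  qed (use R(1) in auto)
qed

text \<open>Expansion in the Green function truncated at \<open>M\<close>: the last factor is the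
  expected number of visits to \<open>u\<close>.\<close>

lemma sum_avgn_expand:
  "\<exists>R. finite R \<and> (\<forall>f. (\<Sum>n<M. avgn n f v) = (\<Sum>u\<in>R. f u * (\<Sum>n<M. avgn n (ind u) v)))"
proof -
  obtain R where R': "finite R \<and> (\<forall>n<M. \<forall>f g. (\<forall>u\<in>R. f u = g u) \<longrightarrow> avgn n f v = avgn n g v)"
    using avgn_local[of M v] ..
  then have R: "finite R" "\<And>n f g. n < M \<Longrightarrow> (\<And>u. u \<in> R \<Longrightarrow> f u = g u) \<Longrightarrow> avgn n f v = avgn n g v"
    by simp_all
  have "(\<Sum>n<M. avgn n f v) = (\<Sum>u\<in>R. f u * (\<Sum>n<M. avgn n (ind u) v))" for f
  proof -
    have "avgn n f v = (\<Sum>u\<in>R. f u * avgn n (ind u) v)" if "n < M" for n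
    proof -
      have "avgn n f v = avgn n (\<lambda>x. \<Sum>u\<in>R. f u * ind u x) v"
        using R(1) that
        by (intro R(2)) (auto simp: if_distrib[of "\<lambda>t. _ * t"] sum.delta cong: if_cong)
      then show ?thesis by (simp only: avgn_sum avgn_cmult)
    qed
    then have "(\<Sum>n<M. avgn n f v) = (\<Sum>n<M. \<Sum>u\<in>R. f u * avgn n (ind u) v)" by simp
    also have "\<dots> = (\<Sum>u\<in>R. \<Sum>n<M. f u * avgn n (ind u) v)" by (rule sum.swap)
    finally show ?thesis by (simp add: sum_distrib_left)
  qed
  with R(1) show ?thesis by blast
qed

text \<open>For a self-loop this is \<open>u\<close> itself, so a loop counts once in
  \<open>cond_sum\<close>, as it does in \<open>cond_vert\<close>.\<close>

definition other :: "'v \<Rightarrow> 'e \<Rightarrow> 'v" where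
  "other u e = (if fst (ends e) = u then snd (ends e) else fst (ends e))"

lemma cond_sum: "cond_vert ends c u * avg f u = (\<Sum>e\<in>incident ends u. c e * f (other u e))"
proof -
  have eq: "{e \<in> incident ends u. other u e = w} = {e. ends e = (u, w) \<or> ends e = (w, u)}" for w
    by (auto simp: incident_def other_def prod_eq_iff)
  have "(\<Sum>w\<in>nb u. \<Sum>e | e \<in> incident ends u \<and> other u e = w. c e * f (other u e)) =
      (\<Sum>w\<in>nb u. \<Sum>e | e \<in> incident ends u \<and> other u e = w. c e * f w)"
    by (intro sum.cong refl) simp
  then have "(\<Sum>w\<in>nb u. \<Sum>e | e \<in> incident ends u \<and> other u e = w. c e * f (other u e)) =
      (\<Sum>w\<in>nb u. \<Sum>e | ends e = (u, w) \<or> ends e = (w, u). c e * f w)"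
    unfolding eq .
  moreover have "other u ` incident ends u \<subseteq> nb u"
    unfolding incident_def other_def nbrs_def adj_def by (auto simp: prod_eq_iff)
  ultimately have "(\<Sum>e\<in>incident ends u. c e * f (other u e)) = (\<Sum>w\<in>nb u. cond_pair ends c u w * f w)"
    using sum.group[of "incident ends u" "nb u" "other u" "\<lambda>e. c e * f (other u e)"] finite_incident
    by (simp add: cond_pair_def sum_distrib_right)
  then show ?thesis
    by (simp add: avg_def sum_distrib_left mult.assoc[symmetric] cond_vert_p)
qed

text \<open>First-step expansion of \<open>(d u + D)^2\<close>; the mixed term is controlled by
  \<open>d u + avg (s M) u \<le> 1\<close>, the bound on the expected total from every start. The
  induction needs the stronger bound \<open>2 * s M u\<close>.\<close>

lemma second_moment:
  assumes d0: "\<And>u. 0 \<le> d u" and S: "\<And>M u. (\<Sum>n<M. avgn n d u) \<le> 1"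
  shows "(\<integral>\<omega>. (\<Sum>n<M. d (\<omega> n))\<^sup>2 \<partial>P v) \<le> 2"
proof -
  have d1: "d u \<le> 1" for u using S[of u 1] by simp
  define D where "D M \<omega> = (\<Sum>n<M. d (\<omega> n))" for M and \<omega> :: "nat \<Rightarrow> 'v"
  have D [measurable]: "D M \<in> borel_measurable walk_space" for M
    unfolding D_def by measurable
  have D0: "0 \<le> D M \<omega>" and DM: "D M \<omega> \<le> M" for M \<omega>
    using sum_bounded_above[of "{..<M}" "\<lambda>n. d (\<omega> n)" 1] d0 d1 by (auto simp: D_def intro!: sum_nonneg)
  have DM2: "\<bar>(D M \<omega>)\<^sup>2\<bar> \<le> (real M)\<^sup>2" for M \<omega> using D0 DM by (simp add: power_mono)
  define s where "s M u = (\<Sum>n<M. avgn n d u)" for M u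
  have ED: "(\<integral>\<omega>. D M \<omega> \<partial>P u) = s M u" for M u
    unfolding D_def s_def using d0 d1
    by (subst Bochner_Integration.integral_sum)
      (auto intro!: integrable_bdd[where C = 1] sum.cong expectation_coord[where C = 1])
  have s_Suc: "s (Suc M) u = d u + avg (s M) u" for M u
  proof -
    have "s (Suc M) u = d u + (\<Sum>n<M. avg (avgn n d) u)"
      unfolding s_def by (subst sum.lessThan_Suc_shift) (simp add: avgn_Suc)
    also have "(\<Sum>n<M. avg (avgn n d) u) = avg (s M) u"
      unfolding s_def[abs_def] avg_def sum_distrib_left by (rule sum.swap)
    finally show ?thesis .
  qed
  have s1: "s M u \<le> 1" for M u using S by (simp add: s_def)
  have "(\<integral>\<omega>. (D M \<omega>)\<^sup>2 \<partial>P u) \<le> 2 * s M u" for u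
  proof (induction M arbitrary: u)
    case 0
    show ?case by (simp add: D_def s_def)
  next
    case (Suc M)
    have DS: "D (Suc M) (case_nat u \<omega>) = d u + D M \<omega>" for \<omega>
      unfolding D_def by (subst sum.lessThan_Suc_shift) simp
    have i: "integrable (P w) (D M)" "integrable (P w) (\<lambda>\<omega>. (D M \<omega>)\<^sup>2)" for w
    proof -
      show "integrable (P w) (D M)"
        by (rule integrable_bdd[where C = M]) (use D0 DM in auto)
      show "integrable (P w) (\<lambda>\<omega>. (D M \<omega>)\<^sup>2)"
        by (rule integrable_bdd[where C = "(real M)\<^sup>2"]) (use DM2 in auto)
    qed
    have E: "(\<integral>\<omega>. (d u + D M \<omega>)\<^sup>2 \<partial>P w) = (d u)\<^sup>2 + 2 * d u * s M w + (\<integral>\<omega>. (D M \<omega>)\<^sup>2 \<partial>P w)" for w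
    proof -
      have "(\<integral>\<omega>. (d u + D M \<omega>)\<^sup>2 \<partial>P w) = (\<integral>\<omega>. (d u)\<^sup>2 + (2 * d u) * D M \<omega> + (D M \<omega>)\<^sup>2 \<partial>P w)"
        by (intro Bochner_Integration.integral_cong) (auto simp: power2_sum)
      also have "\<dots> = (d u)\<^sup>2 + 2 * d u * s M w + (\<integral>\<omega>. (D M \<omega>)\<^sup>2 \<partial>P w)"
        using i by (simp add: ED)
      finally show ?thesis .
    qed
    have "(\<integral>\<omega>. (D (Suc M) \<omega>)\<^sup>2 \<partial>P u) = avg (\<lambda>w. \<integral>\<omega>. (D (Suc M) (case_nat u \<omega>))\<^sup>2 \<partial>P w) u"
      by (rule first_step[where C = "(real (Suc M))\<^sup>2"]) (measurable, rule DM2)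
    also have "\<dots> = avg (\<lambda>w. (d u)\<^sup>2 + 2 * d u * s M w + (\<integral>\<omega>. (D M \<omega>)\<^sup>2 \<partial>P w)) u"
      by (simp only: DS E)
    also have "\<dots> \<le> avg (\<lambda>w. (d u)\<^sup>2 + 2 * d u * s M w + 2 * s M w) u"
      using Suc by (intro avg_mono) simp
    also have "\<dots> = (d u)\<^sup>2 + 2 * d u * avg (s M) u + 2 * avg (s M) u"
      by (simp only: avg_add avg_cmult avg_const)
    also have "\<dots> \<le> 2 * (d u + avg (s M) u)"
    proof -
      have "avg (s M) u \<le> 1" using avg_mono[of u "s M" "\<lambda>_. 1"] s1 by simp
      moreover have "d u + avg (s M) u \<le> 1" using s1[of "Suc M" u] by (simp add: s_Suc)
      ultimately have "d u * (d u + 2 * avg (s M) u) \<le> d u * 2"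
        using d0 by (intro mult_left_mono) auto
      then show ?thesis by (simp add: power2_eq_square algebra_simps)
    qed
    finally show ?case by (simp add: s_Suc)
  qed
  also have "2 * s M v \<le> 2" using s1[of M v] by simp
  finally show ?thesis by (simp add: D_def)
qed

text \<open>Completing the square gives \<open>D \<le> \<tau> * D^2 + 1 / (4 * \<tau>)\<close>
  pointwise, which does the work of Cauchy-Schwarz. It is used to show that a small event carries
  little of the compensator.\<close>

lemma expectation_on_event:
  assumes d0: "\<And>u. 0 \<le> d u" and S: "\<And>M u. (\<Sum>n<M. avgn n d u) \<le> 1"
    and B [measurable]: "B \<in> sets walk_space" and \<tau>: "0 < \<tau>"
  shows "(\<integral>\<omega>. (\<Sum>n<M. d (\<omega> n)) * indicator B \<omega> \<partial>P v) \<le> 2 * \<tau> + measure (P v) B / (4 * \<tau>)"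
proof -
  have d1: "d u \<le> 1" for u using S[of u 1] by simp
  define D where "D \<omega> = (\<Sum>n<M. d (\<omega> n))" for \<omega> :: "nat \<Rightarrow> 'v"
  have D [measurable]: "D \<in> borel_measurable walk_space"
    unfolding D_def by measurable
  have D0: "0 \<le> D \<omega>" and DM: "D \<omega> \<le> M" for \<omega>
    using sum_bounded_above[of "{..<M}" "\<lambda>n. d (\<omega> n)" 1] d0 d1 by (auto simp: D_def intro!: sum_nonneg)
  have DM2: "\<bar>(D \<omega>)\<^sup>2\<bar> \<le> (real M)\<^sup>2" for \<omega> using D0 DM by (simp add: power_mono)
  have i: "integrable (P v) (\<lambda>\<omega>. (D \<omega>)\<^sup>2)" "integrable (P v) (\<lambda>\<omega>. D \<omega> * indicator B \<omega>)"
    "integrable (P v) (indicator B :: _ \<Rightarrow> real)"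
  proof -
    show "integrable (P v) (\<lambda>\<omega>. (D \<omega>)\<^sup>2)"
      by (rule integrable_bdd[where C = "(real M)\<^sup>2"]) (use DM2 in auto)
    show "integrable (P v) (\<lambda>\<omega>. D \<omega> * indicator B \<omega>)"
      by (rule integrable_bdd[where C = M]) (use D0 DM in \<open>auto simp: indicator_def\<close>)
    show "integrable (P v) (indicator B :: _ \<Rightarrow> real)"
      by (rule integrable_bdd[where C = 1]) (auto simp: indicator_def)
  qed
  have "(\<integral>\<omega>. D \<omega> * indicator B \<omega> \<partial>P v) \<le> (\<integral>\<omega>. \<tau> * (D \<omega>)\<^sup>2 + indicator B \<omega> / (4 * \<tau>) \<partial>P v)"
  proof (rule integral_mono)
    fix \<omega>
    have "0 \<le> \<tau> * (D \<omega> - 1 / (2 * \<tau>))\<^sup>2" using \<tau> by simp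
    also have "\<dots> = \<tau> * (D \<omega>)\<^sup>2 - D \<omega> + 1 / (4 * \<tau>)"
      using \<tau> by (simp add: power2_diff field_simps power2_eq_square)
    finally show "D \<omega> * indicator B \<omega> \<le> \<tau> * (D \<omega>)\<^sup>2 + indicator B \<omega> / (4 * \<tau>)"
      using \<tau> by (auto simp: indicator_def)
  qed (use i in auto)
  also have "\<dots> = \<tau> * (\<integral>\<omega>. (D \<omega>)\<^sup>2 \<partial>P v) + measure (P v) B / (4 * \<tau>)"
    using i by simp
  also have "\<dots> \<le> \<tau> * 2 + measure (P v) B / (4 * \<tau>)"
    using second_moment[OF d0 S, of v M] \<tau> by (simp add: D_def)
  finally show ?thesis by (simp add: D_def mult.commute)
qed

end

section \<open>The truncated height and its compensator\<close>

context transient_walk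
begin

text \<open>The truncated height, a submartingale that starts to move only near level \<open>t\<close>; its
  compensator \<open>drift t\<close> charges only vertices with an edge crossing level \<open>t\<close>.\<close>

definition ramp :: "real \<Rightarrow> 'v \<Rightarrow> real" where
  "ramp t u = max 0 (y u - t) / (1 - t)"

definition drift :: "real \<Rightarrow> 'v \<Rightarrow> real" where
  "drift t u = avg (ramp t) u - ramp t u"

lemma ramp_nonneg: "t < 1 \<Longrightarrow> 0 \<le> ramp t u"
  by (simp add: ramp_def)

lemma ramp_le_1: "t < 1 \<Longrightarrow> ramp t u \<le> 1"
  using y_le_1[of u] by (simp add: ramp_def)

text \<open>\<open>ramp t\<close> is an increasing convex function of the subharmonic
  \<open>y\<close>, so this is Jensen's inequality.\<close>

lemma drift_nonneg:
  assumes "0 \<le> t" "t < 1" shows "0 \<le> drift t u"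
proof -
  have "max 0 (y u - t) \<le> max 0 (avg y u - t)" using y_sub[of u] by simp
  moreover have "0 \<le> avg (ramp t) u" using assms by (intro avg_nonneg ramp_nonneg)
  moreover have "(1 / (1 - t)) * (avg y u - t) \<le> avg (ramp t) u"
  proof -
    have "(1 / (1 - t)) * (avg y u - t) = avg (\<lambda>w. (1 / (1 - t)) * (y w - t)) u"
      by (simp only: avg_cmult avg_diff avg_const)
    also have "\<dots> \<le> avg (ramp t) u"
      using assms by (intro avg_mono) (simp add: ramp_def divide_right_mono)
    finally show ?thesis .
  qed
  moreover have "ramp t u \<le> max 0 ((1 / (1 - t)) * (avg y u - t))"
    using y_sub[of u] assms by (auto simp: ramp_def max_def divide_right_mono)
  ultimately show ?thesis by (simp add: drift_def)
qed

lemma sum_drift: "(\<Sum>n<M. avgn n (drift t) u) = avgn M (ramp t) u - ramp t u"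
proof (induction M)
  case (Suc M)
  have "avgn M (drift t) u = avgn (Suc M) (ramp t) u - avgn M (ramp t) u"
    unfolding drift_def[abs_def] avgn_diff avgn_Suc' ..
  then show ?case using Suc by simp
qed simp

lemma sum_drift_le_1:
  assumes "0 \<le> t" "t < 1" shows "(\<Sum>n<M. avgn n (drift t) u) \<le> 1"
proof -
  have "avgn M (ramp t) u \<le> avgn M (\<lambda>_. 1) u" using assms ramp_le_1 by (intro avgn_mono)
  then show ?thesis using ramp_nonneg[of t u] assms by (simp add: sum_drift)
qed

text \<open>From a start at or below level \<open>t\<close> the ramp begins at 0, and its mean tends
  to 1 because \<open>1 - ramp t\<close> is at most a multiple of \<open>hit\<close>.\<close>

lemma sum_drift_tendsto:
  assumes "0 \<le> t" "t < 1" "y u \<le> t"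
  shows "(\<lambda>M. \<Sum>n<M. avgn n (drift t) u) \<longlonglongrightarrow> 1"
proof -
  have "1 - ramp t w \<le> (1 / (1 - t)) * hit w" for w
  proof (cases "t \<le> y w")
    case True
    then show ?thesis using assms by (simp add: ramp_def hit_def field_simps)
  next
    case False
    then have "1 - t \<le> hit w" by (simp add: hit_def)
    then show ?thesis using assms False by (simp add: ramp_def field_simps)
  qed
  then have "avgn M (\<lambda>w. 1 - ramp t w) u \<le> avgn M (\<lambda>w. (1 / (1 - t)) * hit w) u" for M
    by (rule avgn_mono)
  then have le: "1 - avgn M (ramp t) u \<le> (1 / (1 - t)) * avgn M hit u" for M
    by (simp only: avgn_diff avgn_const avgn_cmult)
  have "(\<lambda>M. 1 - (\<Sum>n<M. avgn n (drift t) u)) \<longlonglongrightarrow> 0"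
  proof (rule LIMSEQ_squeeze_0)
    show "(\<lambda>M. (1 / (1 - t)) * avgn M hit u) \<longlonglongrightarrow> 0"
      using tendsto_mult_left[OF avgn_hit_tendsto, of "1 / (1 - t)"] by simp
    show "0 \<le> 1 - (\<Sum>n<M. avgn n (drift t) u)" for M using sum_drift_le_1[OF assms(1,2), of u M] by simp
    show "1 - (\<Sum>n<M. avgn n (drift t) u) \<le> (1 / (1 - t)) * avgn M hit u" for M
      using le[of M] assms by (simp add: sum_drift ramp_def)
  qed
  from tendsto_diff[OF tendsto_const[of 1] this] show ?thesis by simp
qed

text \<open>From \<open>v\<close> the walk is at the root after \<open>j\<close> steps with
  probability \<open>\<pi>\<close>, so the expected number of visits to \<open>v\<close> is at most
  \<open>1 / \<pi>\<close> times that of visits to the root, and \<open>green_le\<close>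
  applies.\<close>

lemma green_from:
  "\<exists>K>0. \<forall>M u. cond_vert ends c u * (\<Sum>n<M. avgn n (ind v) u) \<le> K * (cond_vert ends c u * hit u)"
proof -
  obtain j where j: "0 < avgn j (ind \<rho>) v" using avgn_pos by blast
  define \<pi> where "\<pi> = avgn j (ind \<rho>) v"
  have le: "(\<Sum>n<M. avgn n (ind v) u) \<le> (1 / (\<pi> * avg y \<rho>)) * hit u" for M u
  proof -
    have "\<pi> * avgn n (ind v) u \<le> avgn (n + j) (ind \<rho>) u" for n
    proof -
      have "avgn n (\<lambda>w. \<pi> * ind v w) u \<le> avgn n (avgn j (ind \<rho>)) u"
        by (rule avgn_mono) (auto simp: \<pi>_def intro: avgn_nonneg)
      then show ?thesis by (simp only: avgn_cmult) (simp add: avgn_def funpow_add)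
    qed
    then have "\<pi> * (\<Sum>n<M. avgn n (ind v) u) \<le> (\<Sum>n<M. avgn (n + j) (ind \<rho>) u)"
      unfolding sum_distrib_left by (intro sum_mono)
    also have "\<dots> = (\<Sum>n\<in>{j..<M + j}. avgn n (ind \<rho>) u)"
      by (rule sum.reindex_bij_witness[of _ "\<lambda>n. n - j" "\<lambda>n. n + j"]) auto
    also have "\<dots> \<le> green (M + j) u"
      unfolding green_def by (intro sum_mono2) (auto intro: avgn_nonneg)
    also have "\<dots> \<le> hit u / avg y \<rho>" by (rule green_le)
    finally show ?thesis using j avg_y_root_pos by (simp add: \<pi>_def[symmetric] field_simps)
  qed
  show ?thesis
  proof (intro exI[of _ "1 / (\<pi> * avg y \<rho>)"] conjI allI)
    show "0 < 1 / (\<pi> * avg y \<rho>)" using j avg_y_root_pos by (simp add: \<pi>_def)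
    fix M u
    show "cond_vert ends c u * (\<Sum>n<M. avgn n (ind v) u) \<le> 1 / (\<pi> * avg y \<rho>) * (cond_vert ends c u * hit u)"
      using mult_left_mono[OF le[of u M] cond_vert_nonneg[of u]] by (simp add: mult_ac)
  qed
qed

text \<open>A vertex lies below level \<open>t\<close> once \<open>t\<close> is close to 1, and
  iterated averages are finite sums.\<close>

lemma drift_tendsto_0: "((\<lambda>t. avgn n (drift t) v) \<longlongrightarrow> 0) (at_left 1)" if "\<And>w. y w < 1"
proof -
  have r: "((\<lambda>t. ramp t w) \<longlongrightarrow> 0) (at_left 1)" for w
  proof (rule tendsto_eventually)
    have "eventually (\<lambda>t. t \<in> {y w<..<1}) (at_left 1)"
      using that[of w] eventually_at_left_real by blast
    then show "eventually (\<lambda>t. ramp t w = 0) (at_left 1)"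
      by eventually_elim (auto simp: ramp_def)
  qed
  have "((\<lambda>t. drift t w) \<longlongrightarrow> avg (\<lambda>_. 0) w - 0) (at_left 1)" for w
    unfolding drift_def by (intro tendsto_diff avg_tendsto r)
  then have "((\<lambda>t. drift t w) \<longlongrightarrow> 0) (at_left 1)" for w by simp
  then have "((\<lambda>t. avgn n (drift t) v) \<longlongrightarrow> avgn n (\<lambda>_. 0) v) (at_left 1)"
    by (rule avgn_tendsto)
  then show ?thesis by simp
qed

end

section \<open>Compensator mass against tile widths\<close>

context tiled_walk
begin

lemma incident_ends:
  assumes "e \<in> incident ends u"
  shows "ends e = (u, other u e) \<or> ends e = (other u e, u)"
    and "lo e = min (y u) (y (other u e))" "hi e = max (y u) (y (other u e))"
  using assms by (cases "ends e"; auto simp: incident_def other_def y_lo_def y_hi_def min.commute max.commute)+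

text \<open>\<open>cond_vert ends c u * drift t u\<close> is a sum of increments of
  \<open>ramp t\<close> over the edges at \<open>u\<close>. If \<open>u\<close> lies above
  \<open>t\<close>, first subtracting the multiple \<open>1 / (1 - t)\<close> of the increments of
  \<open>y\<close>, which add up to 0, cancels every edge that does not descend below
  \<open>t\<close>. The factor \<open>hit u\<close> absorbs the slope \<open>1 / (1 - t)\<close> of
  the ramp.\<close>

lemma drift_le_width:
  assumes t: "0 \<le> t" "t < 1"
  shows "cond_vert ends c u * hit u * drift t u \<le> (\<Sum>e | e \<in> incident ends u \<and> lo e \<le> t \<and> t < hi e. len e)"
proof -
  define I where "I = incident ends u"
  have fI: "finite I" by (simp add: I_def finite_incident)
  have key: "cond_vert ends c u * drift t u = (\<Sum>e\<in>I. c e * (ramp t (other u e) - ramp t u))"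
  proof -
    have "drift t u = avg (\<lambda>w. ramp t w - ramp t u) u" by (simp add: drift_def avg_diff)
    then show ?thesis by (simp only: cond_sum I_def)
  qed
  have "cond_vert ends c u * hit u * drift t u \<le> (\<Sum>e\<in>I. if lo e \<le> t \<and> t < hi e then len e else 0)"
  proof (cases "y u \<le> t")
    case True
    have "hit u * (c e * ramp t (other u e)) \<le> (if lo e \<le> t \<and> t < hi e then len e else 0)" if e: "e \<in> I" for e
    proof -
      let ?w = "other u e"
      note E = incident_ends[OF e[unfolded I_def]]
      show ?thesis
      proof (cases "y ?w \<le> t")
        case True
        then show ?thesis using len_nonneg by (simp add: ramp_def)
      next
        case False
        \<comment> \<open>The product is the difference of the two sides of the next
          inequality.\<close>
        have "0 \<le> (t - y u) * (1 - y ?w)" using True y_le_1[of ?w] by simp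
        then have "(1 - y u) * (y ?w - t) \<le> (1 - t) * (y ?w - y u)" by (simp add: algebra_simps)
        then have "hit u * ramp t ?w \<le> y ?w - y u"
          using t False by (simp add: hit_def ramp_def field_simps)
        from mult_left_mono[OF this less_imp_le[OF c_pos[of e]]]
        show ?thesis using E True False by (simp add: tile_len_def mult_ac)
      qed
    qed
    then have "(\<Sum>e\<in>I. hit u * (c e * ramp t (other u e))) \<le> (\<Sum>e\<in>I. if lo e \<le> t \<and> t < hi e then len e else 0)"
      by (rule sum_mono)
    moreover have "ramp t u = 0" using True by (simp add: ramp_def)
    then have "hit u * (cond_vert ends c u * drift t u) = (\<Sum>e\<in>I. hit u * (c e * ramp t (other u e)))"
      unfolding key by (simp add: sum_distrib_left)
    ultimately show ?thesis by (simp add: mult_ac)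
  next
    case False
    then have "u \<noteq> \<rho>" using t y_root by auto
    have "(\<Sum>e\<in>I. c e * (y (other u e) - y u)) = 0"
    proof -
      have "avg (\<lambda>w. y w - y u) u = 0" using y_harmonic[OF \<open>u \<noteq> \<rho>\<close>] by (simp add: avg_diff)
      then show ?thesis using cond_sum[of u "\<lambda>w. y w - y u"] by (simp add: I_def)
    qed
    then have z: "(\<Sum>e\<in>I. (1 / (1 - t)) * (c e * (y (other u e) - y u))) = 0"
      by (simp only: sum_distrib_left[symmetric])
    have "cond_vert ends c u * drift t u =
        (\<Sum>e\<in>I. c e * (ramp t (other u e) - ramp t u)) - (\<Sum>e\<in>I. (1 / (1 - t)) * (c e * (y (other u e) - y u)))"
      using key z by simp
    also have "\<dots> = (\<Sum>e\<in>I. c e * (ramp t (other u e) - ramp t u - (1 / (1 - t)) * (y (other u e) - y u)))"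
      by (simp add: sum_subtractf[symmetric] right_diff_distrib mult_ac)
    finally have key2: "cond_vert ends c u * drift t u =
      (\<Sum>e\<in>I. c e * (ramp t (other u e) - ramp t u - (1 / (1 - t)) * (y (other u e) - y u)))" .
    have "hit u * (c e * (ramp t (other u e) - ramp t u - (1 / (1 - t)) * (y (other u e) - y u))) \<le>
        (if lo e \<le> t \<and> t < hi e then len e else 0)" if e: "e \<in> I" for e
    proof -
      let ?w = "other u e"
      note E = incident_ends[OF e[unfolded I_def]]
      let ?X = "ramp t ?w - ramp t u - (1 / (1 - t)) * (y ?w - y u)"
      show ?thesis
      proof (cases "y ?w < t")
        case False
        then have "?X = ((y ?w - t) - (y u - t) - (y ?w - y u)) / (1 - t)"
        proof -
          have "ramp t ?w = (y ?w - t) / (1 - t)" "ramp t u = (y u - t) / (1 - t)"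
            using False \<open>\<not> y u \<le> t\<close> by (simp_all add: ramp_def)
          then show ?thesis by (simp only: diff_divide_distrib times_divide_eq_left mult_1)
        qed
        then have "?X = 0" by simp
        then show ?thesis using len_nonneg by (simp only:) simp
      next
        case True
        have X: "?X = (t - y ?w) / (1 - t)"
        proof -
          have "?X = (0 - (y u - t) - (y ?w - y u)) / (1 - t)"
          proof -
            have "ramp t ?w = 0 / (1 - t)" "ramp t u = (y u - t) / (1 - t)"
              using True \<open>\<not> y u \<le> t\<close> by (simp_all add: ramp_def)
            then show ?thesis by (simp only: diff_divide_distrib times_divide_eq_left mult_1)
          qed
          then show ?thesis by simp
        qed
        have "(1 - y u) * (t - y ?w) \<le> (1 - t) * (y u - y ?w)"
          using True \<open>\<not> y u \<le> t\<close> t y_le_1[of u] by (intro mult_mono) auto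
        then have "hit u * ?X \<le> y u - y ?w"
          unfolding X using t by (simp add: hit_def field_simps)
        from mult_left_mono[OF this less_imp_le[OF c_pos[of e]]]
        show ?thesis using E True \<open>\<not> y u \<le> t\<close> by (simp add: tile_len_def mult_ac)
      qed
    qed
    then have "(\<Sum>e\<in>I. hit u * (c e * (ramp t (other u e) - ramp t u - (1 / (1 - t)) * (y (other u e) - y u)))) \<le>
        (\<Sum>e\<in>I. if lo e \<le> t \<and> t < hi e then len e else 0)"
      by (rule sum_mono)
    then have "hit u * (cond_vert ends c u * drift t u) \<le> (\<Sum>e\<in>I. if lo e \<le> t \<and> t < hi e then len e else 0)"
      unfolding key2 sum_distrib_left[symmetric] .
    then show ?thesis by (simp add: mult_ac)
  qed
  also have "\<dots> = (\<Sum>e | e \<in> I \<and> lo e \<le> t \<and> t < hi e. len e)"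
    using fI by (simp add: sum.inter_filter)
  finally show ?thesis by (simp add: I_def)
qed

lemma drift_near:
  "\<exists>K>0. \<forall>z r t M. 0 < r \<longrightarrow> 8 * r \<le> \<eta> \<longrightarrow> 0 \<le> t \<longrightarrow> t < 1 \<longrightarrow>
     (\<Sum>n<M. avgn n (\<lambda>u. if near z r u then drift t u else 0) v) \<le> K * r"
proof -
  obtain K where K: "0 < K"
    "\<And>M u. cond_vert ends c u * (\<Sum>n<M. avgn n (ind v) u) \<le> K * (cond_vert ends c u * hit u)"
    using green_from[of v] by blast
  define L where "L = K / cond_vert ends c v"
  have L: "0 < L" using K cond_vert_pos by (simp add: L_def)
  \<comment> \<open>Reversibility turns visits from the fixed \<open>v\<close> to the variable
    \<open>u\<close> into visits from \<open>u\<close> to \<open>v\<close>, the case bounded by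
    \<open>green_from\<close>.\<close>
  have G: "(\<Sum>n<M. avgn n (ind u) v) \<le> L * (cond_vert ends c u * hit u)" for M u
  proof -
    have "cond_vert ends c v * (\<Sum>n<M. avgn n (ind u) v) = cond_vert ends c u * (\<Sum>n<M. avgn n (ind v) u)"
      unfolding sum_distrib_left by (intro sum.cong refl reversible)
    also have "\<dots> \<le> K * (cond_vert ends c u * hit u)" by (rule K)
    finally show ?thesis using cond_vert_pos[of v] by (simp add: L_def field_simps)
  qed
  have "(\<Sum>n<M. avgn n (\<lambda>u. if near z r u then drift t u else 0) v) \<le> 8 * L * r"
    if r: "0 < r" "8 * r \<le> \<eta>" and t: "0 \<le> t" "t < 1" for z r t M
  proof -
    obtain R where R: "finite R"
      "\<And>f. (\<Sum>n<M. avgn n f v) = (\<Sum>u\<in>R. f u * (\<Sum>n<M. avgn n (ind u) v))"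
      using sum_avgn_expand[of v M] by blast
    define R' where "R' = {u \<in> R. near z r u}"
    define X where "X = {e. lo e \<le> t \<and> t < hi e}"
    define F where "F = (\<Union>u\<in>R'. incident ends u \<inter> X)"
    have fin: "finite R'" "finite F" using R(1) finite_incident by (auto simp: R'_def F_def)
    have "(\<Sum>n<M. avgn n (\<lambda>u. if near z r u then drift t u else 0) v) =
        (\<Sum>u\<in>R. if near z r u then drift t u * (\<Sum>n<M. avgn n (ind u) v) else 0)"
      by (subst R(2)) (intro sum.cong, auto)
    also have "\<dots> = (\<Sum>u\<in>R'. drift t u * (\<Sum>n<M. avgn n (ind u) v))"
      unfolding R'_def by (rule sum.inter_filter[OF R(1), symmetric])
    also have "\<dots> \<le> (\<Sum>u\<in>R'. L * (\<Sum>e\<in>incident ends u \<inter> X. len e))"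
    proof (rule sum_mono)
      fix u
      have "drift t u * (\<Sum>n<M. avgn n (ind u) v) \<le> drift t u * (L * (cond_vert ends c u * hit u))"
        by (intro mult_left_mono G drift_nonneg t)
      also have "\<dots> = L * (cond_vert ends c u * hit u * drift t u)" by simp
      also have "\<dots> \<le> L * (\<Sum>e\<in>incident ends u \<inter> X. len e)"
        using drift_le_width[OF t, of u] L by (intro mult_left_mono) (auto simp: X_def Int_def)
      finally show "drift t u * (\<Sum>n<M. avgn n (ind u) v) \<le> L * (\<Sum>e\<in>incident ends u \<inter> X. len e)" .
    qed
    also have "\<dots> = L * (\<Sum>u\<in>R'. \<Sum>e\<in>F. if e \<in> incident ends u then len e else 0)"
    proof -
      have "(\<Sum>e\<in>incident ends u \<inter> X. len e) = (\<Sum>e\<in>F. if e \<in> incident ends u then len e else 0)" if "u \<in> R'" for u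
      proof -
        have "incident ends u \<inter> X = {e \<in> F. e \<in> incident ends u}" using that by (auto simp: F_def)
        then show ?thesis using fin by (simp add: sum.inter_filter)
      qed
      then show ?thesis by (simp add: sum_distrib_left)
    qed
    also have "\<dots> = L * (\<Sum>e\<in>F. \<Sum>u\<in>R'. if e \<in> incident ends u then len e else 0)"
      by (subst sum.swap) simp
    \<comment> \<open>An edge is counted once for each of its ends, hence at most twice.\<close>
    also have "\<dots> \<le> L * (\<Sum>e\<in>F. 2 * len e)"
    proof (intro mult_left_mono sum_mono)
      fix e
      have "(\<Sum>u\<in>R'. if e \<in> incident ends u then len e else 0) = real (card {u \<in> R'. e \<in> incident ends u}) * len e"
        using fin by (simp add: sum.inter_filter[symmetric])
      also have "\<dots> \<le> 2 * len e"
      proof (rule mult_right_mono[OF _ len_nonneg])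
        have "card {u \<in> R'. e \<in> incident ends u} \<le> card {fst (ends e), snd (ends e)}"
          by (rule card_mono) (auto simp: incident_def)
        also have "\<dots> \<le> 2" by (simp add: card_insert_if)
        finally show "real (card {u \<in> R'. e \<in> incident ends u}) \<le> 2" by simp
      qed
      finally show "(\<Sum>u\<in>R'. if e \<in> incident ends u then len e else 0) \<le> 2 * len e" .
    qed (use L in auto)
    also have "\<dots> = 2 * L * (\<Sum>e\<in>F. len e)" by (simp add: sum_distrib_left mult_ac)
    also have "\<dots> \<le> 2 * L * (4 * r)"
    proof (rule mult_left_mono)
      \<comment> \<open>The tiles of \<open>F\<close> cross level \<open>t\<close> but may start
        exactly there; a level slightly higher lies strictly inside all of them.\<close>
      obtain s where s: "t < s" "\<And>e. e \<in> F \<Longrightarrow> s < hi e"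
      proof (cases "F = {}")
        case True
        then show ?thesis using that[of "t + 1"] by auto
      next
        case False
        have "t < Min (hi ` F)" using fin False by (auto simp: F_def X_def)
        then obtain s where "t < s" "s < Min (hi ` F)" using dense by blast
        then show ?thesis using that[of s] fin False by auto
      qed
      show "(\<Sum>e\<in>F. len e) \<le> 4 * r"
      proof (rule widths_near[OF r fin(2), where s = s and z = z])
        show "\<exists>v. e \<in> incident ends v \<and> near z r v" if "e \<in> F" for e
          using that by (auto simp: F_def R'_def)
        show "lo e < s \<and> s < hi e" if "e \<in> F" for e
          using s(1) s(2)[OF that] that by (auto simp: F_def X_def)
      qed
    qed (use L in auto)
    finally show ?thesis by simp
  qed
  then show ?thesis using L by (intro exI[of _ "8 * L"]) auto
qed

end

section \<open>Points of the circle and their real lifts\<close>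

lemma norm_circ_pt [simp]: "norm (circ_pt \<eta> x) = 1"
  by (simp add: circ_pt_def)

lemma circ_pt_nonzero [simp]: "circ_pt \<eta> x \<noteq> 0"
  by (simp add: circ_pt_def)

lemma circ_pt_eqD:
  assumes "circ_pt \<eta> x = circ_pt \<eta> x'" "0 < \<eta>"
  shows "\<exists>k::int. x' = x + of_int k * \<eta>"
proof -
  have "cis (2 * pi * x' / \<eta> - 2 * pi * x / \<eta>) = 1"
    using assms(1) by (simp add: circ_pt_def cis_divide[symmetric])
  then have "cos (2 * pi * x' / \<eta> - 2 * pi * x / \<eta>) = 1"
    by (metis cis.simps(1) one_complex.simps(1))
  then obtain n :: int where "2 * pi * x' / \<eta> - 2 * pi * x / \<eta> = of_int n * 2 * pi"
    unfolding cos_one_2pi_int by blast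
  then have "2 * pi * (x' - x) = 2 * pi * (of_int n * \<eta>)" using assms(2) by (simp add: field_simps)
  then have "x' - x = of_int n * \<eta>" by (subst (asm) mult_cancel_left) simp
  then have "x' = x + of_int n * \<eta>" by simp
  then show ?thesis ..
qed

text \<open>For \<open>\<zeta>\<close> on the unit circle, its lift within half a period of
  \<open>z\<close>: dividing by \<open>circ_pt \<eta> z\<close> moves the branch cut of
  \<open>Arg\<close> to the point opposite \<open>z\<close>.\<close>

definition lift_near :: "real \<Rightarrow> real \<Rightarrow> complex \<Rightarrow> real" where
  "lift_near \<eta> z \<zeta> = z + \<eta> * Arg (\<zeta> / circ_pt \<eta> z) / (2 * pi)"

lemma circ_pt_lift:
  assumes "0 < \<eta>" "norm \<zeta> = 1"
  shows "circ_pt \<eta> (lift_near \<eta> z \<zeta>) = \<zeta>"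
proof -
  have "\<zeta> / circ_pt \<eta> z \<noteq> 0" using assms by auto
  then have "cis (Arg (\<zeta> / circ_pt \<eta> z)) = sgn (\<zeta> / circ_pt \<eta> z)" by (rule cis_Arg)
  also have "\<dots> = \<zeta> / circ_pt \<eta> z" using assms by (simp add: sgn_div_norm norm_divide)
  finally have A: "cis (Arg (\<zeta> / circ_pt \<eta> z)) = \<zeta> / circ_pt \<eta> z" .
  have "2 * pi * lift_near \<eta> z \<zeta> / \<eta> = 2 * pi * z / \<eta> + Arg (\<zeta> / circ_pt \<eta> z)"
    using assms by (simp add: lift_near_def field_simps)
  then have "circ_pt \<eta> (lift_near \<eta> z \<zeta>) = circ_pt \<eta> z * cis (Arg (\<zeta> / circ_pt \<eta> z))"
    by (simp add: circ_pt_def cis_mult)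
  then show ?thesis by (simp add: A)
qed

lemma isCont_Arg_1: "isCont Arg 1"
  by (rule continuous_at_Arg) (simp add: complex_nonpos_Reals_iff)

text \<open>After rotation by \<open>circ_pt \<eta> z\<close> only continuity of \<open>Arg\<close>
  at 1 is involved, so one \<open>\<delta>\<close> serves every \<open>z\<close>.\<close>

lemma lift_near_close:
  assumes "0 < \<eta>" "0 < r"
  shows "\<exists>\<delta>>0. \<forall>z \<zeta>. dist \<zeta> (circ_pt \<eta> z) < \<delta> \<longrightarrow> \<bar>lift_near \<eta> z \<zeta> - z\<bar> < r"
proof -
  have "0 < 2 * pi * r / \<eta>" using assms by simp
  then obtain \<delta> where \<delta>: "\<delta> > 0" "\<And>w. dist w 1 < \<delta> \<Longrightarrow> dist (Arg w) (Arg 1) < 2 * pi * r / \<eta>"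
    using isCont_Arg_1 unfolding continuous_at_eps_delta by metis
  have "\<bar>lift_near \<eta> z \<zeta> - z\<bar> < r" if "dist \<zeta> (circ_pt \<eta> z) < \<delta>" for z \<zeta>
  proof -
    have "dist (\<zeta> / circ_pt \<eta> z) 1 = norm ((\<zeta> - circ_pt \<eta> z) / circ_pt \<eta> z)"
      by (simp add: dist_norm diff_divide_distrib)
    also have "\<dots> = dist \<zeta> (circ_pt \<eta> z)" by (simp add: norm_divide dist_norm)
    finally have "dist (Arg (\<zeta> / circ_pt \<eta> z)) (Arg 1) < 2 * pi * r / \<eta>" using \<delta>(2) that by simp
    then have "\<bar>Arg (\<zeta> / circ_pt \<eta> z)\<bar> < 2 * pi * r / \<eta>" by (simp add: dist_real_def)
    then have "\<bar>\<eta> * Arg (\<zeta> / circ_pt \<eta> z)\<bar> < 2 * pi * r"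
      using assms by (simp add: abs_mult field_simps)
    then show ?thesis using assms by (simp add: lift_near_def abs_divide field_simps)
  qed
  then show ?thesis using \<delta>(1) by blast
qed

lemma circ_pt_lipschitz:
  assumes "0 < \<eta>"
  shows "dist (circ_pt \<eta> x) (circ_pt \<eta> z) \<le> 2 * pi / \<eta> * \<bar>x - z\<bar>"
proof -
  have "dist (circ_pt \<eta> x) (circ_pt \<eta> z) = norm (circ_pt \<eta> z * (cis (2 * pi * x / \<eta> - 2 * pi * z / \<eta>) - 1))"
  proof -
    have "circ_pt \<eta> x = circ_pt \<eta> z * cis (2 * pi * x / \<eta> - 2 * pi * z / \<eta>)"
      unfolding circ_pt_def cis_mult by (rule arg_cong[where f = cis]) simp
    then show ?thesis by (simp only: dist_norm right_diff_distrib mult_1_right)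
  qed
  also have "\<dots> = norm (exp (\<i> * of_real (2 * pi * x / \<eta> - 2 * pi * z / \<eta>)) - 1)"
    by (simp add: norm_mult cis_conv_exp)
  also have "\<dots> \<le> \<bar>2 * pi * x / \<eta> - 2 * pi * z / \<eta>\<bar>"
    using iexp_approx1[of "2 * pi * x / \<eta> - 2 * pi * z / \<eta>" 0] by simp
  also have "\<dots> = 2 * pi / \<eta> * \<bar>x - z\<bar>"
  proof -
    have "2 * pi * x / \<eta> - 2 * pi * z / \<eta> = 2 * pi / \<eta> * (x - z)"
      using assms by (simp add: field_simps)
    then show ?thesis using assms by (simp add: abs_mult)
  qed
  finally show ?thesis .
qed

section \<open>The landing point\<close>

locale tiled_walk_limit = tiled_walk ends c P \<rho> pos \<gamma> a
  for ends :: "'e \<Rightarrow> 'v \<times> 'v" and c :: "'e \<Rightarrow> real" and P :: "'v \<Rightarrow> (nat \<Rightarrow> 'v) measure" and \<rho> :: 'v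
    and pos :: "'v \<Rightarrow> complex" and \<gamma> :: "'e \<Rightarrow> real \<Rightarrow> complex" and a :: "'e \<Rightarrow> real" +
  fixes \<theta> :: "'v \<Rightarrow> real"
  assumes \<theta>_in: "\<And>v. \<theta> v \<in> V v"
    and conv_root: "AE \<omega> in P \<rho>. convergent (\<lambda>n. circ_pt \<eta> (\<theta> (\<omega> n))) \<and>
      (\<lambda>n. arc_length \<eta> (V (\<omega> n))) \<longlonglongrightarrow> 0"
begin

abbreviation "C v \<equiv> circ_pt \<eta> (\<theta> v)"
abbreviation "width v \<equiv> arc_length \<eta> (V v)"

text \<open>The landing point. \<open>lim\<close> makes it total; almost every walk lies in
  \<open>regular\<close>, where it is a genuine limit.\<close>

definition tl :: "(nat \<Rightarrow> 'v) \<Rightarrow> complex" where "tl \<omega> = lim (\<lambda>n. C (\<omega> n))"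

lemma tl_measurable [measurable]: "tl \<in> borel_measurable walk_space"
  unfolding tl_def by measurable

definition regular :: "(nat \<Rightarrow> 'v) set" where
  "regular = {\<omega>. (\<lambda>n. C (\<omega> n)) \<longlonglongrightarrow> tl \<omega> \<and> (\<lambda>n. width (\<omega> n)) \<longlonglongrightarrow> 0}"

lemma regular_measurable [measurable]: "regular \<in> sets walk_space"
proof -
  have "regular = {\<omega> \<in> space walk_space. Cauchy (\<lambda>n. C (\<omega> n))} \<inter>
      {\<omega> \<in> space walk_space. Cauchy (\<lambda>n. width (\<omega> n))} \<inter> {\<omega> \<in> space walk_space. lim (\<lambda>n. width (\<omega> n)) = 0}"
  proof -
    have "X \<longlonglongrightarrow> 0 \<longleftrightarrow> X \<longlonglongrightarrow> lim X \<and> lim X = 0" for X :: "nat \<Rightarrow> real" by (metis limI)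
    then show ?thesis
      unfolding regular_def tl_def Cauchy_convergent_iff convergent_LIMSEQ_iff by auto
  qed
  also have "\<dots> \<in> sets walk_space" by measurable
  finally show ?thesis .
qed

lemma regularI:
  assumes "convergent (\<lambda>n. C (\<omega> n))" "(\<lambda>n. width (\<omega> n)) \<longlonglongrightarrow> 0"
  shows "\<omega> \<in> regular"
  using assms by (simp add: regular_def tl_def convergent_LIMSEQ_iff)

lemma LIMSEQ_shift: "((\<lambda>i. f (shift n \<omega> i)) \<longlonglongrightarrow> l) \<longleftrightarrow> ((\<lambda>i. f (\<omega> i)) \<longlonglongrightarrow> l)"
  for f :: "'v \<Rightarrow> 'z :: metric_space"
  using LIMSEQ_ignore_initial_segment[of "\<lambda>i. f (\<omega> i)" l n] LIMSEQ_offset[of "\<lambda>i. f (\<omega> i)" n l]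
  by (auto simp: add.commute)

lemma regular_shift: "shift n \<omega> \<in> regular \<longleftrightarrow> \<omega> \<in> regular"
  and tl_shift: "\<omega> \<in> regular \<Longrightarrow> tl (shift n \<omega>) = tl \<omega>"
proof -
  note c = LIMSEQ_shift[of C n \<omega>] and w = LIMSEQ_shift[of width n \<omega>]
  show tl: "tl (shift n \<omega>) = tl \<omega>" if "\<omega> \<in> regular"
  proof -
    have "(\<lambda>i. C (shift n \<omega> i)) \<longlonglongrightarrow> tl \<omega>"
      using that unfolding c regular_def by blast
    then show ?thesis unfolding tl_def[of "shift n \<omega>"] by (rule limI)
  qed
  show "shift n \<omega> \<in> regular \<longleftrightarrow> \<omega> \<in> regular"
  proof
    assume r: "shift n \<omega> \<in> regular"
    have "(\<lambda>i. C (\<omega> i)) \<longlonglongrightarrow> tl (shift n \<omega>)"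
      using r unfolding c[symmetric] regular_def by blast
    moreover have "(\<lambda>i. width (\<omega> i)) \<longlonglongrightarrow> 0"
      using r unfolding w[symmetric] regular_def by blast
    ultimately show "\<omega> \<in> regular" by (intro regularI) (auto simp: convergent_def)
  next
    assume r: "\<omega> \<in> regular"
    have "(\<lambda>i. C (shift n \<omega> i)) \<longlonglongrightarrow> tl \<omega>" "(\<lambda>i. width (shift n \<omega> i)) \<longlonglongrightarrow> 0"
      using r unfolding c w regular_def by blast+
    then show "shift n \<omega> \<in> regular" by (intro regularI) (auto simp: convergent_def)
  qed
qed

lemma AE_regular: "AE \<omega> in P v. \<omega> \<in> regular"
proof (rule invariant_AE[where u = \<rho>])
  show "AE \<omega> in P \<rho>. \<omega> \<in> regular"
    using conv_root by eventually_elim (auto intro: regularI)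
qed (auto simp: regular_shift)

lemma AE_adj: "AE \<omega> in P v. \<forall>n. adj ends (\<omega> n) (\<omega> (Suc n))"
proof -
  define B where "B = {\<omega> :: nat \<Rightarrow> 'v. \<not> adj ends (\<omega> 0) (\<omega> 1)}"
  have B: "B \<in> sets walk_space"
  proof -
    have "B = (\<Union>x. {\<omega>. \<omega> 0 = x} \<inter> {\<omega>. \<not> adj ends x (\<omega> 1)})" by (auto simp: B_def)
    moreover have "{\<omega>. Q (\<omega> n)} \<in> sets (walk_space :: (nat \<Rightarrow> 'v) measure)" for Q n
      using pred_coord[of Q n] by (simp add: pred_def)
    ultimately show ?thesis
      using countable_V by (simp only:) (intro sets.countable_UN'' sets.Int)
  qed
  have "measure (P w) B = 0" for w
  proof -
    have "measure (P x) (case_nat w -` B) = 0" if "x \<in> nb w" for x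
    proof -
      have "measure (P x) (case_nat w -` B) = measure (P x) {}"
        using that B measurable_sets[OF case_nat_measurable B, of w]
        by (intro measure_start_cong) (auto simp: B_def nbrs_def)
      then show ?thesis by simp
    qed
    then show ?thesis using first_step_measure[OF B, of w] by simp
  qed
  then have "measure (P v) {\<omega>. shift n \<omega> \<in> B} = 0" for n
    using measure_shift[OF B, of v n] by simp
  moreover have "{\<omega>. shift n \<omega> \<in> B} \<in> sets (P v)" for n
    using measurable_sets[OF shift_measurable B, of n] by (simp add: vimage_def)
  ultimately have "AE \<omega> in P v. \<omega> \<notin> {\<omega>. shift n \<omega> \<in> B}" for n
    by (simp add: PS.prob_eq_0)
  then have "AE \<omega> in P v. \<forall>n. \<omega> \<notin> {\<omega>. shift n \<omega> \<in> B}" by (simp add: AE_all_countable)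
  then show ?thesis by eventually_elim (auto simp: B_def)
qed

lemma V_shift: "x \<in> V v \<Longrightarrow> x + of_int k * \<eta> \<in> V v"
  using V_arc[of v] unfolding is_arc_def by (auto intro: arc_shift)

text \<open>\<open>V v\<close> is a periodic subset of the line, so it contains every real lift of
  the angle of \<open>v\<close>, not only \<open>\<theta> v\<close>.\<close>

lemma lift_in_V: "lift_near \<eta> z (C v) \<in> V v"
proof -
  have "circ_pt \<eta> (\<theta> v) = circ_pt \<eta> (lift_near \<eta> z (C v))"
    using eta_pos by (simp add: circ_pt_lift)
  then obtain k :: int where "lift_near \<eta> z (C v) = \<theta> v + of_int k * \<eta>"
    using circ_pt_eqD[OF _ eta_pos] by blast
  then show ?thesis using V_shift[OF \<theta>_in] by metis
qed

lemma near_if_close: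
  assumes "0 < r"
  shows "\<exists>\<delta>>0. \<forall>z v. dist (C v) (circ_pt \<eta> z) < \<delta> \<longrightarrow> width v \<le> r \<longrightarrow> near z r v"
proof -
  obtain \<delta> where "\<delta> > 0" "\<And>z \<zeta>. dist \<zeta> (circ_pt \<eta> z) < \<delta> \<Longrightarrow> \<bar>lift_near \<eta> z \<zeta> - z\<bar> < r"
    using lift_near_close[OF eta_pos assms] by blast
  then show ?thesis
    unfolding near_def using lift_in_V by (intro exI[of _ \<delta>]) (meson less_imp_le)
qed

lemma norm_tl: "\<omega> \<in> regular \<Longrightarrow> norm (tl \<omega>) = 1"
proof -
  assume "\<omega> \<in> regular"
  then have "(\<lambda>n. norm (C (\<omega> n))) \<longlonglongrightarrow> norm (tl \<omega>)" by (intro tendsto_norm) (simp add: regular_def)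
  then show ?thesis by (simp add: LIMSEQ_const_iff)
qed

definition lands :: "complex \<Rightarrow> (nat \<Rightarrow> 'v) set" where
  "lands \<xi> = {\<omega> \<in> regular. tl \<omega> = \<xi>}"

lemma lands_measurable [measurable]: "lands \<xi> \<in> sets walk_space"
proof -
  have "{\<omega> \<in> space walk_space. \<omega> \<in> regular \<and> tl \<omega> = \<xi>} \<in> sets walk_space" by measurable
  then show ?thesis by (simp add: lands_def)
qed

lemma lands_shift: "shift n \<omega> \<in> lands \<xi> \<longleftrightarrow> \<omega> \<in> lands \<xi>"
  using regular_shift tl_shift by (auto simp: lands_def)

text \<open>The indicator of \<open>lands \<xi>\<close> is approximated by functions of single positions of the
  walk, so the harmonic function \<open>v \<mapsto> P\<^sub>v(lands \<xi>)\<close> comes close to 1 unless it vanishes.\<close>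

lemma lands_prob_near_1:
  assumes "0 < measure (P u) (lands \<xi>)"
  shows "\<exists>v. 7 / 8 < measure (P v) (lands \<xi>)"
proof (rule ccontr)
  assume "\<not> ?thesis"
  then have small: "measure (P v) (lands \<xi>) \<le> 7 / 8" for v by (simp add: not_less)
  define I where "I = (indicator (lands \<xi>) :: (nat \<Rightarrow> 'v) \<Rightarrow> real)"
  have I [measurable]: "I \<in> borel_measurable walk_space" unfolding I_def by measurable
  have I01: "0 \<le> I \<omega>" "I \<omega> \<le> 1" for \<omega> by (auto simp: I_def indicator_def)
  define g where "g v = measure (P v) (lands \<xi>)" for v
  have Ig: "(\<integral>\<omega>. I \<omega> \<partial>P v) = g v" for v by (simp add: I_def g_def)
  \<comment> \<open>Continuous tents around \<open>\<xi>\<close>, decreasing to the indicator of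
    \<open>{\<xi>}\<close>.\<close>
  define q where "q j \<zeta> = max 0 (1 - real j * dist \<zeta> \<xi>)" for j :: nat and \<zeta> :: complex
  have q01: "0 \<le> q j \<zeta>" "q j \<zeta> \<le> 1" for j \<zeta> by (auto simp: q_def)
  have q_cont: "continuous_on UNIV (q j)" for j
    unfolding q_def by (intro continuous_intros)
  have q_meas [measurable]: "q j \<in> borel_measurable borel" for j
    using q_cont by (rule borel_measurable_continuous_onI)
  have I_shift: "I (shift n \<omega>) = I \<omega>" for n \<omega> by (simp add: I_def indicator_def lands_shift)
  \<comment> \<open>A number \<open>b\<close> in \<open>[0, 1]\<close> has mean distance
    \<open>b + (1 - 2 * b) * g\<close> from the indicator, which is at least \<open>g / 7\<close>
    while \<open>g \<le> 7 / 8\<close>. So functions of a single position stay away from the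
    indicator, contrary to the two limits below.\<close>
  have low: "g u / 7 \<le> (\<integral>\<omega>. \<bar>q j (C (\<omega> n)) - I \<omega>\<bar> \<partial>P u)" for j n
  proof -
    have "g v / 7 \<le> (\<integral>\<omega>. \<bar>q j (C (\<omega> 0)) - I \<omega>\<bar> \<partial>P v)" for v
    proof -
      let ?b = "q j (C v)"
      have "(\<integral>\<omega>. \<bar>q j (C (\<omega> 0)) - I \<omega>\<bar> \<partial>P v) = (\<integral>\<omega>. ?b + (1 - 2 * ?b) * I \<omega> \<partial>P v)"
        using AE_starts[of v] q01[of j "C v"]
        by (intro integral_cong_AE) (auto simp: measurable_P_eq I_def indicator_def elim!: eventually_mono)
      also have "\<dots> = ?b + (1 - 2 * ?b) * g v"
        using I01 by (simp add: Ig[symmetric] integrable_bdd[where C = 1])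
      also have "\<dots> \<ge> g v / 7"
      proof -
        have "0 \<le> ?b * (7 - 8 * g v)"
          using small[of v] q01(1)[of j "C v"] unfolding g_def by (intro mult_nonneg_nonneg) auto
        moreover have "0 \<le> (1 - ?b) * g v" using q01[of j "C v"] by (simp add: g_def)
        ultimately show ?thesis by (simp add: algebra_simps)
      qed
      finally show ?thesis .
    qed
    then have "avgn n (\<lambda>v. (1 / 7) * g v) u \<le> avgn n (\<lambda>v. \<integral>\<omega>. \<bar>q j (C (\<omega> 0)) - I \<omega>\<bar> \<partial>P v) u"
      by (intro avgn_mono) simp
    also have "\<dots> = (\<integral>\<omega>. \<bar>q j (C (shift n \<omega> 0)) - I (shift n \<omega>)\<bar> \<partial>P u)"
    proof (rule expectation_shift[where C = 1, symmetric])
      show "\<bar>\<bar>q j (C (\<omega> 0)) - I \<omega>\<bar>\<bar> \<le> 1" for \<omega>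
        using q01[of j "C (\<omega> 0)"] I01[of \<omega>] by auto
    qed measurable
    also have "avgn n (\<lambda>v. (1 / 7) * g v) u = (1 / 7) * g u"
    proof -
      have "avgn n g u = (\<integral>\<omega>. I (shift n \<omega>) \<partial>P u)"
        unfolding Ig[symmetric] by (rule expectation_shift[where C = 1, symmetric]) (use I01 in auto)
      then show ?thesis by (simp only: avgn_cmult I_shift Ig)
    qed
    finally show ?thesis unfolding I_shift by simp
  qed
  have "(\<lambda>n. \<integral>\<omega>. \<bar>q j (C (\<omega> n)) - I \<omega>\<bar> \<partial>P u) \<longlonglongrightarrow> (\<integral>\<omega>. \<bar>q j (tl \<omega>) - I \<omega>\<bar> \<partial>P u)" for j
  proof (rule integral_dominated_convergence[where w = "\<lambda>_. 1"])
    show "AE \<omega> in P u. (\<lambda>n. \<bar>q j (C (\<omega> n)) - I \<omega>\<bar>) \<longlonglongrightarrow> \<bar>q j (tl \<omega>) - I \<omega>\<bar>"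
      using AE_regular[of u]
    proof eventually_elim
      case (elim \<omega>)
      then have "(\<lambda>n. C (\<omega> n)) \<longlonglongrightarrow> tl \<omega>" by (simp add: regular_def)
      then have "(\<lambda>n. q j (C (\<omega> n))) \<longlonglongrightarrow> q j (tl \<omega>)"
        using q_cont[of j] by (intro isCont_tendsto_compose[of _ "q j"]) (auto simp: continuous_on_eq_continuous_at)
      then show ?case by (intro tendsto_intros)
    qed
    show "AE \<omega> in P u. norm \<bar>q j (C (\<omega> n)) - I \<omega>\<bar> \<le> 1" for n
    proof (rule AE_I2)
      fix \<omega> show "norm \<bar>q j (C (\<omega> n)) - I \<omega>\<bar> \<le> 1"
        using q01[of j "C (\<omega> n)"] I01[of \<omega>] by auto
    qed
  qed (auto simp: measurable_P_eq)
  then have "g u / 7 \<le> (\<integral>\<omega>. \<bar>q j (tl \<omega>) - I \<omega>\<bar> \<partial>P u)" for j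
    by (rule LIMSEQ_le_const) (use low in auto)
  moreover have "(\<lambda>j. \<integral>\<omega>. \<bar>q j (tl \<omega>) - I \<omega>\<bar> \<partial>P u) \<longlonglongrightarrow> (\<integral>\<omega>. 0 \<partial>P u)"
  proof (rule integral_dominated_convergence[where w = "\<lambda>_. 1"])
    show "AE \<omega> in P u. (\<lambda>j. \<bar>q j (tl \<omega>) - I \<omega>\<bar>) \<longlonglongrightarrow> 0"
      using AE_regular[of u]
    proof eventually_elim
      case (elim \<omega>)
      show ?case
      proof (cases "tl \<omega> = \<xi>")
        case True
        then show ?thesis using elim by (simp add: I_def lands_def q_def)
      next
        case False
        then obtain J :: nat where J: "1 < real J * dist (tl \<omega>) \<xi>"
          using reals_Archimedean3[of "dist (tl \<omega>) \<xi>"] by auto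
        have "\<bar>q j (tl \<omega>) - I \<omega>\<bar> = 0" if "j \<ge> J" for j
        proof -
          have "real J * dist (tl \<omega>) \<xi> \<le> real j * dist (tl \<omega>) \<xi>" using that by (intro mult_right_mono) auto
          then have "1 - real j * dist (tl \<omega>) \<xi> \<le> 0" using J by linarith
          then show ?thesis using False by (simp add: q_def I_def lands_def max_def)
        qed
        then show ?thesis by (intro tendsto_eventually) (auto simp: eventually_sequentially)
      qed
    qed
    show "AE \<omega> in P u. norm \<bar>q j (tl \<omega>) - I \<omega>\<bar> \<le> 1" for j
    proof (rule AE_I2)
      fix \<omega> show "norm \<bar>q j (tl \<omega>) - I \<omega>\<bar> \<le> 1"
        using q01[of j "tl \<omega>"] I01[of \<omega>] by auto
    qed
  qed (auto simp: measurable_P_eq)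
  ultimately have "g u / 7 \<le> (\<integral>\<omega>. 0 \<partial>P u)" by (intro LIMSEQ_le_const) auto
  then show False using assms by (simp add: g_def)
qed

text \<open>If the walk from \<open>v\<close> lands at \<open>\<xi>\<close> with high probability, most of the compensator is
  picked up at vertices near \<open>\<xi>\<close>; but its mass there is bounded by the total width of the
  tiles near \<open>\<xi>\<close>.\<close>

theorem no_atom: "measure (P u) (lands \<xi>) = 0"
proof (rule ccontr)
  assume "\<not> ?thesis"
  then have "0 < measure (P u) (lands \<xi>)" by (simp add: zero_less_measure_iff)
  then obtain v where v: "7 / 8 < measure (P v) (lands \<xi>)" using lands_prob_near_1 by blast
  define A where "A = lands \<xi>"
  have A [measurable]: "A \<in> sets walk_space" by (simp add: A_def)
  have "A \<noteq> {}" using v by (auto simp: A_def)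
  then have "norm \<xi> = 1" using norm_tl by (auto simp: A_def lands_def)
  define z where "z = lift_near \<eta> 0 \<xi>"
  have z: "circ_pt \<eta> z = \<xi>" using circ_pt_lift[OF eta_pos \<open>norm \<xi> = 1\<close>] by (simp add: z_def)
  obtain K where K: "0 < K" "\<And>z r t M. 0 < r \<Longrightarrow> 8 * r \<le> \<eta> \<Longrightarrow> 0 \<le> t \<Longrightarrow> t < 1 \<Longrightarrow>
     (\<Sum>n<M. avgn n (\<lambda>u. if near z r u then drift t u else 0) v) \<le> K * r"
    using drift_near[of v] by blast
  \<comment> \<open>Constants are chosen in the order \<open>r\<close>, \<open>N\<close>,
    \<open>t\<close>, \<open>M\<close>. Vertices near \<open>\<xi>\<close> will contribute at most
    \<open>K * r \<le> 1 / 16\<close>, the first \<open>N\<close> steps less than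
    \<open>1 / 16\<close>, and walks that land at \<open>\<xi>\<close> but are not near it at some
    time from \<open>N\<close> on at most \<open>3 / 32\<close>; the mass on \<open>A\<close>
    exceeds \<open>3 / 8\<close>.\<close>
  define r where "r = min (\<eta> / 8) (1 / (16 * K))"
  have r: "0 < r" "8 * r \<le> \<eta>" "K * r \<le> 1 / 16"
    using eta_pos K by (auto simp: r_def min_def field_simps)
  obtain \<delta> where \<delta>: "\<delta> > 0" "\<And>z v. dist (C v) (circ_pt \<eta> z) < \<delta> \<Longrightarrow> width v \<le> r \<Longrightarrow> near z r v"
    using near_if_close[OF r(1)] by blast
  define B where "B N = {\<omega> \<in> A. \<exists>n. N \<le> n \<and> \<not> near z r (\<omega> n)}" for N
  have B [measurable]: "B N \<in> sets walk_space" for N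
  proof -
    have "B N = A \<inter> {\<omega>. \<exists>n. N \<le> n \<and> \<not> near z r (\<omega> n)}" by (auto simp: B_def)
    then show ?thesis
      using ex_coord_measurable[of "\<lambda>n w. N \<le> n \<and> \<not> near z r w"] by simp
  qed
  have "(\<lambda>N. measure (P v) (B N)) \<longlonglongrightarrow> measure (P v) (\<Inter>N. B N)"
    using B by (intro PS.finite_Lim_measure_decseq) (auto simp: B_def decseq_def intro: order_trans)
  moreover have "(\<Inter>N. B N) = {}"
  proof (rule ccontr)
    assume "(\<Inter>N. B N) \<noteq> {}"
    then obtain \<omega> where \<omega>: "\<And>N. \<omega> \<in> B N" by blast
    then have "\<omega> \<in> lands \<xi>" by (auto simp: B_def A_def)
    then have lims: "(\<lambda>n. C (\<omega> n)) \<longlonglongrightarrow> \<xi>" "(\<lambda>n. width (\<omega> n)) \<longlonglongrightarrow> 0"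
      by (auto simp: lands_def regular_def)
    have "eventually (\<lambda>n. dist (C (\<omega> n)) \<xi> < \<delta>) sequentially" using lims(1) \<delta>(1) by (rule tendstoD)
    moreover have "eventually (\<lambda>n. width (\<omega> n) < r) sequentially" using lims(2) r(1) by (rule order_tendstoD)
    ultimately have "eventually (\<lambda>n. near z r (\<omega> n)) sequentially"
      by eventually_elim (use \<delta>(2) z in auto)
    then obtain N where "\<And>n. n \<ge> N \<Longrightarrow> near z r (\<omega> n)" by (auto simp: eventually_sequentially)
    then show False using \<omega>[of N] by (auto simp: B_def)
  qed
  ultimately have "(\<lambda>N. measure (P v) (B N)) \<longlonglongrightarrow> 0" by simp
  then have "eventually (\<lambda>N. measure (P v) (B N) < 1 / 256) sequentially"
    by (rule order_tendstoD) simp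
  then obtain N where N: "measure (P v) (B N) < 1 / 256" by (auto simp: eventually_sequentially)
  have "((\<lambda>t. \<Sum>n<N. avgn n (drift t) v) \<longlongrightarrow> (\<Sum>n<N. 0)) (at_left 1)"
    by (intro tendsto_sum drift_tendsto_0 y_less_1)
  then have "eventually (\<lambda>t. (\<Sum>n<N. avgn n (drift t) v) < 1 / 16) (at_left 1)"
    by (rule order_tendstoD) simp
  moreover have "eventually (\<lambda>t. t \<in> {max 0 (y v)<..<1}) (at_left 1)"
    by (rule eventually_at_left_real) (simp add: y_less_1)
  ultimately have "eventually (\<lambda>t. (\<Sum>n<N. avgn n (drift t) v) < 1 / 16 \<and> t \<in> {max 0 (y v)<..<1}) (at_left 1)"
    by (rule eventually_conj)
  then obtain t where t: "(\<Sum>n<N. avgn n (drift t) v) < 1 / 16" "0 < t" "y v < t" "t < 1"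
    using eventually_happens'[of "at_left (1 :: real)"] by force
  have t01: "0 \<le> t" "t < 1" using t by auto
  have "eventually (\<lambda>M. 7 / 8 < (\<Sum>n<M. avgn n (drift t) v)) sequentially"
    using sum_drift_tendsto[OF t01, of v] t by (intro order_tendstoD) auto
  then obtain M where M: "7 / 8 < (\<Sum>n<M. avgn n (drift t) v)" by (auto simp: eventually_sequentially)
  define d where "d = drift t"
  have d0: "0 \<le> d w" for w unfolding d_def by (rule drift_nonneg[OF t01])
  have S: "(\<Sum>n<M. avgn n d w) \<le> 1" for M w unfolding d_def by (rule sum_drift_le_1[OF t01])
  have d1: "d w \<le> 1" for w using S[of w 1] by simp
  define d' where "d' w = (if near z r w then d w else 0)" for w
  have d'01: "0 \<le> d' w" "d' w \<le> 1" for w using d0 d1 by (auto simp: d'_def)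
  define D where "D M \<omega> = (\<Sum>n<M. d (\<omega> n))" for M and \<omega> :: "nat \<Rightarrow> 'v"
  have D [measurable]: "D M \<in> borel_measurable walk_space" for M unfolding D_def by measurable
  have D0: "0 \<le> D M \<omega>" and DM: "D M \<omega> \<le> M" for M \<omega>
    using sum_bounded_above[of "{..<M}" "\<lambda>n. d (\<omega> n)" 1] d0 d1 by (auto simp: D_def intro!: sum_nonneg)
  define D' where "D' \<omega> = (\<Sum>n<M. d' (\<omega> n))" for \<omega> :: "nat \<Rightarrow> 'v"
  have D' [measurable]: "D' \<in> borel_measurable walk_space" unfolding D'_def by measurable
  have D'0: "0 \<le> D' \<omega>" and D'M: "D' \<omega> \<le> M" for \<omega>
    using sum_bounded_above[of "{..<M}" "\<lambda>n. d' (\<omega> n)" 1] d'01 by (auto simp: D'_def intro!: sum_nonneg)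
  have Esum: "(\<integral>\<omega>. (\<Sum>n<M. f (\<omega> n)) \<partial>P v) = (\<Sum>n<M. avgn n f v)"
    if "\<And>w. 0 \<le> f w" "\<And>w. f w \<le> 1" for f :: "'v \<Rightarrow> real" and M
    using that by (subst Bochner_Integration.integral_sum)
      (auto intro!: integrable_bdd[where C = 1] sum.cong expectation_coord[where C = 1])
  have int: "integrable (P v) (D L)" "integrable (P v) D'"
    "integrable (P v) (\<lambda>\<omega>. D L \<omega> * indicator X \<omega>)" if "X \<in> sets walk_space" for L X
  proof -
    note [measurable] = that
    show "integrable (P v) (D L)" by (rule integrable_bdd[where C = L]) (use D0 DM in auto)
    show "integrable (P v) D'" by (rule integrable_bdd[where C = M]) (use D'0 D'M in auto)
    show "integrable (P v) (\<lambda>\<omega>. D L \<omega> * indicator X \<omega>)"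
      by (rule integrable_bdd[where C = L]) (use D0 DM in \<open>auto simp: indicator_def\<close>)
  qed
  have Ac [measurable]: "UNIV - A \<in> sets walk_space"
    using sets.compl_sets[OF A] by simp
  \<comment> \<open>The total exceeds \<open>7 / 8\<close>, and the complement of \<open>A\<close>,
    of probability below \<open>1 / 8\<close>, carries at most \<open>1 / 2\<close> of it (take
    \<open>\<tau> = 1 / 8\<close>).\<close>
  have lower: "3 / 8 < (\<integral>\<omega>. D M \<omega> * indicator A \<omega> \<partial>P v)"
  proof -
    have "measure (P v) (UNIV - A) < 1 / 8"
      using PS.prob_compl[of A v] v by (simp add: A_def)
    moreover have "(\<integral>\<omega>. D M \<omega> * indicator (UNIV - A) \<omega> \<partial>P v) \<le> 2 * (1 / 8) + measure (P v) (UNIV - A) / (4 * (1 / 8))"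
      unfolding D_def by (rule expectation_on_event[OF d0 S]) auto
    moreover have "(\<integral>\<omega>. D M \<omega> \<partial>P v) = (\<integral>\<omega>. D M \<omega> * indicator A \<omega> + D M \<omega> * indicator (UNIV - A) \<omega> \<partial>P v)"
      by (intro Bochner_Integration.integral_cong) (auto simp: indicator_def)
    then have "(\<integral>\<omega>. D M \<omega> \<partial>P v) = (\<integral>\<omega>. D M \<omega> * indicator A \<omega> \<partial>P v) + (\<integral>\<omega>. D M \<omega> * indicator (UNIV - A) \<omega> \<partial>P v)"
      using int(3) by simp
    moreover have "7 / 8 < (\<integral>\<omega>. D M \<omega> \<partial>P v)"
      using M Esum[of d M, OF d0 d1] by (simp add: D_def d_def)
    ultimately show ?thesis by simp
  qed
  have "(\<integral>\<omega>. D M \<omega> * indicator A \<omega> \<partial>P v) \<le> (\<integral>\<omega>. D N \<omega> + (D M \<omega> * indicator (B N) \<omega> + D' \<omega>) \<partial>P v)"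
  proof (rule integral_mono)
    fix \<omega>
    show "D M \<omega> * indicator A \<omega> \<le> D N \<omega> + (D M \<omega> * indicator (B N) \<omega> + D' \<omega>)"
    proof (cases "\<omega> \<in> A \<and> \<omega> \<notin> B N")
      case True
      then have nr: "near z r (\<omega> n)" if "n \<ge> N" for n using that by (auto simp: B_def)
      have "D M \<omega> \<le> (\<Sum>n<M. (if n < N then d (\<omega> n) else 0) + d' (\<omega> n))"
        unfolding D_def using nr d0 d'01 by (intro sum_mono) (auto simp: d'_def not_less)
      also have "\<dots> = (\<Sum>n | n \<in> {..<M} \<and> n < N. d (\<omega> n)) + D' \<omega>"
        by (simp only: sum.distrib D'_def sum.inter_filter finite_lessThan)
      also have "(\<Sum>n | n \<in> {..<M} \<and> n < N. d (\<omega> n)) \<le> D N \<omega>"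
        unfolding D_def by (rule sum_mono2) (auto simp: d0)
      finally show ?thesis using True by (simp add: indicator_def)
    next
      case False
      then show ?thesis using D0 D'0 by (auto simp: indicator_def)
    qed
  qed (use int(1,2)[OF A] int(3)[OF A] int(3)[OF B] in auto)
  also have "\<dots> = (\<integral>\<omega>. D N \<omega> \<partial>P v) + ((\<integral>\<omega>. D M \<omega> * indicator (B N) \<omega> \<partial>P v) + (\<integral>\<omega>. D' \<omega> \<partial>P v))"
    using int(1)[OF A, of N] int(2)[OF A] int(3)[OF B, of M N] by simp
  also have "(\<integral>\<omega>. D N \<omega> \<partial>P v) < 1 / 16"
    using t(1) Esum[of d N, OF d0 d1] by (simp add: D_def d_def)
  also have "(\<integral>\<omega>. D M \<omega> * indicator (B N) \<omega> \<partial>P v) \<le> 2 * (1 / 32) + measure (P v) (B N) / (4 * (1 / 32))"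
    unfolding D_def by (rule expectation_on_event[OF d0 S]) auto
  also have "(\<integral>\<omega>. D' \<omega> \<partial>P v) \<le> 1 / 16"
  proof -
    have "(\<Sum>n<M. avgn n d' v) \<le> K * r"
      using K(2)[OF r(1,2) t01, of z M] unfolding d'_def[abs_def] d_def .
    then show ?thesis using Esum[of d' M, OF d'01] r(3) by (simp add: D'_def)
  qed
  finally show False using lower N by simp
qed

end

subsection \<open>Crossing paths share a vertex\<close>

text \<open>The height is reflected, to match the orientation of \<open>fashoda_interlace\<close>.\<close>

definition pt :: "real \<Rightarrow> real \<Rightarrow> real ^ 2" where
  "pt x s = (\<chi> i. if i = 1 then x else - s)"

lemma pt_nth [simp]: "pt x s $ 1 = x" "pt x s $ 2 = - s"
  by (auto simp: pt_def)

lemma pt_eq [simp]: "pt x s = pt x' s' \<longleftrightarrow> x = x' \<and> s = s'"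
  by (metis minus_equation_iff pt_nth)

lemma continuous_pt:
  assumes "continuous_on A f" "continuous_on A g"
  shows "continuous_on A (\<lambda>u. pt (f u) (g u))"
  unfolding pt_def
proof (rule continuous_on_vec_lambda)
  fix i :: 2
  show "continuous_on A (\<lambda>x. if i = 1 then f x else - g x)"
    by (cases "i = 1") (auto intro!: continuous_intros assms)
qed

section \<open>Segments in the reflected strip\<close>

definition hseg :: "real \<Rightarrow> real \<Rightarrow> real \<Rightarrow> (real ^ 2) set" where
  "hseg s x x' = (\<lambda>u. pt u s) ` closed_segment x x'"

definition vseg :: "real \<Rightarrow> real \<Rightarrow> real \<Rightarrow> (real ^ 2) set" where
  "vseg x s s' = (\<lambda>u. pt x u) ` closed_segment s s'"

lemma path_connected_hseg: "path_connected (hseg s x x')"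
  and path_connected_vseg: "path_connected (vseg x s s')"
  unfolding hseg_def vseg_def
  by (rule path_connected_continuous_image; intro continuous_pt continuous_intros convex_imp_path_connected convex_closed_segment)+

lemma hseg_ends: "pt x s \<in> hseg s x x'" "pt x' s \<in> hseg s x x'"
  and vseg_ends: "pt x s \<in> vseg x s s'" "pt x s' \<in> vseg x s s'"
  by (auto simp: hseg_def vseg_def)

lemma path_connected_chain:
  assumes "path_connected A" "path_connected B" "x \<in> A" "x \<in> B"
  shows "path_connected (A \<union> B)"
  using assms by (intro path_connected_Un) auto

context tiled_walk
begin

section \<open>Vertex arcs inside a window\<close>

definition window :: "real \<Rightarrow> real set" where "window z = {z - \<eta> / 2..z + \<eta> / 2}"

definition lf :: "real \<Rightarrow> 'v \<Rightarrow> real" where "lf z v = Inf (V v \<inter> window z)"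
definition rt :: "real \<Rightarrow> 'v \<Rightarrow> real" where "rt z v = Sup (V v \<inter> window z)"
definition mid :: "real \<Rightarrow> 'v \<Rightarrow> real" where "mid z v = (lf z v + rt z v) / 2"

lemma near_interval:
  assumes r: "0 < r" "8 * r \<le> \<eta>" and v: "near z r v"
  shows "z - 2 * r \<le> lf z v" "lf z v \<le> rt z v" "rt z v \<le> z + 2 * r" "rt z v \<le> lf z v + arc_length \<eta> (V v)"
    "V v \<inter> window z = {lf z v..rt z v}"
proof -
  obtain l h where lh: "z - 2 * r \<le> l" "l \<le> h" "h \<le> z + 2 * r" "h \<le> l + arc_length \<eta> (V v)"
    "V v \<inter> window z = {l..h}"
    using near_window[OF r v] unfolding window_def .
  then have "lf z v = l" "rt z v = h" by (simp_all add: lf_def rt_def)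
  then show "z - 2 * r \<le> lf z v" "lf z v \<le> rt z v" "rt z v \<le> z + 2 * r" "rt z v \<le> lf z v + arc_length \<eta> (V v)"
    "V v \<inter> window z = {lf z v..rt z v}" using lh by auto
qed

lemma interval_sub_V:
  assumes "0 < r" "8 * r \<le> \<eta>" "near z r v"
  shows "{lf z v..rt z v} \<subseteq> V v" "{lf z v<..<rt z v} \<subseteq> V v" "{lf z v..rt z v} \<subseteq> window z"
proof -
  show s: "{lf z v..rt z v} \<subseteq> V v" "{lf z v..rt z v} \<subseteq> window z"
    using near_interval(5)[OF assms] by blast+
  have "{lf z v<..<rt z v} \<subseteq> {lf z v..rt z v}" by auto
  then show "{lf z v<..<rt z v} \<subseteq> V v" using s by blast
qed

lemma fat_iff:
  assumes r: "0 < r" "8 * r \<le> \<eta>" and v: "near z r v"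
  shows "fat v \<longleftrightarrow> lf z v < rt z v"
proof
  assume "lf z v < rt z v"
  then show "fat v" using interval_sub_V(2)[OF assms] by (auto simp: fat_def)
next
  assume f: "fat v"
  note I = near_interval[OF r v]
  have "lf z v \<in> V v" using interval_sub_V(1)[OF assms] I(2) by auto
  then obtain p q where pq: "p < q" "p \<le> lf z v" "lf z v \<le> q" "{p..q} \<subseteq> V v"
    using fat_segment[OF f] by metis
  \<comment> \<open>A second point of the arc, at most \<open>r\<close> away from its left end and
    hence still in the window.\<close>
  define x where "x = (if lf z v < q then min q (lf z v + r) else max p (lf z v - r))"
  have x: "x \<noteq> lf z v" "x \<in> {p..q}" using pq r by (auto simp: x_def)
  have "\<bar>x - lf z v\<bar> \<le> r" using pq r by (auto simp: x_def)
  then have "x \<in> window z" using I r unfolding window_def by auto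
  then have "x \<in> {lf z v..rt z v}" using x pq I(5) by blast
  then show "lf z v < rt z v" using x by auto
qed

lemma mid_inside:
  assumes "0 < r" "8 * r \<le> \<eta>" "near z r v" "fat v"
  shows "lf z v < mid z v" "mid z v < rt z v"
  using fat_iff[OF assms(1-3)] assms(4) by (auto simp: mid_def)

text \<open>The points that the curve drawn for a step between fat vertices \<open>u\<close> and \<open>w\<close> may use.\<close>

definition piece :: "'v \<Rightarrow> 'v \<Rightarrow> real \<Rightarrow> real \<Rightarrow> bool" where
  "piece u w x s \<longleftrightarrow>
    (\<exists>v\<in>{u, w}. s = y v \<and> (\<exists>p q. {p<..<q} \<subseteq> V v \<and> p < x \<and> x < q)) \<or>
    (\<exists>e p q. (ends e = (u, w) \<or> ends e = (w, u)) \<and> {p<..<q} \<subseteq> T e \<and> p < x \<and> x < q \<and> lo e < s \<and> s < hi e) \<or>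
    (u \<noteq> w \<and> y u = s \<and> y w = s \<and> x \<in> V u \<and> x \<in> V w)"

text \<open>The alternatives of \<open>piece\<close> are an interior point of an arc, an interior
  point of a tile, and a common point of two arcs of equal height, perhaps an end of both. The last
  one cannot occur for both steps, since three fat arcs of one height never meet.\<close>

lemma pieces_disjoint:
  assumes fat: "fat u" "fat w" "fat u'" "fat w'" and disj: "{u, w} \<inter> {u', w'} = {}"
    and 1: "piece u w x s" and 2: "piece u' w' x s"
  shows False
proof -
  have AX: False if "v \<in> {u, w} \<or> v \<in> {u', w'}" "s = y v" "{p<..<q} \<subseteq> V v" "p < x" "x < q"
    "v' \<in> {u, w} \<or> v' \<in> {u', w'}" "s = y v'" "x \<in> V v'" "v \<noteq> v'" for v v' p q
    using vert_interior_avoids_vert[of v v' p q x] that fat by auto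
  have BX: False if "{p<..<q} \<subseteq> T e" "p < x" "x < q" "lo e < s" "s < hi e"
    "v' \<in> {u, w} \<or> v' \<in> {u', w'}" "s = y v'" "x \<in> V v'" for v' e p q
    using tile_interior_avoids_vert[of e v' p q x] that fat by auto
  have BB: False if "{p<..<q} \<subseteq> T e" "p < x" "x < q" "lo e < s" "s < hi e"
    "{p'<..<q'} \<subseteq> T e'" "p' < x" "x < q'" "lo e' < s" "s < hi e'" "e \<noteq> e'" for e e' p q p' q'
    using tile_interiors_disjoint[of e e' s p q x p' q'] that by auto
  have DD: False if "u \<noteq> w" "y u = s" "y w = s" "x \<in> V u" "x \<in> V w" "y u' = s" "x \<in> V u'"
    using no_three_at_point[of u w u' x] that fat disj by auto
  show False
    using 1 unfolding piece_def
  proof (elim disjE[of "\<exists>v\<in>_. _ v"] disjE[of "Ex _"] exE conjE bexE)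
    fix v p q assume v: "v \<in> {u, w}" "s = y v" "{p<..<q} \<subseteq> V v" "p < x" "x < q"
    then have xv: "x \<in> V v" by auto
    show False
      using 2 unfolding piece_def
    proof (elim disjE[of "\<exists>v\<in>_. _ v"] disjE[of "Ex _"] exE conjE bexE)
      fix v' p' q' assume "v' \<in> {u', w'}" "s = y v'" "{p'<..<q'} \<subseteq> V v'" "p' < x" "x < q'"
      then show False using AX[OF _ v(2-5), of v'] v(1) disj by auto
    next
      fix e p' q' assume "{p'<..<q'} \<subseteq> T e" "p' < x" "x < q'" "lo e < s" "s < hi e"
      then show False using BX[of p' q' e v] v xv by auto
    next
      assume "y u' = s" "x \<in> V u'"
      then show False using AX[OF _ v(2-5), of u'] v(1) disj by auto
    qed
  next
    fix e p q assume e: "{p<..<q} \<subseteq> T e" "p < x" "x < q" "lo e < s" "s < hi e"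
      and ends: "ends e = (u, w) \<or> ends e = (w, u)"
    show False
      using 2 unfolding piece_def
    proof (elim disjE[of "\<exists>v\<in>_. _ v"] disjE[of "Ex _"] exE conjE bexE)
      fix v' p' q' assume "v' \<in> {u', w'}" "s = y v'" "{p'<..<q'} \<subseteq> V v'" "p' < x" "x < q'"
      then show False using BX[OF e, of v'] by auto
    next
      fix e' p' q' assume e': "{p'<..<q'} \<subseteq> T e'" "p' < x" "x < q'" "lo e' < s" "s < hi e'"
        and "ends e' = (u', w') \<or> ends e' = (w', u')"
      then have "e \<noteq> e'" using ends disj by auto
      then show False using BB[OF e e'] by simp
    next
      assume "y u' = s" "x \<in> V u'"
      then show False using BX[OF e, of u'] by auto
    qed
  next
    assume D: "u \<noteq> w" "y u = s" "y w = s" "x \<in> V u" "x \<in> V w"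
    show False
      using 2 unfolding piece_def
    proof (elim disjE[of "\<exists>v\<in>_. _ v"] disjE[of "Ex _"] exE conjE bexE)
      fix v' p' q' assume v': "v' \<in> {u', w'}" "s = y v'" "{p'<..<q'} \<subseteq> V v'" "p' < x" "x < q'"
      then show False using AX[OF _ v'(2-5), of u] D disj by auto
    next
      fix e' p' q' assume e': "{p'<..<q'} \<subseteq> T e'" "p' < x" "x < q'" "lo e' < s" "s < hi e'"
      then show False using BX[OF e', of u] D by auto
    next
      assume "y u' = s" "x \<in> V u'"
      then show False using DD D by simp
    qed
  qed
qed

text \<open>The point lies on or under the arc of \<open>v\<close>. At a great height this forces
  \<open>v\<close> to be high as well, hence late in its walk; see
  \<open>settles_high\<close>.\<close>

definition covered :: "real \<Rightarrow> 'v \<Rightarrow> real \<Rightarrow> real \<Rightarrow> bool" where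
  "covered z v x s \<longleftrightarrow> s \<le> y v \<and> lf z v \<le> x \<and> x \<le> rt z v"

definition step_set :: "real \<Rightarrow> 'v \<Rightarrow> 'v \<Rightarrow> (real ^ 2) set" where
  "step_set z u w = {pt x s |x s. piece u w x s \<and> (covered z u x s \<or> covered z w x s) \<and> min (y u) (y w) \<le> s}"

definition base :: "real \<Rightarrow> 'v \<Rightarrow> real ^ 2" where
  "base z v = pt (mid z v) (y v)"

section \<open>Curves along walks\<close>

lemma hseg_step:
  assumes "v \<in> {u, w}" "{lf z v<..<rt z v} \<subseteq> V v" "lf z v < x" "x < rt z v" "lf z v < x'" "x' < rt z v"
  shows "hseg (y v) x x' \<subseteq> step_set z u w"
proof
  fix P assume "P \<in> hseg (y v) x x'"
  then obtain t where t: "P = pt t (y v)" "lf z v < t" "t < rt z v"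
    using assms(3-6) by (auto simp: hseg_def closed_segment_eq_real_ivl split: if_splits)
  then have "piece u w t (y v)" unfolding piece_def using assms(1,2) by blast
  then show "P \<in> step_set z u w"
    using t assms(1) by (auto simp: step_set_def covered_def)
qed

text \<open>The tile lies inside both arcs. The curve follows the arc of \<open>u\<close> to the
  middle of the tile, crosses the tile vertically, and follows the arc of \<open>w\<close>.\<close>

lemma join_by_edge:
  assumes r: "0 < r" "8 * r \<le> \<eta>" and u: "near z r u" "fat u" and w: "near z r w" "fat w"
    and e: "ends e = (u, w) \<or> ends e = (w, u)" and len: "0 < len e"
  shows "\<exists>G. path_connected G \<and> base z u \<in> G \<and> base z w \<in> G \<and> G \<subseteq> step_set z u w"
proof -
  obtain p where p: "{p..p + len e} \<subseteq> T e" "{p..p + len e} \<subseteq> {lf z u..rt z u}"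
    using tile_in_window[OF r e near_interval(3)[OF r u(1)] near_interval(5)[OF r u(1), unfolded window_def]] .
  have e': "ends e = (w, u) \<or> ends e = (u, w)" using e by blast
  have "{p..p + len e} \<subseteq> V w \<inter> window z"
    using p T_sub_V[OF e'] interval_sub_V(3)[OF r u(1)] by blast
  then have pw: "{p..p + len e} \<subseteq> {lf z w..rt z w}" using near_interval(5)[OF r w(1)] by simp
  define m where "m = p + len e / 2"
  have m: "p < m" "m < p + len e" using len by (auto simp: m_def)
  have mu: "lf z u < m" "m < rt z u" and mw: "lf z w < m" "m < rt z w"
  proof -
    have "p \<in> {p..p + len e}" "p + len e \<in> {p..p + len e}" using len by auto
    then have "lf z u \<le> p" "p + len e \<le> rt z u" "lf z w \<le> p" "p + len e \<le> rt z w"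
      using p(2) pw by (meson atLeastAtMost_iff subsetD)+
    then show "lf z u < m" "m < rt z u" "lf z w < m" "m < rt z w" using m by auto
  qed
  have lohi: "lo e = min (y u) (y w)" "hi e = max (y u) (y w)"
    using e by (auto simp: y_lo_def y_hi_def min.commute max.commute)
  define G where "G = (hseg (y u) (mid z u) m \<union> vseg m (y u) (y w)) \<union> hseg (y w) m (mid z w)"
  have "path_connected G"
    unfolding G_def
    by (intro path_connected_chain[of _ _ "pt m (y w)"] path_connected_chain[of _ _ "pt m (y u)"]
        path_connected_hseg path_connected_vseg) (auto simp: hseg_ends vseg_ends)
  moreover have "base z u \<in> G" "base z w \<in> G"
    by (auto simp: G_def base_def hseg_ends)
  moreover have "vseg m (y u) (y w) \<subseteq> step_set z u w"
  proof
    fix Q assume "Q \<in> vseg m (y u) (y w)"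
    then obtain s where s: "Q = pt m s" "min (y u) (y w) \<le> s" "s \<le> max (y u) (y w)"
      by (auto simp: vseg_def closed_segment_eq_real_ivl min_def max_def split: if_splits)
    have "piece u w m s"
    proof (cases "s = y u \<or> s = y w")
      case True
      then show ?thesis
        unfolding piece_def using mu mw interval_sub_V(2)[OF r u(1)] interval_sub_V(2)[OF r w(1)] by blast
    next
      case False
      then have "lo e < s" "s < hi e" using s lohi by auto
      moreover have "{p<..<p + len e} \<subseteq> T e" using p(1) by (auto simp: subset_iff)
      ultimately show ?thesis unfolding piece_def using e m by blast
    qed
    then show "Q \<in> step_set z u w"
      using s mu mw by (auto simp: step_set_def covered_def max_def split: if_splits)
  qed
  then have "G \<subseteq> step_set z u w"
    unfolding G_def using mu mw mid_inside[OF r u] mid_inside[OF r w]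
      hseg_step[of u u w z] hseg_step[of w u w z] interval_sub_V(2)[OF r u(1)] interval_sub_V(2)[OF r w(1)]
    by (intro Un_least) auto
  ultimately show ?thesis by blast
qed

text \<open>Only the point \<open>x\<close>, where the curve changes arcs, can be an end of an arc;
  the third alternative of \<open>piece\<close> is made for it.\<close>

lemma join_at_point:
  assumes r: "0 < r" "8 * r \<le> \<eta>" and u: "near z r u" "fat u" and w: "near z r w" "fat w"
    and y: "y u = y w" and x: "x \<in> V u" "x \<in> V w" "x \<in> window z"
  shows "\<exists>G. path_connected G \<and> base z u \<in> G \<and> base z w \<in> G \<and> G \<subseteq> step_set z u w"
proof (cases "u = w")
  case True
  have "{base z u} \<subseteq> step_set z u w"
    using hseg_step[of u u w z "mid z u" "mid z u"] mid_inside[OF r u] interval_sub_V(2)[OF r u(1)]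
    by (auto simp: hseg_def base_def)
  then show ?thesis using True by (intro exI[of _ "{base z u}"]) auto
next
  case False
  have xi: "lf z u \<le> x" "x \<le> rt z u" "lf z w \<le> x" "x \<le> rt z w"
    using near_interval(5)[OF r u(1)] near_interval(5)[OF r w(1)] x by auto
  define G where "G = hseg (y u) (mid z u) x \<union> hseg (y w) x (mid z w)"
  have "path_connected G"
    unfolding G_def using y
    by (intro path_connected_chain[of _ _ "pt x (y u)"] path_connected_hseg) (auto simp: hseg_ends)
  moreover have "base z u \<in> G" "base z w \<in> G"
    by (auto simp: G_def base_def hseg_ends)
  moreover have "Q \<in> step_set z u w" if "Q \<in> G" for Q
  proof -
    have "\<exists>t v. v \<in> {u, w} \<and> Q = pt t (y v) \<and> (t = x \<or> (lf z v < t \<and> t < rt z v))"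
      using that mid_inside[OF r u] mid_inside[OF r w] xi
      unfolding G_def hseg_def closed_segment_eq_real_ivl
      by (auto split: if_splits) (force)+
    then obtain t v where t: "v \<in> {u, w}" "Q = pt t (y v)" "t = x \<or> (lf z v < t \<and> t < rt z v)" by blast
    show ?thesis
    proof (cases "t = x")
      case True
      have "piece u w x (y v)" unfolding piece_def using False y x t(1) by auto
      then show ?thesis using t True y xi by (auto simp: step_set_def covered_def)
    next
      case False
      then have "hseg (y v) t t \<subseteq> step_set z u w"
        using t interval_sub_V(2)[OF r u(1)] interval_sub_V(2)[OF r w(1)] by (intro hseg_step) auto
      then show ?thesis using t hseg_ends by blast
    qed
  qed
  ultimately show ?thesis by blast
qed

lemma thin_edge:
  assumes r: "0 < r" "8 * r \<le> \<eta>" and d: "near z r d"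
    and e: "ends e = (d, w) \<or> ends e = (w, d)" and len: "len e = 0"
  obtains x where "x \<in> window z" "x \<in> V d" "x \<in> V w" "y d = y w"
proof -
  obtain p where p: "{p..p + len e} \<subseteq> T e" "{p..p + len e} \<subseteq> {lf z d..rt z d}"
    using tile_in_window[OF r e near_interval(3)[OF r d] near_interval(5)[OF r d, unfolded window_def]] .
  have e': "ends e = (w, d) \<or> ends e = (d, w)" using e by blast
  have "p \<in> T e" "p \<in> {lf z d..rt z d}" using p len by auto
  then have "p \<in> V d" "p \<in> V w" "p \<in> window z"
    using T_sub_V[OF e'] interval_sub_V(1,3)[OF r d] by blast+
  moreover have "lo e = hi e" using len len_pos[of e] lo_le_hi[of e] by simp
  then have "y d = y w" using e by (auto simp: y_lo_def y_hi_def min_def max_def split: if_splits)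
  ultimately show ?thesis using that by blast
qed

lemma wide_edge_fat:
  assumes e: "ends e = (d, w) \<or> ends e = (w, d)" and len: "len e \<noteq> 0"
  shows "fat d"
proof -
  have "0 < len e" using len len_nonneg[of e] by simp
  moreover have "{a e<..<a e + len e} \<subseteq> T e"
    using arc_piece[of "a e" 0 \<eta> "len e"] unfolding tile_int_def by (auto simp: subset_iff)
  ultimately show ?thesis
    unfolding fat_def using T_sub_V[OF e] by (intro exI[of _ "a e"] exI[of _ "a e + len e"]) auto
qed

lemma thin_window:
  assumes r: "0 < r" "8 * r \<le> \<eta>" and d: "near z r d" "\<not> fat d" and x: "x \<in> V d" "x \<in> window z"
  shows "V d \<inter> window z = {x}"
  using near_interval[OF r d(1)] fat_iff[OF r d(1)] d(2) x by force

definition corridor :: "real \<Rightarrow> 'v set \<Rightarrow> (real ^ 2) set" where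
  "corridor z U = (\<Union>u\<in>{u \<in> U. fat u}. \<Union>w\<in>{w \<in> U. fat w}. step_set z u w)"

lemma corridor_mono: "U \<subseteq> U' \<Longrightarrow> corridor z U \<subseteq> corridor z U'"
  unfolding corridor_def by blast

text \<open>Thin vertices, whose arc is a single point, are skipped: a run of thin vertices joins the
  fat vertices before and after it at one point of both arcs.\<close>

lemma walk_curve_aux:
  assumes r: "0 < r" "8 * r \<le> \<eta>" and near: "\<And>k. k \<le> n \<Longrightarrow> near z r (\<omega> k)"
    and adj: "\<And>k. k < n \<Longrightarrow> adj ends (\<omega> k) (\<omega> (Suc k))" and fat: "fat (\<omega> 0)"
  shows "\<exists>G i. i \<le> n \<and> fat (\<omega> i) \<and> path_connected G \<and> base z (\<omega> 0) \<in> G \<and> base z (\<omega> i) \<in> G \<and>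
    G \<subseteq> corridor z (\<omega> ` {..n}) \<and> (fat (\<omega> n) \<longrightarrow> i = n) \<and> y (\<omega> n) = y (\<omega> i) \<and> V (\<omega> n) \<inter> window z \<subseteq> V (\<omega> i)"
  using near adj
proof (induction n)
  case 0
  have "\<omega> 0 \<in> \<omega> ` {..0}" by simp
  have "lf z (\<omega> 0) \<in> V (\<omega> 0) \<inter> window z"
    using near_interval[OF r 0(1)[of 0]] by auto
  then obtain G where G: "path_connected G" "base z (\<omega> 0) \<in> G" "G \<subseteq> step_set z (\<omega> 0) (\<omega> 0)"
    using join_at_point[OF r 0(1)[of 0] fat 0(1)[of 0] fat] by blast
  then have "G \<subseteq> corridor z (\<omega> ` {..0})" using fat by (auto simp: corridor_def)
  then show ?case using G fat by blast
next
  case (Suc n)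
  have nr: "near z r (\<omega> k)" if "k \<le> Suc n" for k using Suc.prems(1) that by blast
  obtain G i where i: "i \<le> n" "fat (\<omega> i)" and G: "path_connected G" "base z (\<omega> 0) \<in> G" "base z (\<omega> i) \<in> G"
    "G \<subseteq> corridor z (\<omega> ` {..n})" and last: "fat (\<omega> n) \<longrightarrow> i = n" "y (\<omega> n) = y (\<omega> i)"
    "V (\<omega> n) \<inter> window z \<subseteq> V (\<omega> i)"
    using Suc.IH Suc.prems by (metis (no_types, lifting) le_SucI less_SucI)
  let ?d = "\<omega> n" and ?w = "\<omega> (Suc n)" and ?u = "\<omega> i"
  obtain e where e: "ends e = (?d, ?w) \<or> ends e = (?w, ?d)"
    using adjE[OF Suc.prems(2)[of n]] by auto
  have e': "ends e = (?w, ?d) \<or> ends e = (?d, ?w)" using e by blast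
  have mono: "corridor z (\<omega> ` {..n}) \<subseteq> corridor z (\<omega> ` {..Suc n})" by (intro corridor_mono) auto
  have extend: ?case
    if fw: "fat ?w" and H: "path_connected H" "base z ?u \<in> H" "base z ?w \<in> H" "H \<subseteq> step_set z ?u ?w" for H
  proof -
    have "H \<subseteq> corridor z (\<omega> ` {..Suc n})"
    proof -
      have "?u \<in> {u \<in> \<omega> ` {..Suc n}. fat u}" "?w \<in> {u \<in> \<omega> ` {..Suc n}. fat u}" using fw i by auto
      then show ?thesis using H(4) unfolding corridor_def by blast
    qed
    then have "path_connected (G \<union> H) \<and> base z (\<omega> 0) \<in> G \<union> H \<and> base z ?w \<in> G \<union> H \<and> G \<union> H \<subseteq> corridor z (\<omega> ` {..Suc n})"
      using path_connected_chain[OF G(1) H(1) G(3) H(2)] G H mono by blast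
    then show ?thesis using fw by (intro exI[of _ "G \<union> H"] exI[of _ "Suc n"]) auto
  qed
  show ?case
  proof (cases "len e = 0")
    case False
    \<comment> \<open>A tile of positive length makes both ends fat, so there is no run of thin
      vertices to bridge.\<close>
    then have "fat ?d" "fat ?w" using wide_edge_fat[OF e] wide_edge_fat[OF e'] by auto
    then have "?u = ?d" using last by auto
    moreover obtain H where "path_connected H" "base z ?d \<in> H" "base z ?w \<in> H" "H \<subseteq> step_set z ?d ?w"
      using join_by_edge[OF r nr _ nr _ e] \<open>fat ?d\<close> \<open>fat ?w\<close> False len_nonneg[of e] by force
    ultimately show ?thesis using extend[OF \<open>fat ?w\<close>] by simp
  next
    case True
    obtain x where x: "x \<in> window z" "x \<in> V ?d" "x \<in> V ?w" "y ?d = y ?w"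
      using thin_edge[OF r nr e True] by auto
    have xu: "x \<in> V ?u" "y ?u = y ?w" using last x by auto
    show ?thesis
    proof (cases "fat ?w")
      case fw: True
      obtain H where "path_connected H" "base z ?u \<in> H" "base z ?w \<in> H" "H \<subseteq> step_set z ?u ?w"
        using join_at_point[OF r nr i(2) nr fw xu(2,1) x(3,1)] i(1) by auto
      then show ?thesis using extend[OF fw] by blast
    next
      case fw: False
      \<comment> \<open>A thin \<open>?w\<close> adds nothing to the curve: its one point in the
        window already lies in the arc of the last fat vertex \<open>?u\<close>.\<close>
      have "V ?w \<inter> window z = {x}" using thin_window[OF r nr fw x(3,1)] by simp
      then show ?thesis
        using fw G i mono xu by (intro exI[of _ G] exI[of _ i]) auto
    qed
  qed
qed

lemma walk_curve:
  assumes "0 < r" "8 * r \<le> \<eta>" "\<And>k. k \<le> n \<Longrightarrow> near z r (\<omega> k)"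
    "\<And>k. k < n \<Longrightarrow> adj ends (\<omega> k) (\<omega> (Suc k))" "fat (\<omega> 0)" "fat (\<omega> n)"
  obtains G where "path_connected G" "base z (\<omega> 0) \<in> G" "base z (\<omega> n) \<in> G" "G \<subseteq> corridor z (\<omega> ` {..n})"
  using walk_curve_aux[OF assms(1-5)] assms(6) by blast

lemma corridorD:
  assumes "Q \<in> corridor z U"
  obtains x s v w where "Q = pt x s" "v \<in> U" "covered z v x s" "w \<in> U" "y w \<le> s"
proof -
  obtain u w x s where *: "u \<in> U" "w \<in> U" "Q = pt x s" "covered z u x s \<or> covered z w x s" "min (y u) (y w) \<le> s"
    using assms by (auto simp: corridor_def step_set_def)
  then show ?thesis using that by (metis min_def)
qed

lemma corridors_disjoint:
  assumes "U \<inter> U' = {}"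
  shows "corridor z U \<inter> corridor z U' = {}"
proof (rule ccontr)
  assume "corridor z U \<inter> corridor z U' \<noteq> {}"
  then obtain Q where Q: "Q \<in> corridor z U" "Q \<in> corridor z U'" by blast
  obtain u w x s where 1: "u \<in> U" "w \<in> U" "fat u" "fat w" "Q = pt x s" "piece u w x s"
    using Q(1) by (auto simp: corridor_def step_set_def)
  obtain u' w' where 2: "u' \<in> U'" "w' \<in> U'" "fat u'" "fat w'" "piece u' w' x s"
    using Q(2) 1(5) by (auto simp: corridor_def step_set_def)
  show False
    by (rule pieces_disjoint[OF 1(3,4) 2(3,4) _ 1(6) 2(5)]) (use 1 2 assms in auto)
qed

end

section \<open>Settling walks and how they cross\<close>

context tiled_walk
begin

text \<open>What the planar argument uses of a walk landing at \<open>\<xi>\<close>, in real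
  coordinates of the window and without any probability.\<close>

definition settles :: "real \<Rightarrow> real \<Rightarrow> (nat \<Rightarrow> 'v) \<Rightarrow> real \<Rightarrow> bool" where
  "settles z r \<omega> \<xi> \<longleftrightarrow> (\<forall>k. near z r (\<omega> k)) \<and> (\<forall>k. adj ends (\<omega> k) (\<omega> (Suc k))) \<and>
     (\<lambda>k. y (\<omega> k)) \<longlonglongrightarrow> 1 \<and>
     (\<forall>\<epsilon>>0. \<forall>\<^sub>F k in sequentially. \<xi> - \<epsilon> \<le> lf z (\<omega> k) \<and> rt z (\<omega> k) \<le> \<xi> + \<epsilon>)"

lemma thin_step:
  assumes "0 < r" "8 * r \<le> \<eta>" "near z r d" "adj ends d w" "\<not> fat d"
  shows "y w = y d"
proof -
  obtain e where e: "ends e = (d, w) \<or> ends e = (w, d)" using adjE[OF assms(4)] .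
  then have "len e = 0" using wide_edge_fat assms(5) by blast
  then show ?thesis using thin_edge[OF assms(1-3) e] by metis
qed

lemma thin_run:
  assumes r: "0 < r" "8 * r \<le> \<eta>" and s: "settles z r \<omega> \<xi>"
    and thin: "\<And>k. N \<le> k \<Longrightarrow> k < M \<Longrightarrow> \<not> fat (\<omega> k)" and "N \<le> M"
  shows "y (\<omega> M) = y (\<omega> N)"
  using \<open>N \<le> M\<close> thin
proof (induction M rule: dec_induct)
  case (step n)
  then show ?case
    using thin_step[OF r, of z "\<omega> n" "\<omega> (Suc n)"] s by (simp add: settles_def)
qed simp

text \<open>The height is constant along a run of thin vertices, while it tends to 1 without ever
  reaching it.\<close>

lemma fat_infinitely_often:
  assumes r: "0 < r" "8 * r \<le> \<eta>" and s: "settles z r \<omega> \<xi>" and t: "t < 1"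
  shows "\<exists>n\<ge>N. fat (\<omega> n) \<and> t < y (\<omega> n)"
proof (rule ccontr)
  assume none: "\<not> ?thesis"
  have lim: "(\<lambda>k. y (\<omega> k)) \<longlonglongrightarrow> 1" using s by (simp add: settles_def)
  then have "eventually (\<lambda>k. t < y (\<omega> k)) sequentially" using t by (rule order_tendstoD)
  then obtain M where M: "\<And>k. k \<ge> M \<Longrightarrow> t < y (\<omega> k)" by (auto simp: eventually_sequentially)
  define L where "L = max M N"
  have thin: "\<not> fat (\<omega> k)" if "k \<ge> L" for k
  proof
    assume "fat (\<omega> k)"
    moreover have "N \<le> k" "M \<le> k" using that by (auto simp: L_def)
    ultimately show False using none M[of k] by blast
  qed
  have "y (\<omega> k) = y (\<omega> L)" if "L \<le> k" for k
    by (rule thin_run[OF r s _ that]) (rule thin)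
  then have "eventually (\<lambda>k. y (\<omega> k) = y (\<omega> L)) sequentially"
    unfolding eventually_sequentially by blast
  then have "(\<lambda>k. y (\<omega> k)) \<longlonglongrightarrow> y (\<omega> L)"
    by (rule tendsto_eventually)
  with lim have "y (\<omega> L) = 1" using LIMSEQ_unique by blast
  then show False using y_less_1[of "\<omega> L"] by simp
qed

text \<open>The height does not change before the first fat vertex, so the lower end of the drawn
  curve is still at the height of the start.\<close>

lemma first_fat:
  assumes r: "0 < r" "8 * r \<le> \<eta>" and s: "settles z r \<omega> \<xi>"
  shows "\<exists>k. fat (\<omega> k) \<and> y (\<omega> k) = y (\<omega> 0)"
proof -
  have ex: "\<exists>k. fat (\<omega> k)" using fat_infinitely_often[OF r s, of 0 0] by auto
  define k where "k = (LEAST k. fat (\<omega> k))"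
  have "fat (\<omega> k)" unfolding k_def using ex by (rule LeastI_ex)
  moreover have "y (\<omega> k) = y (\<omega> 0)"
    by (rule thin_run[OF r s]) (auto simp: k_def dest: not_less_Least)
  ultimately show ?thesis by blast
qed

text \<open>The finitely many positions not yet close to \<open>\<xi>\<close> have heights bounded
  away from 1; above that bound only later positions can cover a point.\<close>

lemma settles_high:
  assumes s: "settles z r \<omega> \<xi>" and \<epsilon>: "0 < \<epsilon>"
  shows "\<exists>t<1. \<forall>k x s. t \<le> s \<longrightarrow> covered z (\<omega> k) x s \<longrightarrow> \<bar>x - \<xi>\<bar> \<le> \<epsilon>"
proof -
  have "eventually (\<lambda>k. \<xi> - \<epsilon> \<le> lf z (\<omega> k) \<and> rt z (\<omega> k) \<le> \<xi> + \<epsilon>) sequentially"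
    using s \<epsilon> by (simp add: settles_def)
  then obtain N where N: "\<And>k. k \<ge> N \<Longrightarrow> \<xi> - \<epsilon> \<le> lf z (\<omega> k) \<and> rt z (\<omega> k) \<le> \<xi> + \<epsilon>"
    by (auto simp: eventually_sequentially)
  define S where "S = insert 0 ((\<lambda>k. y (\<omega> k)) ` {..<N})"
  have S: "finite S" "S \<noteq> {}" by (auto simp: S_def)
  have "Max S < 1" using S y_less_1 by (auto simp: S_def)
  then obtain t where t: "Max S < t" "t < 1" using dense by blast
  have "\<bar>x - \<xi>\<bar> \<le> \<epsilon>" if "t \<le> s" "covered z (\<omega> k) x s" for k x s
  proof -
    have "t \<le> y (\<omega> k)" using that by (simp add: covered_def)
    moreover have "y (\<omega> k) \<le> Max S" if "k < N" using S(1) that by (intro Max_ge) (auto simp: S_def)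
    ultimately have "k \<ge> N" using t by (meson less_le_trans not_le)
    from N[OF this] that(2) show ?thesis by (auto simp: covered_def abs_le_iff)
  qed
  then show ?thesis using t by blast
qed

text \<open>The lower end of the curve of \<open>X\<close> is continued down to height \<open>-1\<close>, to the right and
  up again outside the window; then its upper end separates the upper ends of the joint curve
  of \<open>Z'\<close> and \<open>Z\<close>.\<close>

theorem crossing:
  assumes r: "0 < r" "8 * r \<le> \<eta>"
    and X: "settles z r X \<xi>" and Z: "settles z r Z b" and Z': "settles z r Z' b'"
    and order: "b' < \<xi>" "\<xi> < b" and start: "Z 0 = Z' 0"
    and above: "\<And>k. y (X 0) < y (Z k)" "\<And>k. y (X 0) < y (Z' k)"
  shows "\<exists>i j. X i = Z j \<or> X i = Z' j"
proof (rule ccontr)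
  assume "\<not> ?thesis"
  then have disj: "range X \<inter> (range Z \<union> range Z') = {}" by auto
  have nearX: "near z r (X k)" and nearZ: "near z r (Z k)" and nearZ': "near z r (Z' k)" for k
    using X Z Z' by (auto simp: settles_def)
  \<comment> \<open>A third of the smaller gap: the \<open>\<epsilon>\<close>-neighbourhoods of
    \<open>b'\<close>, \<open>\<xi>\<close> and \<open>b\<close>, to which the curves are confined
    above level \<open>t\<close>, are then disjoint.\<close>
  define \<epsilon> where "\<epsilon> = min (\<xi> - b') (b - \<xi>) / 3"
  have \<epsilon>: "0 < \<epsilon>" "b' + 3 * \<epsilon> \<le> \<xi>" "\<xi> + 3 * \<epsilon> \<le> b" using order by (auto simp: \<epsilon>_def min_def field_simps)
  obtain t1 where t1: "t1 < 1" "\<And>k x s. t1 \<le> s \<Longrightarrow> covered z (X k) x s \<Longrightarrow> \<bar>x - \<xi>\<bar> \<le> \<epsilon>"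
    using settles_high[OF X \<epsilon>(1)] by blast
  obtain t2 where t2: "t2 < 1" "\<And>k x s. t2 \<le> s \<Longrightarrow> covered z (Z k) x s \<Longrightarrow> \<bar>x - b\<bar> \<le> \<epsilon>"
    using settles_high[OF Z \<epsilon>(1)] by blast
  obtain t3 where t3: "t3 < 1" "\<And>k x s. t3 \<le> s \<Longrightarrow> covered z (Z' k) x s \<Longrightarrow> \<bar>x - b'\<bar> \<le> \<epsilon>"
    using settles_high[OF Z' \<epsilon>(1)] by blast
  define t where "t = max t1 (max t2 t3)"
  have t: "t < 1" "t1 \<le> t" "t2 \<le> t" "t3 \<le> t" using t1 t2 t3 by (auto simp: t_def)
  obtain k0 where k0: "fat (X k0)" "y (X k0) = y (X 0)" using first_fat[OF r X] by blast
  obtain n where n: "n \<ge> k0" "fat (X n)" "t < y (X n)" using fat_infinitely_often[OF r X t(1)] by blast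
  obtain m where m: "fat (Z m)" "t < y (Z m)" using fat_infinitely_often[OF r Z t(1)] by blast
  obtain m' where m': "fat (Z' m')" "t < y (Z' m')" using fat_infinitely_often[OF r Z' t(1)] by blast
  have covered_mid: "covered z v (mid z v) (y v)" if "near z r v" for v
    using near_interval(2)[OF r that] by (simp add: covered_def mid_def)
  have pos: "\<bar>mid z (X n) - \<xi>\<bar> \<le> \<epsilon>" "\<bar>mid z (Z m) - b\<bar> \<le> \<epsilon>" "\<bar>mid z (Z' m') - b'\<bar> \<le> \<epsilon>"
    using t1(2)[OF _ covered_mid[OF nearX]] t2(2)[OF _ covered_mid[OF nearZ]] t3(2)[OF _ covered_mid[OF nearZ']]
      n m m' t by auto
  have inW: "z - 2 * r \<le> x \<and> x \<le> z + 2 * r" if "near z r v" "covered z v x s" for v x s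
    using near_interval[OF r that(1)] that(2) by (auto simp: covered_def)

  \<comment> \<open>\<open>Z'\<close> run backwards from time \<open>m'\<close> to the common start,
    then \<open>Z\<close> up to time \<open>m\<close>.\<close>
  define Y where "Y i = (if i \<le> m' then Z' (m' - i) else Z (i - m'))" for i
  have Ycov: "\<exists>k. v = Z k \<or> v = Z' k" if "v \<in> Y ` {..m' + m}" for v
    using that by (auto simp: Y_def)
  have nearY: "near z r (Y i)" for i using nearZ nearZ' by (simp add: Y_def)
  have adjY: "adj ends (Y i) (Y (Suc i))" for i
  proof -
    consider "i < m'" | "i = m'" | "i > m'" by linarith
    then show ?thesis
    proof cases
      case 1
      then have "Suc (m' - Suc i) = m' - i" by simp
      then have "adj ends (Z' (m' - Suc i)) (Z' (m' - i))" using Z' unfolding settles_def by metis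
      then show ?thesis using 1 by (simp add: Y_def adj_sym)
    next
      case 2
      then show ?thesis using Z start unfolding settles_def by (simp add: Y_def) (metis One_nat_def)
    next
      case 3
      then have "Suc i - m' = Suc (i - m')" by simp
      then show ?thesis using 3 Z unfolding settles_def by (simp add: Y_def)
    qed
  qed
  have Yends: "Y 0 = Z' m'" "Y (m' + m) = Z m" using start by (auto simp: Y_def)
  obtain G where G: "path_connected G" "base z (Z' m') \<in> G" "base z (Z m) \<in> G" "G \<subseteq> corridor z (Y ` {..m' + m})"
    using walk_curve[OF r, of "m' + m" z Y] nearY adjY m(1) m'(1) Yends by metis
  obtain H where H: "path_connected H" "base z (X k0) \<in> H" "base z (X n) \<in> H" "H \<subseteq> corridor z (range X)"
  proof -
    have "near z r (X (k0 + k))" "adj ends (X (k0 + k)) (X (k0 + Suc k))" for k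
      using X by (auto simp: settles_def)
    then obtain H where "path_connected H" "base z (X (k0 + 0)) \<in> H" "base z (X (k0 + (n - k0))) \<in> H"
      "H \<subseteq> corridor z ((\<lambda>k. X (k0 + k)) ` {..n - k0})"
      using walk_curve[OF r, of "n - k0" z "\<lambda>k. X (k0 + k)"] k0(1) n(1,2) by auto
    moreover have "corridor z ((\<lambda>k. X (k0 + k)) ` {..n - k0}) \<subseteq> corridor z (range X)"
      by (rule corridor_mono) auto
    ultimately show ?thesis using that n(1) by auto
  qed
  have GH: "G \<inter> H = {}"
  proof -
    have "Y ` {..m' + m} \<inter> range X = {}" using Ycov disj by blast
    from corridors_disjoint[OF this] show ?thesis using G(4) H(4) by blast
  qed
  have Gpt: "\<exists>x s. Q = pt x s \<and> y (X 0) < s \<and> s \<le> 1 \<and> z - 2 * r \<le> x \<and> x \<le> z + 2 * r \<and>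
      (t \<le> s \<longrightarrow> \<bar>x - b\<bar> \<le> \<epsilon> \<or> \<bar>x - b'\<bar> \<le> \<epsilon>)" if QG: "Q \<in> G" for Q
  proof -
    have "Q \<in> corridor z (Y ` {..m' + m})" using QG G(4) by blast
    then obtain x s v w where q: "Q = pt x s" "v \<in> Y ` {..m' + m}" "covered z v x s" "w \<in> Y ` {..m' + m}" "y w \<le> s"
      by (rule corridorD)
    have "y (X 0) < y w" using Ycov[OF q(4)] above by metis
    moreover have "s \<le> 1" using q(3) y_le_1[of v] by (simp add: covered_def)
    moreover have "z - 2 * r \<le> x \<and> x \<le> z + 2 * r" using q(2,3) nearY inW by auto
    moreover have "\<bar>x - b\<bar> \<le> \<epsilon> \<or> \<bar>x - b'\<bar> \<le> \<epsilon>" if "t \<le> s"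
      using Ycov[OF q(2)] q(3) t2(2)[of s] t3(2)[of s] that t by fastforce
    ultimately show ?thesis using q(1,5) by (intro exI[of _ x] exI[of _ s]) auto
  qed
  have Hpt: "\<exists>x s. Q = pt x s \<and> 0 \<le> s \<and> s \<le> 1 \<and> z - 2 * r \<le> x \<and> x \<le> z + 2 * r \<and>
      (t \<le> s \<longrightarrow> \<bar>x - \<xi>\<bar> \<le> \<epsilon>)" if QH: "Q \<in> H" for Q
  proof -
    have "Q \<in> corridor z (range X)" using QH H(4) by blast
    then obtain x s v w where q: "Q = pt x s" "v \<in> range X" "covered z v x s" "w \<in> range X" "y w \<le> s"
      by (rule corridorD)
    have "0 \<le> s" using q(5) y_nonneg[of w] by simp
    moreover have "s \<le> 1" using q(3) y_le_1[of v] by (simp add: covered_def)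
    moreover have "z - 2 * r \<le> x \<and> x \<le> z + 2 * r" using q(2,3) nearX inW by auto
    moreover have "\<bar>x - \<xi>\<bar> \<le> \<epsilon>" if "t \<le> s"
      using q(2,3) t1(2)[of s] that t by fastforce
    ultimately show ?thesis using q(1) by (intro exI[of _ x] exI[of _ s]) auto
  qed
  let ?zr = "z + \<eta> / 2"
  \<comment> \<open>Vertical segments prolong the curves to height 1, the side of the box on which
    their end points are compared.\<close>
  define F1 where "F1 = (vseg (mid z (Z' m')) 1 (y (Z' m')) \<union> G) \<union> vseg (mid z (Z m)) (y (Z m)) 1"
  define F2 where "F2 = (((vseg (mid z (X n)) 1 (y (X n)) \<union> H) \<union> vseg (mid z (X k0)) (y (X k0)) (- 1)) \<union>
    hseg (- 1) (mid z (X k0)) ?zr) \<union> vseg ?zr (- 1) 1"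
  have pc1: "path_connected F1"
    unfolding F1_def
    by (intro path_connected_chain[of _ _ "base z (Z m)"] path_connected_chain[of _ _ "base z (Z' m')"]
        path_connected_vseg G) (use G(2,3) in \<open>auto simp: base_def vseg_ends\<close>)
  have pc2: "path_connected F2"
    unfolding F2_def
    by (intro path_connected_chain[of _ _ "pt ?zr (- 1)"] path_connected_chain[of _ _ "pt (mid z (X k0)) (- 1)"]
        path_connected_chain[of _ _ "base z (X k0)"] path_connected_chain[of _ _ "base z (X n)"]
        path_connected_vseg path_connected_hseg H)
      (use H(2,3) in \<open>auto simp: base_def vseg_ends hseg_ends\<close>)
  have vsegD: "\<exists>u. Q = pt x u \<and> min s s' \<le> u \<and> u \<le> max s s'" if "Q \<in> vseg x s s'" for Q x s s'
    using that by (auto simp: vseg_def closed_segment_eq_real_ivl split: if_splits)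
  have hsegD: "\<exists>u. Q = pt u s \<and> min x x' \<le> u \<and> u \<le> max x x'" if "Q \<in> hseg s x x'" for Q s x x'
    using that by (auto simp: hseg_def closed_segment_eq_real_ivl split: if_splits)
  have midW: "z - 2 * r \<le> mid z v \<and> mid z v \<le> z + 2 * r" if "near z r v" for v
    using inW[OF that covered_mid[OF that]] .
  have F1pt: "\<exists>x s. Q = pt x s \<and> y (X 0) < s \<and> s \<le> 1 \<and> z - 2 * r \<le> x \<and> x \<le> z + 2 * r \<and>
      (t \<le> s \<longrightarrow> \<bar>x - b\<bar> \<le> \<epsilon> \<or> \<bar>x - b'\<bar> \<le> \<epsilon>) \<and> (Q \<in> G \<or> t \<le> s)" if Q: "Q \<in> F1" for Q
  proof (cases "Q \<in> G")
    case True
    then show ?thesis using Gpt by blast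
  next
    case False
    then consider "Q \<in> vseg (mid z (Z' m')) 1 (y (Z' m'))" | "Q \<in> vseg (mid z (Z m)) (y (Z m)) 1"
      using Q by (auto simp: F1_def)
    then show ?thesis
    proof cases
      case 1
      then obtain u where u: "Q = pt (mid z (Z' m')) u" "y (Z' m') \<le> u" "u \<le> 1"
        using vsegD[OF 1] y_le_1[of "Z' m'"] by auto
      then show ?thesis
        using above(2)[of m'] m' pos midW[OF nearZ'] by (intro exI[of _ "mid z (Z' m')"] exI[of _ u]) auto
    next
      case 2
      then obtain u where u: "Q = pt (mid z (Z m)) u" "y (Z m) \<le> u" "u \<le> 1"
        using vsegD[OF 2] y_le_1[of "Z m"] by auto
      then show ?thesis
        using above(1)[of m] m pos midW[OF nearZ] by (intro exI[of _ "mid z (Z m)"] exI[of _ u]) auto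
    qed
  qed
  have F2pt: "\<exists>x s. Q = pt x s \<and> - 1 \<le> s \<and> s \<le> 1 \<and> z - 2 * r \<le> x \<and> x \<le> ?zr \<and>
      (s \<le> y (X 0) \<or> x = ?zr \<or> Q \<in> H \<or> t \<le> s) \<and> (x = ?zr \<or> s \<le> y (X 0) \<or> (t \<le> s \<longrightarrow> \<bar>x - \<xi>\<bar> \<le> \<epsilon>))"
    if Q: "Q \<in> F2" for Q
  proof -
    have y0: "0 \<le> y (X 0)" by (rule y_nonneg)
    consider "Q \<in> H" | "Q \<in> vseg (mid z (X n)) 1 (y (X n))" | "Q \<in> vseg (mid z (X k0)) (y (X k0)) (- 1)"
      | "Q \<in> hseg (- 1) (mid z (X k0)) ?zr" | "Q \<in> vseg ?zr (- 1) 1"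
      using Q by (auto simp: F2_def)
    then show ?thesis
    proof cases
      case 1
      then obtain x s where "Q = pt x s" "0 \<le> s" "s \<le> 1" "z - 2 * r \<le> x" "x \<le> z + 2 * r" "t \<le> s \<longrightarrow> \<bar>x - \<xi>\<bar> \<le> \<epsilon>"
        using Hpt by blast
      then show ?thesis using 1 r by (intro exI[of _ x] exI[of _ s]) auto
    next
      case 2
      then obtain u where u: "Q = pt (mid z (X n)) u" "y (X n) \<le> u" "u \<le> 1"
        using vsegD[OF 2] y_le_1[of "X n"] by auto
      then show ?thesis
        using n pos midW[OF nearX, of n] r y_nonneg[of "X n"]
        by (rule_tac exI[of _ "mid z (X n)"], rule_tac exI[of _ u]) auto
    next
      case 3
      then obtain u where u: "Q = pt (mid z (X k0)) u" "- 1 \<le> u" "u \<le> y (X 0)"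
        using vsegD[OF 3] k0 y0 by auto
      then show ?thesis
        using midW[OF nearX, of k0] r y_le_1[of "X 0"]
        by (intro exI[of _ "mid z (X k0)"] exI[of _ u]) auto
    next
      case 4
      then obtain u where u: "Q = pt u (- 1)" "mid z (X k0) \<le> u" "u \<le> ?zr"
        using hsegD[OF 4] midW[OF nearX, of k0] r by auto
      then show ?thesis
        using midW[OF nearX, of k0] y0 by (intro exI[of _ u] exI[of _ "- 1"]) auto
    next
      case 5
      then obtain u where u: "Q = pt ?zr u" "- 1 \<le> u" "u \<le> 1"
        using vsegD[OF 5] by auto
      then show ?thesis using r by (intro exI[of _ ?zr] exI[of _ u]) auto
    qed
  qed
  \<comment> \<open>\<open>F1\<close> has no point at or below the height \<open>y (X 0)\<close> and
    does not reach the right edge of the window. Above \<open>t\<close> the two sets are separated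
    by the angle; what remains is \<open>G\<close> against \<open>H\<close>.\<close>
  have disjF: "F1 \<inter> F2 = {}"
  proof (rule ccontr)
    assume "F1 \<inter> F2 \<noteq> {}"
    then obtain Q where Q: "Q \<in> F1" "Q \<in> F2" by blast
    obtain x s where 1: "Q = pt x s" "y (X 0) < s" "x \<le> z + 2 * r"
      "t \<le> s \<longrightarrow> \<bar>x - b\<bar> \<le> \<epsilon> \<or> \<bar>x - b'\<bar> \<le> \<epsilon>" "Q \<in> G \<or> t \<le> s"
      using F1pt[OF Q(1)] by blast
    obtain x' s' where 2: "Q = pt x' s'" "s' \<le> y (X 0) \<or> x' = ?zr \<or> Q \<in> H \<or> t \<le> s'"
      "x' = ?zr \<or> s' \<le> y (X 0) \<or> (t \<le> s' \<longrightarrow> \<bar>x' - \<xi>\<bar> \<le> \<epsilon>)"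
      using F2pt[OF Q(2)] by blast
    have eq: "x' = x" "s' = s" using 1(1) 2(1) by auto
    have "x \<noteq> ?zr" using 1(3) r by auto
    then have "Q \<in> H \<or> t \<le> s" "t \<le> s \<longrightarrow> \<bar>x - \<xi>\<bar> \<le> \<epsilon>" using 2 1(2) unfolding eq by auto
    moreover have "\<not> t \<le> s" using calculation 1(4) \<epsilon> by (auto simp: abs_le_iff)
    ultimately show False using 1(5) GH by blast
  qed
  obtain f where f: "path f" "path_image f \<subseteq> F1" "pathstart f = pt (mid z (Z' m')) 1" "pathfinish f = pt (mid z (Z m)) 1"
    using pc1 vseg_ends unfolding path_connected_def F1_def by blast
  obtain g where g: "path g" "path_image g \<subseteq> F2" "pathstart g = pt (mid z (X n)) 1" "pathfinish g = pt ?zr 1"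
    using pc2 vseg_ends unfolding path_connected_def F2_def by blast
  have box: "pt x s \<in> cbox (pt (z - \<eta> / 2) 1) (pt ?zr (- 1))"
    if "z - 2 * r \<le> x" "x \<le> ?zr" "- 1 \<le> s" "s \<le> 1" for x s
    using that r by (auto simp: mem_box_cart forall_2)
  have "path_image f \<subseteq> cbox (pt (z - \<eta> / 2) 1) (pt ?zr (- 1))"
  proof
    fix Q assume "Q \<in> path_image f"
    then obtain x s where "Q = pt x s" "y (X 0) < s" "s \<le> 1" "z - 2 * r \<le> x" "x \<le> z + 2 * r"
      using F1pt f(2) by blast
    then show "Q \<in> cbox (pt (z - \<eta> / 2) 1) (pt ?zr (- 1))" using box[of x s] r y_nonneg[of "X 0"] by auto
  qed
  moreover have "path_image g \<subseteq> cbox (pt (z - \<eta> / 2) 1) (pt ?zr (- 1))"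
    using F2pt g(2) box by blast
  \<comment> \<open>On that side the end points of the two paths alternate, which forces them to
    cross.\<close>
  moreover have "mid z (Z' m') < mid z (X n)" "mid z (X n) < mid z (Z m)" "mid z (Z m) < ?zr"
    using pos \<epsilon> midW[OF nearZ, of m] r by (auto simp: abs_le_iff)
  ultimately obtain Q where "Q \<in> path_image f" "Q \<in> path_image g"
    using fashoda_interlace[OF f(1) g(1), of "pt (z - \<eta> / 2) 1" "pt ?zr (- 1)"] f(3,4) g(3,4) by auto
  then show False using f(2) g(2) disjF by blast
qed

end

subsection \<open>Boundary values\<close>

text \<open>One half of the probability integral transform. \<open>S\<close> is a lower set; if it
  has a supremum, the mass below it is at most \<open>\<delta>\<close> by continuity from below, and
  the supremum itself has no mass.\<close>

lemma (in prob_space) quantile_bound: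
  fixes R :: "'a \<Rightarrow> real"
  assumes R [measurable]: "R \<in> borel_measurable M"
    and atomless: "\<And>x. prob {\<omega> \<in> space M. R \<omega> = x} = 0" and \<delta>: "0 < \<delta>"
  shows "prob {\<omega> \<in> space M. prob {\<omega>' \<in> space M. R \<omega>' < R \<omega>} < \<delta>} \<le> \<delta>"
proof -
  define G where "G x = prob {\<omega> \<in> space M. R \<omega> < x}" for x
  have mono: "mono G"
    unfolding G_def by (intro monoI finite_measure_mono) auto
  have [measurable]: "G \<in> borel_measurable borel" by (rule borel_measurable_mono[OF mono])
  define S where "S = {x. G x < \<delta>}"
  have down: "x \<in> S" if "z \<in> S" "x \<le> z" for x z
    using monoD[OF mono that(2)] that(1) by (simp add: S_def)
  have approx: "prob {\<omega> \<in> space M. R \<omega> < x} \<le> \<delta>" if "\<And>z. z < x \<Longrightarrow> z \<in> S" for x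
  proof -
    have "(\<lambda>n. prob {\<omega> \<in> space M. R \<omega> < x - 1 / real (Suc n)}) \<longlonglongrightarrow>
        prob (\<Union>n. {\<omega> \<in> space M. R \<omega> < x - 1 / real (Suc n)})"
    proof (rule finite_Lim_measure_incseq)
      have "1 / real (Suc n) \<le> 1 / real (Suc m)" if "m \<le> n" for m n
        using that by (intro divide_left_mono) auto
      then show "incseq (\<lambda>n. {\<omega> \<in> space M. R \<omega> < x - 1 / real (Suc n)})"
        unfolding incseq_def by (smt (verit) Collect_mono_iff)
    qed auto
    moreover have "(\<Union>n. {\<omega> \<in> space M. R \<omega> < x - 1 / real (Suc n)}) = {\<omega> \<in> space M. R \<omega> < x}"
    proof (intro equalityI subsetI)
      fix \<omega> assume "\<omega> \<in> {\<omega> \<in> space M. R \<omega> < x}"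
      then have *: "\<omega> \<in> space M" "0 < x - R \<omega>" by auto
      then obtain n where "1 / real (Suc n) < x - R \<omega>" by (metis nat_approx_posE)
      then show "\<omega> \<in> (\<Union>n. {\<omega> \<in> space M. R \<omega> < x - 1 / real (Suc n)})"
        using * by (auto intro!: exI[of _ n])
    next
      fix \<omega> assume "\<omega> \<in> (\<Union>n. {\<omega> \<in> space M. R \<omega> < x - 1 / real (Suc n)})"
      then obtain n where "\<omega> \<in> space M" "R \<omega> < x - 1 / real (Suc n)" by blast
      moreover have "0 < 1 / real (Suc n)" by simp
      ultimately have "R \<omega> < x" by linarith
      then show "\<omega> \<in> {\<omega> \<in> space M. R \<omega> < x}" using \<open>\<omega> \<in> space M\<close> by simp
    qed
    ultimately have lim: "(\<lambda>n. G (x - 1 / real (Suc n))) \<longlonglongrightarrow> prob {\<omega> \<in> space M. R \<omega> < x}"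
      by (simp add: G_def)
    have "G (x - 1 / real (Suc n)) \<le> \<delta>" for n
      using that[of "x - 1 / real (Suc n)"] by (simp add: S_def less_imp_le)
    then show ?thesis by (intro LIMSEQ_le_const2[OF lim]) auto
  qed
  have "prob {\<omega> \<in> space M. R \<omega> \<in> S} \<le> \<delta>"
  proof (cases "bdd_above S")
    case True
    show ?thesis
    proof (cases "S = {}")
      case False
      have "z \<in> S" if "z < Sup S" for z
        using that less_cSup_iff[OF False True] down by (metis less_imp_le)
      then have "prob {\<omega> \<in> space M. R \<omega> < Sup S} \<le> \<delta>" by (rule approx)
      moreover have "prob {\<omega> \<in> space M. R \<omega> \<in> S} \<le> prob ({\<omega> \<in> space M. R \<omega> < Sup S} \<union> {\<omega> \<in> space M. R \<omega> = Sup S})"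
        using cSup_upper[OF _ True] by (intro finite_measure_mono) (auto simp: order_le_less)
      moreover have "\<dots> \<le> prob {\<omega> \<in> space M. R \<omega> < Sup S} + prob {\<omega> \<in> space M. R \<omega> = Sup S}"
          by (intro measure_Un_le) auto
      ultimately show ?thesis using atomless by simp
    qed (use \<delta> in simp)
  next
    case False
    have all: "x \<in> S" for x
      using False down unfolding bdd_above_def by (metis less_imp_le not_le)
    have "(\<lambda>n. prob {\<omega> \<in> space M. R \<omega> < real n}) \<longlonglongrightarrow> prob (\<Union>n. {\<omega> \<in> space M. R \<omega> < real n})"
      by (intro finite_Lim_measure_incseq) (auto simp: incseq_def)
    moreover have "(\<Union>n. {\<omega> \<in> space M. R \<omega> < real n}) = space M"
      using reals_Archimedean2 by auto
    moreover have "prob {\<omega> \<in> space M. R \<omega> < real n} \<le> \<delta>" for n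
      by (rule approx) (rule all)
    ultimately have "prob (space M) \<le> \<delta>" by (metis (no_types, lifting) LIMSEQ_le_const2)
    then show ?thesis
      using finite_measure_mono[of "{\<omega> \<in> space M. R \<omega> \<in> S}" "space M"] by auto
  qed
  then show ?thesis by (simp add: S_def G_def)
qed

text \<open>\<open>Arg\<close> is continuous off the non-positive real axis, and on that axis it is
  constantly \<open>pi\<close> except for the value 0 at the origin.\<close>

lemma Arg_measurable [measurable]: "Arg \<in> borel_measurable borel"
proof -
  define A where "A z = (if z \<in> \<real>\<^sub>\<le>\<^sub>0 then pi else Arg z)" for z
  have [measurable]: "A \<in> borel_measurable borel"
    unfolding A_def
    by (rule borel_measurable_continuous_on_if)
      (auto intro!: continuous_intros continuous_at_imp_continuous_on continuous_at_Arg)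
  have eq: "Arg z = (if z = 0 then 0 else A z)" for z
  proof (cases "z = 0")
    case False
    then have "Im z = 0 \<Longrightarrow> Re z \<noteq> 0" by (auto simp: complex_eq_iff)
    then show ?thesis
      using Arg_eq_pi[of z] False by (auto simp: A_def complex_nonpos_Reals_iff order_le_less)
  qed (simp add: Arg_zero)
  have "(\<lambda>z. if z = 0 then 0 else A z) \<in> borel_measurable borel" by measurable
  then show ?thesis unfolding eq[symmetric] .
qed

lemma lift_near_measurable [measurable]: "lift_near \<eta> z \<in> borel_measurable borel"
  unfolding lift_near_def by measurable

section \<open>The middle of the landing law\<close>

context tiled_walk_limit
begin

text \<open>\<open>close\<close> keeps the landing point off the branch cut opposite
  \<open>z\<close>, so the lifted angles converge as real numbers. The vanishing widths then carry
  the whole arcs along.\<close>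

lemma settlesI:
  assumes r: "0 < r" "8 * r \<le> \<eta>" and nr: "\<And>k. near z r (\<omega> k)"
    and adj: "\<And>k. adj ends (\<omega> k) (\<omega> (Suc k))" and y: "(\<lambda>k. y (\<omega> k)) \<longlonglongrightarrow> 1"
    and reg: "\<omega> \<in> regular" and close: "\<bar>lift_near \<eta> z (tl \<omega>) - z\<bar> < \<eta> / 2"
  shows "settles z r \<omega> (lift_near \<eta> z (tl \<omega>))"
proof -
  let ?\<xi> = "lift_near \<eta> z (tl \<omega>)"
  define x where "x k = lift_near \<eta> z (C (\<omega> k))" for k
  have lims: "(\<lambda>k. C (\<omega> k)) \<longlonglongrightarrow> tl \<omega>" "(\<lambda>k. width (\<omega> k)) \<longlonglongrightarrow> 0"
    using reg by (auto simp: regular_def)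
  have "tl \<omega> / circ_pt \<eta> z \<noteq> 0" using norm_tl[OF reg] by auto
  have "Arg (tl \<omega> / circ_pt \<eta> z) \<noteq> pi"
  proof
    assume "Arg (tl \<omega> / circ_pt \<eta> z) = pi"
    then have "?\<xi> - z = \<eta> / 2" by (simp add: lift_near_def)
    then show False using close eta_pos by linarith
  qed
  then have "tl \<omega> / circ_pt \<eta> z \<notin> \<real>\<^sub>\<le>\<^sub>0"
    using \<open>tl \<omega> / circ_pt \<eta> z \<noteq> 0\<close> Arg_eq_pi[of "tl \<omega> / circ_pt \<eta> z"]
    by (auto simp: complex_nonpos_Reals_iff complex_eq_iff)
  then have "isCont Arg (tl \<omega> / circ_pt \<eta> z)" by (rule continuous_at_Arg)
  moreover have "(\<lambda>k. C (\<omega> k) / circ_pt \<eta> z) \<longlonglongrightarrow> tl \<omega> / circ_pt \<eta> z"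
    by (intro tendsto_intros lims) simp
  ultimately have A: "(\<lambda>k. Arg (C (\<omega> k) / circ_pt \<eta> z)) \<longlonglongrightarrow> Arg (tl \<omega> / circ_pt \<eta> z)"
    by (rule isCont_tendsto_compose)
  have x: "x \<longlonglongrightarrow> ?\<xi>"
    unfolding x_def lift_near_def
    by (rule tendsto_add[OF tendsto_const tendsto_divide[OF tendsto_mult[OF tendsto_const A] tendsto_const]]) simp
  have "eventually (\<lambda>k. ?\<xi> - \<epsilon> \<le> lf z (\<omega> k) \<and> rt z (\<omega> k) \<le> ?\<xi> + \<epsilon>) sequentially" if \<epsilon>: "0 < \<epsilon>" for \<epsilon>
  proof -
    have "0 < min (\<epsilon> / 2) (\<eta> / 2 - \<bar>?\<xi> - z\<bar>)" using \<epsilon> close by simp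
    then have "eventually (\<lambda>k. dist (x k) ?\<xi> < min (\<epsilon> / 2) (\<eta> / 2 - \<bar>?\<xi> - z\<bar>)) sequentially"
      using x by (rule tendstoD[rotated])
    moreover have "eventually (\<lambda>k. width (\<omega> k) < \<epsilon> / 2) sequentially"
      using lims(2) \<epsilon> by (intro order_tendstoD) auto
    ultimately show ?thesis
    proof eventually_elim
      case (elim k)
      have d: "\<bar>x k - ?\<xi>\<bar> < \<epsilon> / 2" "\<bar>x k - ?\<xi>\<bar> < \<eta> / 2 - \<bar>?\<xi> - z\<bar>"
        using elim(1) by (auto simp: dist_real_def)
      have "x k \<in> window z" using d(2) unfolding window_def by auto
      moreover have "x k \<in> V (\<omega> k)" unfolding x_def by (rule lift_in_V)
      ultimately have "x k \<in> {lf z (\<omega> k)..rt z (\<omega> k)}" using near_interval(5)[OF r nr] by blast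
      then have "lf z (\<omega> k) \<le> x k" "x k \<le> rt z (\<omega> k)" by auto
      then show ?case
        using near_interval(4)[OF r nr, of k] elim(2) d(1) unfolding abs_less_iff by linarith
    qed
  qed
  then show ?thesis using nr adj y by (simp add: settles_def)
qed

lemma atomless_lift: "measure (P v) {\<omega>. lift_near \<eta> z (tl \<omega>) = x} = 0"
proof -
  have "{\<omega> \<in> space walk_space. lift_near \<eta> z (tl \<omega>) = x} \<in> sets walk_space" by measurable
  then have m: "{\<omega>. lift_near \<eta> z (tl \<omega>) = x} \<in> sets (P v)" by simp
  have "AE \<omega> in P v. \<omega> \<notin> lands (circ_pt \<eta> x)"
    using no_atom[of v "circ_pt \<eta> x"] by (simp add: PS.prob_eq_0)
  with AE_regular[of v] have "AE \<omega> in P v. \<omega> \<notin> {\<omega>. lift_near \<eta> z (tl \<omega>) = x}"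
  proof eventually_elim
    case (elim \<omega>)
    then show ?case using circ_pt_lift[OF eta_pos norm_tl[OF elim(1)], of z] by (auto simp: lands_def)
  qed
  then show ?thesis using m by (simp add: PS.prob_eq_0)
qed

definition below :: "'v \<Rightarrow> real \<Rightarrow> real" where
  "below v x = measure (P v) {\<omega>. lift_near \<eta> (\<theta> v) (tl \<omega>) < x}"

definition beyond :: "'v \<Rightarrow> real \<Rightarrow> real" where
  "beyond v x = measure (P v) {\<omega>. x < lift_near \<eta> (\<theta> v) (tl \<omega>)}"

lemma half_measurable [measurable]:
  "{\<omega>. lift_near \<eta> z (tl \<omega>) < x} \<in> sets walk_space"
  "{\<omega>. x < lift_near \<eta> z (tl \<omega>)} \<in> sets walk_space"
proof -
  have "{\<omega> \<in> space walk_space. lift_near \<eta> z (tl \<omega>) < x} \<in> sets walk_space"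
    "{\<omega> \<in> space walk_space. x < lift_near \<eta> z (tl \<omega>)} \<in> sets walk_space" by measurable
  then show "{\<omega>. lift_near \<eta> z (tl \<omega>) < x} \<in> sets walk_space"
    "{\<omega>. x < lift_near \<eta> z (tl \<omega>)} \<in> sets walk_space" by auto
qed

lemma below_measurable [measurable]: "below v \<in> borel_measurable borel"
  by (rule borel_measurable_mono)
    (auto simp: below_def intro!: monoI PS.finite_measure_mono)

lemma beyond_measurable [measurable]: "beyond v \<in> borel_measurable borel"
proof -
  have "mono (\<lambda>x. - beyond v x)"
    by (auto simp: beyond_def intro!: monoI PS.finite_measure_mono)
  then have "(\<lambda>x. - beyond v x) \<in> borel_measurable borel" by (rule borel_measurable_mono)
  then have "(\<lambda>x. - (- beyond v x)) \<in> borel_measurable borel" by measurable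
  then show ?thesis by simp
qed

text \<open>The points that have landing mass at least \<open>\<delta>\<close> on either side, as
  seen from \<open>v\<close>, when the circle is cut open opposite
  \<open>\<theta> v\<close>.\<close>

definition middle :: "real \<Rightarrow> 'v \<Rightarrow> complex set" where
  "middle \<delta> v = {\<zeta>. \<delta> \<le> below v (lift_near \<eta> (\<theta> v) \<zeta>) \<and> \<delta> \<le> beyond v (lift_near \<eta> (\<theta> v) \<zeta>)}"

lemma middle_measurable [measurable]: "middle \<delta> v \<in> sets borel"
proof -
  have "{\<zeta> \<in> space borel. \<delta> \<le> below v (lift_near \<eta> (\<theta> v) \<zeta>) \<and> \<delta> \<le> beyond v (lift_near \<eta> (\<theta> v) \<zeta>)} \<in> sets borel"
    by measurable
  then show ?thesis by (simp add: middle_def)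
qed

lemma tl_vimage [measurable]: "A \<in> sets borel \<Longrightarrow> {\<omega>. tl \<omega> \<in> A} \<in> sets walk_space"
  using measurable_sets[OF tl_measurable, of A] by (simp add: vimage_def)

text \<open>\<open>quantile_bound\<close> for the lifted landing point and for its negative; here
  the absence of atoms enters.\<close>

lemma not_middle:
  assumes "0 < \<delta>"
  shows "measure (P v) {\<omega>. tl \<omega> \<notin> middle \<delta> v} \<le> 2 * \<delta>"
proof -
  define R where "R \<omega> = lift_near \<eta> (\<theta> v) (tl \<omega>)" for \<omega>
  have R [measurable]: "R \<in> borel_measurable walk_space" unfolding R_def by measurable
  have 1: "measure (P v) {\<omega>. measure (P v) {\<omega>'. R \<omega>' < R \<omega>} < \<delta>} \<le> \<delta>"
    using PS.quantile_bound[of R v \<delta>] atomless_lift assms by (simp add: measurable_P_eq R_def)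
  have 2: "measure (P v) {\<omega>. measure (P v) {\<omega>'. - R \<omega>' < - R \<omega>} < \<delta>} \<le> \<delta>"
    using PS.quantile_bound[of "\<lambda>\<omega>. - R \<omega>" v \<delta>] atomless_lift[of v "\<theta> v"] assms
    by (simp add: measurable_P_eq R_def minus_equation_iff[of _ "_ :: real"] eq_commute[of "- _" "_ :: real"])
  have m: "{\<omega>. below v (R \<omega>) < \<delta>} \<in> sets (P v)" "{\<omega>. beyond v (R \<omega>) < \<delta>} \<in> sets (P v)"
  proof -
    have "{\<omega> \<in> space walk_space. below v (R \<omega>) < \<delta>} \<in> sets walk_space"
      "{\<omega> \<in> space walk_space. beyond v (R \<omega>) < \<delta>} \<in> sets walk_space" by measurable
    then show "{\<omega>. below v (R \<omega>) < \<delta>} \<in> sets (P v)" "{\<omega>. beyond v (R \<omega>) < \<delta>} \<in> sets (P v)" by auto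
  qed
  have "{\<omega>. tl \<omega> \<notin> middle \<delta> v} = {\<omega>. below v (R \<omega>) < \<delta>} \<union> {\<omega>. beyond v (R \<omega>) < \<delta>}"
    by (auto simp: middle_def R_def)
  then have "measure (P v) {\<omega>. tl \<omega> \<notin> middle \<delta> v} \<le>
      measure (P v) {\<omega>. below v (R \<omega>) < \<delta>} + measure (P v) {\<omega>. beyond v (R \<omega>) < \<delta>}"
    using measure_Un_le[OF m] by simp
  also have "\<dots> \<le> \<delta> + \<delta>"
    using 1 2 by (intro add_mono) (simp_all add: below_def beyond_def R_def)
  finally show ?thesis by simp
qed

text \<open>A counterpart of \<open>AE_tail_of_measure\<close>, by dominated convergence.\<close>

lemma avgn_measure_tendsto_0:
  assumes B [measurable]: "B \<in> sets walk_space"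
    and ev: "AE \<omega> in P v. eventually (\<lambda>n. shift n \<omega> \<notin> B) sequentially"
  shows "(\<lambda>n. avgn n (\<lambda>w. measure (P w) B) v) \<longlonglongrightarrow> 0"
proof -
  have "(\<lambda>n. \<integral>\<omega>. indicator B (shift n \<omega>) \<partial>P v) \<longlonglongrightarrow> (\<integral>\<omega>. 0 \<partial>P v :: real)"
  proof (rule integral_dominated_convergence[where w = "\<lambda>_. 1"])
    show "AE \<omega> in P v. (\<lambda>n. indicator B (shift n \<omega>) :: real) \<longlonglongrightarrow> 0"
      using ev
    proof eventually_elim
      case (elim \<omega>)
      then have "eventually (\<lambda>n. indicator B (shift n \<omega>) = (0 :: real)) sequentially"
        by (rule eventually_mono) simp
      then show ?case by (rule tendsto_eventually)
    qed
  qed (auto simp: measurable_P_eq indicator_def)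
  moreover have "(\<integral>\<omega>. indicator B (shift n \<omega>) \<partial>P v) = avgn n (\<lambda>w. measure (P w) B) v" for n
    by (subst expectation_shift[where C = 1]) (auto simp: indicator_def)
  ultimately show ?thesis by simp
qed

end

section \<open>Harmonic limits as functions of the landing point\<close>

locale tiled_walk_harmonic = tiled_walk_limit ends c P \<rho> pos \<gamma> a \<theta>
  for ends :: "'e \<Rightarrow> 'v \<times> 'v" and c :: "'e \<Rightarrow> real" and P :: "'v \<Rightarrow> (nat \<Rightarrow> 'v) measure" and \<rho> :: 'v
    and pos :: "'v \<Rightarrow> complex" and \<gamma> :: "'e \<Rightarrow> real \<Rightarrow> complex" and a :: "'e \<Rightarrow> real"
    and \<theta> :: "'v \<Rightarrow> real" +
  fixes h :: "'v \<Rightarrow> real" and K :: real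
  assumes h_harmonic: "\<And>w. h w = avg h w" and h_bdd: "\<And>w. \<bar>h w\<bar> \<le> K"
begin

definition hlim :: "(nat \<Rightarrow> 'v) \<Rightarrow> real" where "hlim \<omega> = lim (\<lambda>n. h (\<omega> n))"

lemma hlim_measurable [measurable]: "hlim \<in> borel_measurable walk_space"
  unfolding hlim_def by measurable

text \<open>Failing this has vanishing probability from late positions of the walk
  (\<open>avgn_untame\<close>). The level \<open>s = - 1\<close> switches the height condition off,
  \<open>y\<close> being non-negative.\<close>

definition tame :: "real \<Rightarrow> real \<Rightarrow> (nat \<Rightarrow> 'v) set" where
  "tame \<epsilon> s = {\<omega>. \<forall>k. dist (C (\<omega> k)) (C (\<omega> 0)) \<le> \<epsilon> \<and> \<bar>h (\<omega> k) - h (\<omega> 0)\<bar> \<le> \<epsilon> \<and>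
     width (\<omega> k) \<le> \<epsilon> \<and> s < y (\<omega> k)}"

lemma tame_measurable [measurable]: "tame \<epsilon> s \<in> sets walk_space" "- tame \<epsilon> s \<in> sets walk_space"
proof -
  have "{\<omega> \<in> space (walk_space :: (nat \<Rightarrow> 'v) measure). \<forall>k. dist (C (\<omega> k)) (C (\<omega> 0)) \<le> \<epsilon> \<and>
      \<bar>h (\<omega> k) - h (\<omega> 0)\<bar> \<le> \<epsilon> \<and> width (\<omega> k) \<le> \<epsilon> \<and> s < y (\<omega> k)} \<in> sets walk_space"
    by measurable
  then show 1: "tame \<epsilon> s \<in> sets walk_space" by (simp add: tame_def)
  show "- tame \<epsilon> s \<in> sets walk_space" using sets.compl_sets[OF 1] by (simp add: Compl_eq_Diff_UNIV)
qed

definition typical :: "(nat \<Rightarrow> 'v) \<Rightarrow> bool" where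
  "typical \<omega> \<longleftrightarrow> \<omega> \<in> regular \<and> (\<lambda>n. h (\<omega> n)) \<longlonglongrightarrow> hlim \<omega> \<and> (\<lambda>n. y (\<omega> n)) \<longlonglongrightarrow> 1 \<and>
     (\<forall>n. adj ends (\<omega> n) (\<omega> (Suc n)))"

lemma AE_typical: "AE \<omega> in P v. typical \<omega>"
  using AE_regular[of v] harmonic_converges[OF h_harmonic h_bdd, of v] y_tendsto_1[of v] AE_adj[of v]
  by eventually_elim (simp add: typical_def hlim_def convergent_LIMSEQ_iff)

lemma typical_tame:
  assumes \<omega>: "typical \<omega>" and \<epsilon>: "0 < \<epsilon>" "s < 1"
  shows "eventually (\<lambda>n. shift n \<omega> \<notin> - tame \<epsilon> s) sequentially"
proof -
  have lims: "(\<lambda>n. C (\<omega> n)) \<longlonglongrightarrow> tl \<omega>" "(\<lambda>n. width (\<omega> n)) \<longlonglongrightarrow> 0"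
    "(\<lambda>n. h (\<omega> n)) \<longlonglongrightarrow> hlim \<omega>" "(\<lambda>n. y (\<omega> n)) \<longlonglongrightarrow> 1"
    using \<omega> by (auto simp: typical_def regular_def)
  have \<epsilon>2: "0 < \<epsilon> / 2" using \<epsilon> by simp
  have "eventually (\<lambda>n. dist (C (\<omega> n)) (tl \<omega>) < \<epsilon> / 2 \<and> dist (h (\<omega> n)) (hlim \<omega>) < \<epsilon> / 2 \<and>
      width (\<omega> n) < \<epsilon> \<and> s < y (\<omega> n)) sequentially"
    by (intro eventually_conj tendstoD[OF lims(1) \<epsilon>2] tendstoD[OF lims(3) \<epsilon>2]
      order_tendstoD(2)[OF lims(2) \<epsilon>(1)] order_tendstoD(1)[OF lims(4) \<epsilon>(2)])
  then obtain N where N: "\<And>n. n \<ge> N \<Longrightarrow> dist (C (\<omega> n)) (tl \<omega>) < \<epsilon> / 2 \<and> dist (h (\<omega> n)) (hlim \<omega>) < \<epsilon> / 2 \<and>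
      width (\<omega> n) < \<epsilon> \<and> s < y (\<omega> n)"
    unfolding eventually_sequentially by blast
  have "shift n \<omega> \<in> tame \<epsilon> s" if "n \<ge> N" for n
    unfolding tame_def mem_Collect_eq
  proof
    fix k
    have a: "n + k \<ge> N" "n + 0 \<ge> N" using that by auto
    have "dist (C (\<omega> (n + k))) (C (\<omega> (n + 0))) < \<epsilon>"
      using dist_triangle2[of "C (\<omega> (n + k))" "C (\<omega> (n + 0))" "tl \<omega>"] N[OF a(1)] N[OF a(2)] by linarith
    moreover have "dist (h (\<omega> (n + k))) (h (\<omega> (n + 0))) < \<epsilon>"
      using dist_triangle2[of "h (\<omega> (n + k))" "h (\<omega> (n + 0))" "hlim \<omega>"] N[OF a(1)] N[OF a(2)] by linarith
    ultimately show "dist (C (shift n \<omega> k)) (C (shift n \<omega> 0)) \<le> \<epsilon> \<and> \<bar>h (shift n \<omega> k) - h (shift n \<omega> 0)\<bar> \<le> \<epsilon> \<and>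
        width (shift n \<omega> k) \<le> \<epsilon> \<and> s < y (shift n \<omega> k)"
      using N[OF a(1)] by (simp add: dist_real_def)
  qed
  then show ?thesis unfolding eventually_sequentially by blast
qed

lemma avgn_untame:
  assumes "0 < \<epsilon>" "s < 1"
  shows "(\<lambda>n. avgn n (\<lambda>w. measure (P w) (- tame \<epsilon> s)) v) \<longlonglongrightarrow> 0"
proof (rule avgn_measure_tendsto_0[OF tame_measurable(2)])
  show "AE \<omega> in P v. eventually (\<lambda>n. shift n \<omega> \<notin> - tame \<epsilon> s) sequentially"
    using AE_typical[of v] by eventually_elim (rule typical_tame[OF _ assms])
qed

text \<open>An event of probability at least \<open>\<delta>\<close> cannot be swallowed by the
  untame walks, which have less. This turns landing probabilities into single walks to which
  \<open>crossing\<close> applies.\<close>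

lemma exists_walk:
  assumes far: "measure (P v) (- tame \<epsilon> s) < \<delta>" and E: "E \<in> sets walk_space" "\<delta> \<le> measure (P v) E"
  shows "\<exists>\<omega>. typical \<omega> \<and> \<omega> \<in> tame \<epsilon> s \<and> \<omega> \<in> E \<and> \<omega> 0 = v"
proof (rule ccontr)
  assume none: "\<not> ?thesis"
  have "AE \<omega> in P v. \<omega> \<in> E \<longrightarrow> \<omega> \<in> - tame \<epsilon> s"
    using AE_typical[of v] AE_starts[of v] by eventually_elim (use none in blast)
  then have "measure (P v) E \<le> measure (P v) (- tame \<epsilon> s)"
    using tame_measurable(2) by (intro PS.finite_measure_mono_AE) auto
  then show False using far E(2) by simp
qed

lemma dist_tl_le:
  assumes "\<omega> \<in> regular" "\<omega> \<in> tame \<epsilon> s"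
  shows "dist (tl \<omega>) (C (\<omega> 0)) \<le> \<epsilon>"
proof (rule LIMSEQ_le_const2)
  show "(\<lambda>n. dist (C (\<omega> n)) (C (\<omega> 0))) \<longlonglongrightarrow> dist (tl \<omega>) (C (\<omega> 0))"
    using assms(1) by (intro tendsto_dist tendsto_const) (simp add: regular_def)
qed (use assms(2) in \<open>auto simp: tame_def\<close>)

text \<open>The walk \<open>X\<close> lands strictly between the landing points of two walks that start at \<open>v\<close>
  and stay high up, so it visits a vertex of one of them; along all three walks \<open>h\<close> is nearly
  constant.\<close>

lemma hlim_close:
  assumes \<kappa>: "0 < \<kappa>"
  obtains \<epsilon> where "0 < \<epsilon>" "\<And>s X \<delta> v. typical X \<Longrightarrow> X \<in> tame \<epsilon> (- 1) \<Longrightarrow> y (X 0) < s \<Longrightarrow>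
    measure (P v) (- tame \<epsilon> s) < \<delta> \<Longrightarrow> tl X \<in> middle \<delta> v \<Longrightarrow> \<bar>hlim X - h v\<bar> \<le> \<kappa>"
proof -
  define r where "r = \<eta> / 8"
  have r: "0 < r" "8 * r \<le> \<eta>" using eta_pos by (auto simp: r_def)
  obtain \<delta>1 where \<delta>1: "\<delta>1 > 0" "\<And>z v. dist (C v) (circ_pt \<eta> z) < \<delta>1 \<Longrightarrow> width v \<le> r \<Longrightarrow> near z r v"
    using near_if_close[OF r(1)] by blast
  \<comment> \<open>The first bound keeps lifts off the branch cut. The second, through the
    Lipschitz constant \<open>2 * pi / \<eta>\<close>, turns a lift within \<open>r'\<close> of
    \<open>\<theta> v\<close> into a distance of at most \<open>\<delta>1 / 4\<close> on the
    circle.\<close>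
  define r' where "r' = min (\<eta> / 4) (\<eta> * \<delta>1 / (8 * pi))"
  have r': "0 < r'" "r' < \<eta> / 2" "2 * pi / \<eta> * r' \<le> \<delta>1 / 4"
  proof -
    show "0 < r'" "r' < \<eta> / 2" using eta_pos \<delta>1(1) by (auto simp: r'_def min_less_iff_disj)
    have "2 * pi / \<eta> * r' \<le> 2 * pi / \<eta> * (\<eta> * \<delta>1 / (8 * pi))"
      using eta_pos by (intro mult_left_mono) (auto simp: r'_def)
    also have "\<dots> = \<delta>1 / 4" using eta_pos by (simp add: field_simps)
    finally show "2 * pi / \<eta> * r' \<le> \<delta>1 / 4" .
  qed
  obtain \<delta>2 where \<delta>2: "\<delta>2 > 0" "\<And>z \<zeta>. dist \<zeta> (circ_pt \<eta> z) < \<delta>2 \<Longrightarrow> \<bar>lift_near \<eta> z \<zeta> - z\<bar> < r'"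
    using lift_near_close[OF eta_pos r'(1)] by blast
  \<comment> \<open>\<open>\<kappa> / 3\<close> because three oscillations add up: two along
    \<open>X\<close>, from its start to its limit and to the common vertex, and one along the other
    walk.\<close>
  define \<epsilon> where "\<epsilon> = min (\<kappa> / 3) (min r (min (\<delta>1 / 8) (\<delta>2 / 2)))"
  have \<epsilon>: "0 < \<epsilon>" "3 * \<epsilon> \<le> \<kappa>" "\<epsilon> \<le> r" "8 * \<epsilon> \<le> \<delta>1" "2 * \<epsilon> \<le> \<delta>2"
    using \<kappa> r \<delta>1(1) \<delta>2(1) by (auto simp: \<epsilon>_def)
  show ?thesis
  proof (rule that[OF \<epsilon>(1)])
    fix s X \<delta> v
    assume X: "typical X" "X \<in> tame \<epsilon> (- 1)" "y (X 0) < s"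
      and far: "measure (P v) (- tame \<epsilon> s) < \<delta>" and midd: "tl X \<in> middle \<delta> v"
    let ?z = "\<theta> v"
    let ?L = "\<lambda>\<omega>. lift_near \<eta> ?z (tl \<omega>)"
    have walk: "settles ?z r Z (?L Z) \<and> \<bar>?L Z - ?z\<bar> < r'"
      if Z: "typical Z" "Z \<in> tame \<epsilon> s" "Z 0 = v" for Z
    proof -
      have reg: "Z \<in> regular" using Z by (simp add: typical_def)
      have nr: "near ?z r (Z k)" for k
      proof (rule \<delta>1(2))
        have "dist (C (Z k)) (circ_pt \<eta> ?z) \<le> \<epsilon>" "width (Z k) \<le> \<epsilon>"
          using Z(2,3) by (auto simp: tame_def)
        then show "dist (C (Z k)) (circ_pt \<eta> ?z) < \<delta>1" "width (Z k) \<le> r"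
          using \<delta>1(1) \<epsilon> by linarith+
      qed
      have "dist (tl Z) (circ_pt \<eta> ?z) \<le> \<epsilon>" using dist_tl_le[OF reg Z(2)] Z(3) by simp
      then have close: "\<bar>?L Z - ?z\<bar> < r'" using \<delta>2(1) \<epsilon> by (intro \<delta>2(2)) auto
      have "settles ?z r Z (?L Z)"
        by (rule settlesI[OF r nr _ _ reg]) (use Z(1) close r'(2) in \<open>auto simp: typical_def\<close>)
      then show ?thesis using close by simp
    qed
    have b: "\<delta> \<le> measure (P v) {\<omega>. ?L \<omega> < ?L X}" "\<delta> \<le> measure (P v) {\<omega>. ?L X < ?L \<omega>}"
      using midd by (auto simp: middle_def below_def beyond_def)
    obtain Z' where Z': "typical Z'" "Z' \<in> tame \<epsilon> s" "?L Z' < ?L X" "Z' 0 = v"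
      using exists_walk[OF far half_measurable(1) b(1)] by blast
    obtain Z where Z: "typical Z" "Z \<in> tame \<epsilon> s" "?L X < ?L Z" "Z 0 = v"
      using exists_walk[OF far half_measurable(2) b(2)] by blast
    \<comment> \<open>That \<open>X\<close> is near \<open>v\<close> at all follows from its landing
      point lying between those of \<open>Z'\<close> and \<open>Z\<close>, which are close to
      \<open>\<theta> v\<close>.\<close>
    have xc: "\<bar>?L X - ?z\<bar> < r'"
      using walk[OF Z(1,2,4)] walk[OF Z'(1,2,4)] Z(3) Z'(3) by auto
    have regX: "X \<in> regular" using X by (simp add: typical_def)
    have "dist (tl X) (circ_pt \<eta> ?z) \<le> 2 * pi / \<eta> * \<bar>?L X - ?z\<bar>"
      using circ_pt_lipschitz[OF eta_pos, of "?L X" ?z] circ_pt_lift[OF eta_pos norm_tl[OF regX]] by simp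
    also have "\<dots> \<le> 2 * pi / \<eta> * r'" using xc eta_pos by (intro mult_left_mono) auto
    also have "\<dots> \<le> \<delta>1 / 4" by (rule r')
    finally have tlX: "dist (tl X) (circ_pt \<eta> ?z) \<le> \<delta>1 / 4" .
    have nrX: "near ?z r (X k)" for k
    proof (rule \<delta>1(2))
      have 1: "dist (C (X k)) (C (X 0)) \<le> \<epsilon>" "width (X k) \<le> \<epsilon>" using X(2) by (auto simp: tame_def)
      have 2: "dist (tl X) (C (X 0)) \<le> \<epsilon>" by (rule dist_tl_le[OF regX X(2)])
      have "dist (C (X k)) (circ_pt \<eta> ?z) \<le> dist (C (X k)) (tl X) + dist (tl X) (circ_pt \<eta> ?z)"
        by (rule dist_triangle)
      moreover have "dist (C (X k)) (tl X) \<le> dist (C (X k)) (C (X 0)) + dist (tl X) (C (X 0))"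
        by (rule dist_triangle2)
      ultimately show "dist (C (X k)) (circ_pt \<eta> ?z) < \<delta>1" "width (X k) \<le> r"
        using tlX \<epsilon> \<delta>1(1) 1 2 by linarith+
    qed
    have sX: "settles ?z r X (?L X)"
      by (rule settlesI[OF r nrX _ _ regX]) (use X(1) xc r'(2) in \<open>auto simp: typical_def\<close>)
    have "\<exists>i j. X i = Z j \<or> X i = Z' j"
    proof (rule crossing[OF r sX])
      show "y (X 0) < y (Z k)" "y (X 0) < y (Z' k)" for k
        using X(3) Z(2) Z'(2) by (auto simp: tame_def intro: less_trans)
    qed (use walk[OF Z(1,2,4)] walk[OF Z'(1,2,4)] Z(3,4) Z'(3,4) in auto)
    then obtain i j where "X i = Z j \<or> X i = Z' j" by blast
    moreover have "\<bar>h (Z j) - h v\<bar> \<le> \<epsilon>" "\<bar>h (Z' j) - h v\<bar> \<le> \<epsilon>"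
      using Z(2,4) Z'(2,4) by (auto simp: tame_def)
    ultimately have i: "\<bar>h (X i) - h v\<bar> \<le> \<epsilon>" by auto
    have "\<bar>hlim X - h (X 0)\<bar> \<le> \<epsilon>"
    proof (rule LIMSEQ_le_const2)
      show "(\<lambda>n. \<bar>h (X n) - h (X 0)\<bar>) \<longlonglongrightarrow> \<bar>hlim X - h (X 0)\<bar>"
        using X(1) by (intro tendsto_intros) (simp add: typical_def)
    qed (use X(2) in \<open>auto simp: tame_def\<close>)
    moreover have "\<bar>h (X i) - h (X 0)\<bar> \<le> \<epsilon>" using X(2) by (simp add: tame_def)
    ultimately show "\<bar>hlim X - h v\<bar> \<le> \<kappa>" using i \<epsilon>(2) unfolding abs_le_iff by linarith
  qed
qed

text \<open>Four exceptional events of probability at most \<open>\<kappa> / 4\<close> each. The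
  time \<open>m\<close> comes first, then a level \<open>s\<close> that the walk at time
  \<open>m\<close> is unlikely to have reached, then a time \<open>n\<close> at which the walk is
  likely to sit at a vertex from which few walks are untame with respect to
  \<open>s\<close>.\<close>

lemma approximation:
  assumes \<kappa>: "0 < \<kappa>"
  shows "\<exists>f :: complex \<Rightarrow> real. f \<in> borel_measurable borel \<and>
    measure (P \<rho>) {\<omega>. \<kappa> < \<bar>hlim \<omega> - f (tl \<omega>)\<bar>} \<le> \<kappa>"
proof -
  obtain \<epsilon> where \<epsilon>: "0 < \<epsilon>" "\<And>s X \<delta> v. typical X \<Longrightarrow> X \<in> tame \<epsilon> (- 1) \<Longrightarrow> y (X 0) < s \<Longrightarrow>
    measure (P v) (- tame \<epsilon> s) < \<delta> \<Longrightarrow> tl X \<in> middle \<delta> v \<Longrightarrow> \<bar>hlim X - h v\<bar> \<le> \<kappa>"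
    using hlim_close[OF \<kappa>] by metis
  have "eventually (\<lambda>m. avgn m (\<lambda>w. measure (P w) (- tame \<epsilon> (- 1))) \<rho> < \<kappa> / 4) sequentially"
    using avgn_untame[OF \<epsilon>(1), of "-1" \<rho>] \<kappa> by (intro order_tendstoD) auto
  then obtain m where m: "avgn m (\<lambda>w. measure (P w) (- tame \<epsilon> (- 1))) \<rho> < \<kappa> / 4"
    by (auto simp: eventually_sequentially)
  define B1 where "B1 = {\<omega>. shift m \<omega> \<in> - tame \<epsilon> (- 1)}"
  have B1: "B1 \<in> sets walk_space" "measure (P \<rho>) B1 \<le> \<kappa> / 4"
  proof -
    have "shift m -` (- tame \<epsilon> (- 1)) \<inter> space walk_space \<in> sets walk_space"
      by (rule measurable_sets[OF shift_measurable tame_measurable(2)])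
    moreover have "B1 = shift m -` (- tame \<epsilon> (- 1)) \<inter> space walk_space"
      unfolding B1_def vimage_def by auto
    ultimately show "B1 \<in> sets walk_space" by simp
    show "measure (P \<rho>) B1 \<le> \<kappa> / 4"
      unfolding B1_def measure_shift[OF tame_measurable(2)] using m by simp
  qed
  \<comment> \<open>Heights at the fixed time \<open>m\<close> are below 1, so some level below 1
    exceeds them with high probability.\<close>
  define S where "S j = {\<omega> :: nat \<Rightarrow> 'v. 1 - 1 / real (Suc j) \<le> y (\<omega> m)}" for j
  have S: "S j \<in> sets walk_space" for j
    using pred_coord[of "\<lambda>w. 1 - 1 / real (Suc j) \<le> y w" m] by (simp add: S_def pred_def)
  have "(\<lambda>j. measure (P \<rho>) (S j)) \<longlonglongrightarrow> measure (P \<rho>) (\<Inter>j. S j)"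
  proof (rule PS.finite_Lim_measure_decseq)
    have "1 / real (Suc n) \<le> 1 / real (Suc k)" if "k \<le> n" for k n
      using that by (intro divide_left_mono) auto
    then show "decseq S" unfolding decseq_def S_def by (smt (verit) Collect_mono_iff)
  qed (use S in auto)
  moreover have "(\<Inter>j. S j) = {}"
  proof (rule ccontr)
    assume "(\<Inter>j. S j) \<noteq> {}"
    then obtain \<omega> where \<omega>: "\<And>j. \<omega> \<in> S j" by blast
    have "0 < 1 - y (\<omega> m)" using y_less_1[of "\<omega> m"] by simp
    then obtain j where "1 / real (Suc j) < 1 - y (\<omega> m)" by (metis nat_approx_posE)
    then show False using \<omega>[of j] by (simp add: S_def)
  qed
  ultimately have "(\<lambda>j. measure (P \<rho>) (S j)) \<longlonglongrightarrow> 0" by simp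
  then have "eventually (\<lambda>j. measure (P \<rho>) (S j) < \<kappa> / 4) sequentially"
    using \<kappa> by (intro order_tendstoD) auto
  then obtain j where j: "measure (P \<rho>) (S j) < \<kappa> / 4" by (auto simp: eventually_sequentially)
  define s where "s = 1 - 1 / real (Suc j)"
  have s: "s < 1" by (simp add: s_def)
  \<comment> \<open>The bound \<open>2 * \<delta>\<close> of \<open>not_middle\<close> becomes
    \<open>\<kappa> / 4\<close>.\<close>
  define \<delta> where "\<delta> = \<kappa> / 8"
  have \<delta>: "0 < \<delta>" using \<kappa> by (simp add: \<delta>_def)
  define u where "u w = measure (P w) (- tame \<epsilon> s)" for w
  have "eventually (\<lambda>n. avgn n u \<rho> < \<delta> * (\<kappa> / 4)) sequentially"
    using avgn_untame[OF \<epsilon>(1) s, of \<rho>] \<kappa> \<delta> unfolding u_def by (intro order_tendstoD) auto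
  then obtain n where n: "avgn n u \<rho> < \<delta> * (\<kappa> / 4)" by (auto simp: eventually_sequentially)
  define far where "far w \<longleftrightarrow> u w < \<delta>" for w
  define B2 where "B2 = {\<omega> :: nat \<Rightarrow> 'v. \<not> far (\<omega> n)}"
  have B2: "B2 \<in> sets walk_space" "measure (P \<rho>) B2 \<le> \<kappa> / 4"
  proof -
    have m0: "{\<omega> :: nat \<Rightarrow> 'v. \<not> far (\<omega> k)} \<in> sets walk_space" for k
      using pred_coord[of "\<lambda>w. \<not> far w" k] by (simp add: pred_def)
    then show "B2 \<in> sets walk_space" by (simp add: B2_def)
    have "measure (P \<rho>) B2 = avgn n (\<lambda>w. measure (P w) {\<omega>. \<not> far (\<omega> 0)}) \<rho>"
      using measure_shift[OF m0[of 0], of \<rho> n] by (simp add: B2_def)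
    \<comment> \<open>Markov's inequality for \<open>u\<close> at the position at time
      \<open>n\<close>.\<close>
    also have "\<dots> \<le> avgn n (\<lambda>w. (1 / \<delta>) * u w) \<rho>"
    proof (rule avgn_mono)
      fix w
      have "measure (P w) {\<omega>. \<not> far (\<omega> 0)} = measure (P w) (if far w then {} else UNIV)"
        by (rule measure_start_cong) (use m0 sets.top[of "walk_space :: (nat \<Rightarrow> 'v) measure"] in auto)
      also have "\<dots> \<le> (1 / \<delta>) * u w"
        using \<delta> by (auto simp: far_def not_less u_def field_simps)
      finally show "measure (P w) {\<omega>. \<not> far (\<omega> 0)} \<le> (1 / \<delta>) * u w" .
    qed
    also have "\<dots> = (1 / \<delta>) * avgn n u \<rho>" by (rule avgn_cmult)
    also have "\<dots> \<le> \<kappa> / 4" using n \<delta> by (simp add: field_simps)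
    finally show "measure (P \<rho>) B2 \<le> \<kappa> / 4" .
  qed
  define B3 where "B3 = {\<omega>. tl (shift n \<omega>) \<notin> middle \<delta> (\<omega> n)}"
  have B3: "B3 \<in> sets walk_space" "measure (P \<rho>) B3 \<le> \<kappa> / 4"
  proof -
    define D where "D = {\<omega>. tl \<omega> \<notin> middle \<delta> (\<omega> 0)}"
    have compl: "{\<omega>. tl \<omega> \<notin> middle \<delta> w} \<in> sets walk_space" for w
      using tl_vimage[of "- middle \<delta> w"] by (simp add: borel_comp)
    have "D = (\<Union>w. {\<omega>. \<omega> 0 = w} \<inter> {\<omega>. tl \<omega> \<notin> middle \<delta> w})" by (auto simp: D_def)
    moreover have "{\<omega> :: nat \<Rightarrow> 'v. \<omega> 0 = w} \<in> sets walk_space" for w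
      using pred_coord[of "\<lambda>v. v = w" 0] by (simp add: pred_def)
    ultimately have D: "D \<in> sets walk_space"
      using countable_V compl by (simp only:) (intro sets.countable_UN'' sets.Int)
    have eq: "B3 = {\<omega>. shift n \<omega> \<in> D}" by (simp add: B3_def D_def)
    show "B3 \<in> sets walk_space"
      using measurable_sets[OF shift_measurable D, of n] by (simp add: eq vimage_def)
    have "measure (P w) D \<le> 2 * \<delta>" for w
    proof -
      have "measure (P w) D = measure (P w) {\<omega>. tl \<omega> \<notin> middle \<delta> w}"
        by (rule measure_start_cong[OF D compl]) (simp add: D_def)
      then show ?thesis using not_middle[OF \<delta>, of w] by simp
    qed
    then have "avgn n (\<lambda>w. measure (P w) D) \<rho> \<le> avgn n (\<lambda>_. 2 * \<delta>) \<rho>" by (rule avgn_mono)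
    then show "measure (P \<rho>) B3 \<le> \<kappa> / 4"
      unfolding eq measure_shift[OF D] by (simp add: \<delta>_def)
  qed
  define g where "g i = (from_nat_into UNIV i :: 'v)" for i
  have g: "\<exists>i. g i = v" for v
    unfolding g_def using countable_V from_nat_into_surj by (metis UNIV_I)
  define Q where "Q i \<zeta> \<longleftrightarrow> far (g i) \<and> \<zeta> \<in> middle \<delta> (g i)" for i \<zeta>
  have [measurable]: "Measurable.pred borel (Q i)" for i
    unfolding Q_def by measurable
  \<comment> \<open>Every vertex passing the test \<open>Q\<close> serves in
    \<open>hlim_close\<close>; the position at time \<open>n\<close> only shows that one exists. The
    first in a fixed enumeration makes \<open>f\<close> a Borel function of \<open>\<zeta>\<close>
    alone.\<close>
  define f where "f \<zeta> = h (g (LEAST i. Q i \<zeta>))" for \<zeta>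
  have f: "f \<in> borel_measurable borel" unfolding f_def by measurable
  have good: "\<bar>hlim \<omega> - f (tl \<omega>)\<bar> \<le> \<kappa>"
    if \<omega>: "typical \<omega>" "\<omega> \<notin> B1" "\<omega> \<notin> S j" "\<omega> \<notin> B2" "\<omega> \<notin> B3" for \<omega>
  proof -
    have reg: "\<omega> \<in> regular" using \<omega>(1) by (simp add: typical_def)
    obtain i where "g i = \<omega> n" using g by blast
    then have "Q i (tl \<omega>)" using \<omega>(4,5) tl_shift[OF reg, of n] by (simp add: Q_def B2_def B3_def)
    then have Q: "Q (LEAST i. Q i (tl \<omega>)) (tl \<omega>)" by (rule LeastI)
    define v where "v = g (LEAST i. Q i (tl \<omega>))"
    have v: "far v" "tl \<omega> \<in> middle \<delta> v" using Q by (auto simp: Q_def v_def)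
    have "(\<lambda>n. h (shift m \<omega> n)) \<longlonglongrightarrow> hlim \<omega>"
      unfolding LIMSEQ_shift[of h] using \<omega>(1) by (simp add: typical_def)
    then have hs: "hlim (shift m \<omega>) = hlim \<omega>"
      unfolding hlim_def[of "shift m \<omega>"] by (rule limI)
    have "typical (shift m \<omega>)"
      unfolding typical_def hs LIMSEQ_shift[of h] LIMSEQ_shift[of y] regular_shift
      using \<omega>(1) by (simp add: typical_def)
    moreover have "shift m \<omega> \<in> tame \<epsilon> (- 1)" using \<omega>(2) by (simp add: B1_def)
    moreover have "y (shift m \<omega> 0) < s" using \<omega>(3) by (simp add: S_def s_def)
    moreover have "measure (P v) (- tame \<epsilon> s) < \<delta>" using v(1) by (simp add: far_def u_def)
    moreover have "tl (shift m \<omega>) \<in> middle \<delta> v" using v(2) tl_shift[OF reg, of m] by simp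
    ultimately have "\<bar>hlim (shift m \<omega>) - h v\<bar> \<le> \<kappa>" by (rule \<epsilon>(2))
    then show ?thesis unfolding hs f_def v_def .
  qed
  have "AE \<omega> in P \<rho>. \<omega> \<in> {\<omega>. \<kappa> < \<bar>hlim \<omega> - f (tl \<omega>)\<bar>} \<longrightarrow> \<omega> \<in> ((B1 \<union> S j) \<union> B2) \<union> B3"
    using AE_typical[of \<rho>] by eventually_elim (use good not_less in blast)
  then have "measure (P \<rho>) {\<omega>. \<kappa> < \<bar>hlim \<omega> - f (tl \<omega>)\<bar>} \<le> measure (P \<rho>) (((B1 \<union> S j) \<union> B2) \<union> B3)"
    using B1 B2 B3 S by (intro PS.finite_measure_mono_AE) auto
  also have "\<dots> \<le> measure (P \<rho>) ((B1 \<union> S j) \<union> B2) + measure (P \<rho>) B3"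
    using B1(1) B2(1) B3(1) S by (intro measure_Un_le) auto
  also have "measure (P \<rho>) ((B1 \<union> S j) \<union> B2) \<le> measure (P \<rho>) (B1 \<union> S j) + measure (P \<rho>) B2"
    using B1(1) B2(1) S by (intro measure_Un_le) auto
  also have "measure (P \<rho>) (B1 \<union> S j) \<le> measure (P \<rho>) B1 + measure (P \<rho>) (S j)"
    using B1(1) S by (intro measure_Un_le) auto
  finally have "measure (P \<rho>) {\<omega>. \<kappa> < \<bar>hlim \<omega> - f (tl \<omega>)\<bar>} \<le> \<kappa>"
    using B1(2) B2(2) B3(2) j by simp
  then show ?thesis using f by blast
qed

text \<open>Borel-Cantelli with errors \<open>(1 / 2) ^ j\<close> makes the approximations converge
  to \<open>hlim\<close> almost surely; the limit is cut off at \<open>K\<close> to be bounded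
  everywhere.\<close>

lemma boundary_function:
  "\<exists>f :: complex \<Rightarrow> real. f \<in> borel_measurable borel \<and> (\<forall>\<zeta>. \<bar>f \<zeta>\<bar> \<le> K) \<and> (AE \<omega> in P \<rho>. hlim \<omega> = f (tl \<omega>))"
proof -
  have "\<forall>j. \<exists>f :: complex \<Rightarrow> real. f \<in> borel_measurable borel \<and>
    measure (P \<rho>) {\<omega>. (1 / 2) ^ j < \<bar>hlim \<omega> - f (tl \<omega>)\<bar>} \<le> (1 / 2) ^ j"
    by (intro allI approximation) simp
  then obtain F :: "nat \<Rightarrow> complex \<Rightarrow> real" where F: "\<And>j. F j \<in> borel_measurable borel"
    "\<And>j. measure (P \<rho>) {\<omega>. (1 / 2) ^ j < \<bar>hlim \<omega> - F j (tl \<omega>)\<bar>} \<le> (1 / 2) ^ j"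
    by metis
  note [measurable] = F(1)
  define A where "A j = {\<omega>. (1 / 2) ^ j < \<bar>hlim \<omega> - F j (tl \<omega>)\<bar>}" for j
  have A: "A j \<in> sets (P \<rho>)" for j
  proof -
    have "{\<omega> \<in> space walk_space. (1 / 2) ^ j < \<bar>hlim \<omega> - F j (tl \<omega>)\<bar>} \<in> sets walk_space" by measurable
    then show ?thesis by (simp add: A_def)
  qed
  have "summable (\<lambda>j. measure (P \<rho>) (A j))"
  proof (rule summable_comparison_test')
    show "summable (\<lambda>j. (1 / 2 :: real) ^ j)" by (rule summable_geometric) simp
    show "norm (measure (P \<rho>) (A j)) \<le> (1 / 2) ^ j" for j using F(2)[of j] by (simp add: A_def)
  qed
  then have "AE \<omega> in P \<rho>. eventually (\<lambda>j. \<omega> \<in> space (P \<rho>) - A j) sequentially"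
    using A by (intro borel_cantelli_AE1) (auto simp: PS.emeasure_eq_measure)
  then have lim: "AE \<omega> in P \<rho>. (\<lambda>j. F j (tl \<omega>)) \<longlonglongrightarrow> hlim \<omega>"
  proof eventually_elim
    case (elim \<omega>)
    have "(\<lambda>j. hlim \<omega> - F j (tl \<omega>)) \<longlonglongrightarrow> 0"
    proof (rule Lim_null_comparison)
      show "eventually (\<lambda>j. norm (hlim \<omega> - F j (tl \<omega>)) \<le> (1 / 2) ^ j) sequentially"
        using elim by eventually_elim (simp add: A_def not_less)
      show "(\<lambda>j. (1 / 2 :: real) ^ j) \<longlonglongrightarrow> 0" by (rule LIMSEQ_realpow_zero) auto
    qed
    from tendsto_diff[OF tendsto_const[of "hlim \<omega>"] this] show ?case by simp
  qed
  define f where "f \<zeta> = max (- K) (min K (lim (\<lambda>j. F j \<zeta>)))" for \<zeta>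
  have "0 \<le> K" using h_bdd[of \<rho>] by linarith
  have "f \<in> borel_measurable borel" unfolding f_def by measurable
  moreover have "\<bar>f \<zeta>\<bar> \<le> K" for \<zeta> using \<open>0 \<le> K\<close> by (auto simp: f_def)
  moreover have "AE \<omega> in P \<rho>. hlim \<omega> = f (tl \<omega>)"
    using lim AE_typical[of \<rho>]
  proof eventually_elim
    case (elim \<omega>)
    have "(\<lambda>n. \<bar>h (\<omega> n)\<bar>) \<longlonglongrightarrow> \<bar>hlim \<omega>\<bar>" using elim(2) by (intro tendsto_rabs) (simp add: typical_def)
    then have "\<bar>hlim \<omega>\<bar> \<le> K" by (rule LIMSEQ_le_const2) (use h_bdd in auto)
    then show ?case using limI[OF elim(1)] by (simp add: f_def abs_le_iff)
  qed
  ultimately show ?thesis by blast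
qed

text \<open>Being a given function of the landing point is a shift-invariant property of
  \<open>hlim\<close>, so \<open>invariant_AE\<close> spreads it from the root to every start. The
  mean of \<open>hlim\<close> from \<open>v\<close> is \<open>h v\<close>, by dominated convergence
  for the bounded martingale.\<close>

theorem representation:
  "\<exists>f :: complex \<Rightarrow> real. f \<in> borel_measurable borel \<and> bounded (range f) \<and>
    (\<forall>v. h v = (\<integral>\<omega>. f (tl \<omega>) \<partial>P v))"
proof -
  obtain f :: "complex \<Rightarrow> real" where f [measurable]: "f \<in> borel_measurable borel" and fK: "\<And>\<zeta>. \<bar>f \<zeta>\<bar> \<le> K"
    and AE: "AE \<omega> in P \<rho>. hlim \<omega> = f (tl \<omega>)"
    using boundary_function by blast
  define B where "B = {\<omega>. \<omega> \<in> regular \<and> Cauchy (\<lambda>n. h (\<omega> n)) \<and> hlim \<omega> = f (tl \<omega>)}"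
  have B: "B \<in> sets walk_space"
  proof -
    have [measurable]: "(\<lambda>\<omega>. f (tl \<omega>)) \<in> borel_measurable walk_space"
      by (rule measurable_compose[OF tl_measurable f])
    have "B = regular \<inter> {\<omega> \<in> space walk_space. Cauchy (\<lambda>n. h (\<omega> n))} \<inter>
        {\<omega> \<in> space walk_space. hlim \<omega> = f (tl \<omega>)}"
      by (auto simp: B_def)
    also have "\<dots> \<in> sets walk_space" by measurable
    finally show ?thesis .
  qed
  have inv: "shift 1 \<omega> \<in> B \<longleftrightarrow> \<omega> \<in> B" for \<omega>
  proof -
    have c: "convergent (\<lambda>n. h (shift 1 \<omega> n)) \<longleftrightarrow> convergent (\<lambda>n. h (\<omega> n))"
      unfolding convergent_def LIMSEQ_shift[of h] ..
    have "hlim (shift 1 \<omega>) = hlim \<omega>" if "convergent (\<lambda>n. h (\<omega> n))"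
    proof -
      have "(\<lambda>n. h (shift 1 \<omega> n)) \<longlonglongrightarrow> hlim \<omega>"
        unfolding LIMSEQ_shift[of h] using that by (simp add: hlim_def convergent_LIMSEQ_iff)
      then show ?thesis unfolding hlim_def[of "shift 1 \<omega>"] by (rule limI)
    qed
    then show ?thesis
      unfolding B_def mem_Collect_eq Cauchy_convergent_iff c
      using regular_shift[of 1 \<omega>] tl_shift[of \<omega> 1] by metis
  qed
  have "AE \<omega> in P \<rho>. \<omega> \<in> B"
    using AE AE_typical[of \<rho>]
    by eventually_elim (auto simp: B_def typical_def Cauchy_convergent_iff convergent_def)
  then have AE_all: "AE \<omega> in P v. \<omega> \<in> B" for v
    by (rule invariant_AE[OF B inv])
  have "avg h = h" by (rule ext) (rule h_harmonic[symmetric])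
  then have h_inv: "avgn n h = h" for n by (induction n) (auto simp: avgn_Suc)
  have "h v = (\<integral>\<omega>. f (tl \<omega>) \<partial>P v)" for v
  proof -
    have "(\<lambda>n. \<integral>\<omega>. h (\<omega> n) \<partial>P v) \<longlonglongrightarrow> (\<integral>\<omega>. hlim \<omega> \<partial>P v)"
    proof (rule integral_dominated_convergence[where w = "\<lambda>_. K"])
      show "AE \<omega> in P v. (\<lambda>n. h (\<omega> n)) \<longlonglongrightarrow> hlim \<omega>"
        using AE_typical[of v] by eventually_elim (simp add: typical_def)
    qed (auto simp: measurable_P_eq h_bdd)
    moreover have "(\<integral>\<omega>. h (\<omega> n) \<partial>P v) = h v" for n
      using expectation_coord[of h K v n, OF h_bdd] by (simp add: h_inv)
    ultimately have "h v = (\<integral>\<omega>. hlim \<omega> \<partial>P v)" by (simp add: LIMSEQ_const_iff)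
    also have "\<dots> = (\<integral>\<omega>. f (tl \<omega>) \<partial>P v)"
    proof (rule integral_cong_AE)
      show "AE \<omega> in P v. hlim \<omega> = f (tl \<omega>)"
        using AE_all[of v] by eventually_elim (simp add: B_def)
    qed (auto simp: measurable_P_eq)
    finally show ?thesis .
  qed
  moreover have "bounded (range f)" using fK by (auto simp: bounded_iff)
  ultimately show ?thesis using f by blast
qed

end

theorem theorem1p1:
  fixes ends :: "'e \<Rightarrow> 'v \<times> 'v" and c :: "'e \<Rightarrow> real"
    and pos :: "'v \<Rightarrow> complex" and \<gamma> :: "'e \<Rightarrow> real \<Rightarrow> complex"
    and P :: "'v \<Rightarrow> (nat \<Rightarrow> 'v) measure" and \<rho> :: 'v
    and a :: "'e \<Rightarrow> real" and \<theta> :: "'v \<Rightarrow> real" and h :: "'v \<Rightarrow> real"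
  assumes "network ends c"
    and "plane_embedding ends pos \<gamma>"
    and "\<forall>v. rw_law ends c v (P v)"
    and "transient_at P \<rho>"
    and "rectangle_tiling ends c P \<rho> pos \<gamma> a"
    and "\<forall>v. \<theta> v \<in> vert_int ends c P \<rho> a v"
    and "AE \<omega> in P \<rho>. convergent (\<lambda>n. circ_pt (eta ends c P \<rho>) (\<theta> (\<omega> n))) \<and>
           (\<lambda>n. arc_length (eta ends c P \<rho>) (vert_int ends c P \<rho> a (\<omega> n))) \<longlonglongrightarrow> 0"
    and "harmonic ends c h" and "bounded (range h)"
  shows "\<exists>f :: complex \<Rightarrow> real. f \<in> borel_measurable borel \<and> bounded (range f) \<and>
           (\<forall>v. h v = (\<integral>\<omega>. f (lim (\<lambda>n. circ_pt (eta ends c P \<rho>) (\<theta> (\<omega> n)))) \<partial>P v))"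
proof -
  interpret network_walk ends c P
  proof
    show "network ends c" by fact
    show "rw_law ends c v (P v)" for v using assms(3) ..
  qed
  obtain K where K: "\<And>w. \<bar>h w\<bar> \<le> K"
    using assms(9) by (auto simp: bounded_iff)
  have h: "h w = avg h w" for w
    using assms(8) unfolding harmonic_def avg_def by blast
  interpret tiled_walk_harmonic ends c P \<rho> pos \<gamma> a \<theta> h K
  proof unfold_locales
    show "transient_at P \<rho>" "rectangle_tiling ends c P \<rho> pos \<gamma> a" by fact+
    show "\<theta> v \<in> vert_int ends c P \<rho> a v" for v using assms(6) ..
    show "AE \<omega> in P \<rho>. convergent (\<lambda>n. circ_pt (eta ends c P \<rho>) (\<theta> (\<omega> n))) \<and>
      (\<lambda>n. arc_length (eta ends c P \<rho>) (vert_int ends c P \<rho> a (\<omega> n))) \<longlonglongrightarrow> 0" by fact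
    show "h w = avg h w" "\<bar>h w\<bar> \<le> K" for w by (rule h, rule K)
  qed
  show ?thesis
    using representation unfolding tl_def .
qed

end
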